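(* Let $n\in\{2,3\}$ and $Y:=(0,1)^n$. Let $A\in L^{\infty}(Y;\mathbb{R}^{n\times n}_{\mathrm{sym}})$ be uniformly elliptic, i.e., there exist constants $\lambda,\Lambda>0$ such that $\lambda I_n\leq A\leq \Lambda I_n$ a.e. in $Y$, let $b\in L^{\infty}(Y;\mathbb{R}^n)$. Set $\hat{\delta}_0:=(1+\pi^2)^{-1}$ if $\|b\|_{L^\infty(Y)}\neq 0$ and $\hat{\delta}_0:=0$ otherwise. Suppose that there exists $\delta\in(\hat{\delta}_0,1]$ such that $$\frac{|A|^2+|b|^2}{(\mathrm{tr}(A))^2}\leq \frac{1}{n-1+\delta}\quad\text{a.e. in }Y.$$ Let $\gamma:=\frac{\mathrm{tr}(A)}{|A|^2+|b|^2}$, and let $\tilde{L}w:=-A:Dw-b\cdot w$ for $w\in H^1_t(Y;\mathbb{R}^n)$. Then there exists a constant $C>0$ such that the following holds for every $f\in L^2(Y)$, every $F\in H^1(Y;\mathbb{R}^n)$ with $f=-\nabla\cdot F$ a.e. in $Y$, and every closed linear subspace $P_h$ of $H^1_t(Y;\mathbb{R}^n)$. Let $\rho\in H^1_t(Y;\mathbb{R}^n)$ be the unique solution to $$(-\nabla\cdot\rho,\gamma\tilde{L}w)_{L^2(Y)}+(\mathrm{rot}(\rho),\mathrm{rot}(w))_{L^2(Y)}=(F,w)_{L^2(Y)}\quad\forall w\in H^1_t(Y;\mathbb{R}^n).$$ Then there exists a unique $\rho_h\in P_h$ such that $$(-\nabla\cdot\rho_h,\gamma\tilde{L}w_h)_{L^2(Y)}+(\mathrm{rot}(\rho_h),\mathrm{rot}(w_h))_{L^2(Y)}=(F,w_h)_{L^2(Y)}\quad\forall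 w_h\in P_h,$$ and we have the error bound $$\|\nabla\cdot(\rho-\rho_h)\|_{L^2(Y)}\leq C\inf_{w_h\in P_h}\|D(\rho-w_h)\|_{L^2(Y)}.$$
   Context: $\mathbb{R}^{n\times n}_{\mathrm{sym}}$ denotes the symmetric real $n\times n$ matrices, $I_n$ the identity matrix, and matrix inequalities are in the sense of quadratic forms. For matrices $M,N$, $M:N:=\sum_{i,j}M_{ij}N_{ij}$ and $|M|:=\sqrt{M:M}$; $|b|$ is the Euclidean norm. $Dw$ is the Jacobian of a vector field $w$. All functions are real-valued. $H^1_t(Y;\mathbb{R}^n)$ is the subset of $H^1(Y;\mathbb{R}^n)$ consisting of vector fields with vanishing tangential trace on $\partial Y$ (that is, on each face of the cube with normal direction $e_j$, the traces of all components $w_i$ with $i\neq j$ vanish); closedness of $P_h$ is with respect to the $H^1(Y;\mathbb{R}^n)$ norm. Convention: $\mathrm{rot}(w):=\partial_2w_1-\partial_1w_2$ when $n=2$, and $\mathrm{rot}(w):=\nabla\times w$ when $n=3$. *)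

theory Defs
  imports "HOL-Analysis.Analysis" "HOL-Probability.Essential_Supremum"
begin

text \<open>
  Elements of Lebesgue and Sobolev spaces are represented by functions on the whole of
  \<open>real^'n\<close>; values outside the domain are irrelevant, and functions that agree almost
  everywhere on the domain represent the same element.  Spaces over a domain \<open>\<Omega>\<close> are taken
  with respect to \<open>lebesgue_on \<Omega>\<close>.

  The library's inner product and norm on \<open>real^'n^'n\<close> are
  the Frobenius ones: \<open>M \<bullet> N\<close> is the sum of all \<open>M$i$j * N$i$j\<close>, that is \<open>M : N\<close>.
\<close>

section \<open>Lebesgue spaces\<close>

definition L2 :: "'a measure \<Rightarrow> ('a \<Rightarrow> 'b::euclidean_space) set" where
  "L2 M = {f. f \<in> borel_measurable M \<and> integrable M (\<lambda>x. (norm (f x))\<^sup>2)}"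

definition L2_inner :: "'a measure \<Rightarrow> ('a \<Rightarrow> 'b::euclidean_space) \<Rightarrow> ('a \<Rightarrow> 'b) \<Rightarrow> real" where
  "L2_inner M f g = (LINT x|M. f x \<bullet> g x)"

definition L2_norm :: "'a measure \<Rightarrow> ('a \<Rightarrow> 'b::euclidean_space) \<Rightarrow> real" where
  "L2_norm M f = sqrt (LINT x|M. (norm (f x))\<^sup>2)"

definition Linf_norm :: "'a measure \<Rightarrow> ('a \<Rightarrow> 'b::euclidean_space) \<Rightarrow> ereal" where
  "Linf_norm M f = esssup M (\<lambda>x. ereal (norm (f x)))"

definition Linf :: "'a measure \<Rightarrow> ('a \<Rightarrow> 'b::euclidean_space) set" where
  "Linf M = {f. f \<in> borel_measurable M \<and> Linf_norm M f < \<infinity>}"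

section \<open>Weak derivatives and first-order Sobolev spaces\<close>

definition partial :: "'n::finite \<Rightarrow> (real^'n \<Rightarrow> real) \<Rightarrow> real^'n \<Rightarrow> real" where
  "partial i f x = frechet_derivative f (at x) (axis i 1)"

primrec Ck :: "nat \<Rightarrow> (real^'n::finite \<Rightarrow> real) \<Rightarrow> bool" where
  "Ck 0 f \<longleftrightarrow> continuous_on UNIV f"
| "Ck (Suc k) f \<longleftrightarrow> f differentiable_on UNIV \<and> (\<forall>i. Ck k (partial i f))"

definition smooth :: "(real^'n::finite \<Rightarrow> real) \<Rightarrow> bool" where
  "smooth f \<longleftrightarrow> (\<forall>k. Ck k f)"

definition test_functions :: "(real^'n::finite) set \<Rightarrow> (real^'n \<Rightarrow> real) set" where
  "test_functions \<Omega> =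
     {\<phi>. smooth \<phi> \<and> compact (closure {x. \<phi> x \<noteq> 0}) \<and> closure {x. \<phi> x \<noteq> 0} \<subseteq> \<Omega>}"

definition has_weak_partial ::
  "(real^'n::finite) set \<Rightarrow> 'n \<Rightarrow> (real^'n \<Rightarrow> real) \<Rightarrow> (real^'n \<Rightarrow> real) \<Rightarrow> bool" where
  "has_weak_partial \<Omega> i u g \<longleftrightarrow>
     (\<forall>\<phi>\<in>test_functions \<Omega>.
        (LINT x|lebesgue_on \<Omega>. u x * partial i \<phi> x) = - (LINT x|lebesgue_on \<Omega>. g x * \<phi> x))"

definition H1 :: "(real^'n::finite) set \<Rightarrow> (real^'n \<Rightarrow> real) set" where
  "H1 \<Omega> = {u \<in> L2 (lebesgue_on \<Omega>). \<forall>i. \<exists>g \<in> L2 (lebesgue_on \<Omega>). has_weak_partial \<Omega> i u g}"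

text \<open>A representative of the weak derivative; for \<open>u \<in> H1 \<Omega>\<close>, \<open>\<Omega>\<close> open, it is determined a.e.\<close>

definition weak_partial ::
  "(real^'n::finite) set \<Rightarrow> 'n \<Rightarrow> (real^'n \<Rightarrow> real) \<Rightarrow> real^'n \<Rightarrow> real" where
  "weak_partial \<Omega> i u = (SOME g. g \<in> L2 (lebesgue_on \<Omega>) \<and> has_weak_partial \<Omega> i u g)"

definition H1_norm :: "(real^'n::finite) set \<Rightarrow> (real^'n \<Rightarrow> real) \<Rightarrow> real" where
  "H1_norm \<Omega> u =
     sqrt ((L2_norm (lebesgue_on \<Omega>) u)\<^sup>2
           + (\<Sum>i\<in>UNIV. (L2_norm (lebesgue_on \<Omega>) (weak_partial \<Omega> i u))\<^sup>2))"

definition H1_fields :: "(real^'n::finite) set \<Rightarrow> (real^'n \<Rightarrow> real^'n) set" where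
  "H1_fields \<Omega> = {w. \<forall>i. (\<lambda>x. w x $ i) \<in> H1 \<Omega>}"

text \<open>Row \<open>i\<close>, column \<open>j\<close> of the Jacobian holds the \<open>j\<close>-th derivative of the \<open>i\<close>-th component.\<close>

definition weak_jacobian ::
  "(real^'n::finite) set \<Rightarrow> (real^'n \<Rightarrow> real^'n) \<Rightarrow> real^'n \<Rightarrow> real^'n^'n" where
  "weak_jacobian \<Omega> w x = (\<chi> i j. weak_partial \<Omega> j (\<lambda>y. w y $ i) x)"

definition divergence ::
  "(real^'n::finite) set \<Rightarrow> (real^'n \<Rightarrow> real^'n) \<Rightarrow> real^'n \<Rightarrow> real" where
  "divergence \<Omega> w x = (\<Sum>i\<in>UNIV. weak_partial \<Omega> i (\<lambda>y. w y $ i) x)"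

definition rot2 :: "(real^2) set \<Rightarrow> (real^2 \<Rightarrow> real^2) \<Rightarrow> real^2 \<Rightarrow> real" where
  "rot2 \<Omega> w x = weak_partial \<Omega> 2 (\<lambda>y. w y $ 1) x - weak_partial \<Omega> 1 (\<lambda>y. w y $ 2) x"

definition rot3 :: "(real^3) set \<Rightarrow> (real^3 \<Rightarrow> real^3) \<Rightarrow> real^3 \<Rightarrow> real^3" where
  "rot3 \<Omega> w x = vector
     [weak_partial \<Omega> 2 (\<lambda>y. w y $ 3) x - weak_partial \<Omega> 3 (\<lambda>y. w y $ 2) x,
      weak_partial \<Omega> 3 (\<lambda>y. w y $ 1) x - weak_partial \<Omega> 1 (\<lambda>y. w y $ 3) x,
      weak_partial \<Omega> 1 (\<lambda>y. w y $ 2) x - weak_partial \<Omega> 2 (\<lambda>y. w y $ 1) x]"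

definition H1_field_norm :: "(real^'n::finite) set \<Rightarrow> (real^'n \<Rightarrow> real^'n) \<Rightarrow> real" where
  "H1_field_norm \<Omega> w =
     sqrt ((L2_norm (lebesgue_on \<Omega>) w)\<^sup>2 + (L2_norm (lebesgue_on \<Omega>) (weak_jacobian \<Omega> w))\<^sup>2)"

section \<open>The unit cube and tangential traces\<close>

definition cube :: "(real^'n::finite) set" where
  "cube = {x. \<forall>i. 0 < x $ i \<and> x $ i < 1}"

abbreviation cube_measure :: "(real^'n::finite) measure" where
  "cube_measure \<equiv> lebesgue_on cube"

text \<open>
  Surface measure on the face of the unit cube where the \<open>j\<close>-th coordinate equals \<open>c\<close>
  (\<open>c\<close> being 0 or 1): since the cube has unit length in direction \<open>j\<close>, the image of
  \<open>n\<close>-dimensional Lebesgue measure under projection onto the face is the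
  \<open>(n-1)\<close>-dimensional Lebesgue measure of the face.
\<close>

definition face_measure :: "'n::finite \<Rightarrow> real \<Rightarrow> (real^'n) measure" where
  "face_measure j c = distr cube_measure borel (\<lambda>x. \<chi> k. if k = j then c else x $ k)"

text \<open>
  The trace operator is the continuous extension from smooth functions up to the boundary:
  \<open>g\<close> is the trace of \<open>u\<close> on a face if smooth functions converge to \<open>u\<close> in \<open>H1 cube\<close> while
  their restrictions converge to \<open>g\<close> in the \<open>L2\<close> space of the face.
\<close>

definition has_trace ::
  "'n::finite \<Rightarrow> real \<Rightarrow> (real^'n \<Rightarrow> real) \<Rightarrow> (real^'n \<Rightarrow> real) \<Rightarrow> bool" where
  "has_trace j c u g \<longleftrightarrow> g \<in> L2 (face_measure j c) \<and>
     (\<exists>\<phi> :: nat \<Rightarrow> real^'n \<Rightarrow> real. (\<forall>k. smooth (\<phi> k)) \<and>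
        (\<lambda>k. H1_norm cube (\<lambda>x. \<phi> k x - u x)) \<longlonglongrightarrow> 0 \<and>
        (\<lambda>k. L2_norm (face_measure j c) (\<lambda>x. \<phi> k x - g x)) \<longlonglongrightarrow> 0)"

definition H1t :: "(real^'n::finite \<Rightarrow> real^'n) set" where
  "H1t = {w \<in> H1_fields cube.
            \<forall>j. \<forall>c\<in>{0, 1}. \<forall>i. i \<noteq> j \<longrightarrow> has_trace j c (\<lambda>x. w x $ i) (\<lambda>_. 0)}"

text \<open>
  Closedness with constant sequences makes \<open>P\<close> invariant under changes on null sets, so \<open>P\<close>
  really is a set of equivalence classes.
\<close>

definition closed_subspace :: "(real^'n::finite \<Rightarrow> real^'n) set \<Rightarrow> bool" where
  "closed_subspace P \<longleftrightarrow> P \<subseteq> H1t \<and> (\<lambda>_. 0) \<in> P \<and>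
     (\<forall>u\<in>P. \<forall>v\<in>P. (\<lambda>x. u x + v x) \<in> P) \<and>
     (\<forall>u\<in>P. \<forall>a::real. (\<lambda>x. a *\<^sub>R u x) \<in> P) \<and>
     (\<forall>s :: nat \<Rightarrow> real^'n \<Rightarrow> real^'n. \<forall>u\<in>H1t. (\<forall>k. s k \<in> P) \<and>
        (\<lambda>k. H1_field_norm cube (\<lambda>x. s k x - u x)) \<longlonglongrightarrow> 0 \<longrightarrow> u \<in> P)"

section \<open>Coefficients and the variational problem\<close>

definition form_le :: "real^'n::finite^'n \<Rightarrow> real^'n^'n \<Rightarrow> bool" where
  "form_le M N \<longleftrightarrow> (\<forall>v. v \<bullet> (M *v v) \<le> v \<bullet> (N *v v))"

definition uniformly_elliptic :: "(real^'n::finite \<Rightarrow> real^'n^'n) \<Rightarrow> bool" where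
  "uniformly_elliptic A \<longleftrightarrow>
     (\<exists>l>0. \<exists>u>0. AE x in cube_measure. form_le (l *\<^sub>R mat 1) (A x) \<and> form_le (A x) (u *\<^sub>R mat 1))"

definition delta0 :: "(real^'n::finite \<Rightarrow> real^'n) \<Rightarrow> real" where
  "delta0 b = (if Linf_norm cube_measure b \<noteq> 0 then inverse (1 + pi\<^sup>2) else 0)"

definition gam ::
  "(real^'n::finite \<Rightarrow> real^'n^'n) \<Rightarrow> (real^'n \<Rightarrow> real^'n) \<Rightarrow> real^'n \<Rightarrow> real" where
  "gam A b x = trace (A x) / ((norm (A x))\<^sup>2 + (norm (b x))\<^sup>2)"

definition Ltilde ::
  "(real^'n::finite \<Rightarrow> real^'n^'n) \<Rightarrow> (real^'n \<Rightarrow> real^'n) \<Rightarrow> (real^'n \<Rightarrow> real^'n)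
    \<Rightarrow> real^'n \<Rightarrow> real" where
  "Ltilde A b w x = - (A x \<bullet> weak_jacobian cube w x) - b x \<bullet> w x"

text \<open>
  Galerkin problem in the space \<open>V\<close>.  The rotation is a parameter because its
  values are scalars in two and vectors in three dimensions.
\<close>

definition solves ::
  "((real^'n::finite \<Rightarrow> real^'n) \<Rightarrow> real^'n \<Rightarrow> 'r::euclidean_space)
    \<Rightarrow> (real^'n \<Rightarrow> real^'n^'n) \<Rightarrow> (real^'n \<Rightarrow> real^'n) \<Rightarrow> (real^'n \<Rightarrow> real^'n)
    \<Rightarrow> (real^'n \<Rightarrow> real^'n) set \<Rightarrow> (real^'n \<Rightarrow> real^'n) \<Rightarrow> bool" where
  "solves rot A b F V r \<longleftrightarrow> r \<in> V \<and>
     (\<forall>w\<in>V.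
        L2_inner cube_measure (\<lambda>x. - divergence cube r x) (\<lambda>x. gam A b x * Ltilde A b w x)
        + L2_inner cube_measure (rot r) (rot w)
        = L2_inner cube_measure F w)"

definition unique_solution ::
  "((real^'n::finite \<Rightarrow> real^'n) \<Rightarrow> real^'n \<Rightarrow> 'r::euclidean_space)
    \<Rightarrow> (real^'n \<Rightarrow> real^'n^'n) \<Rightarrow> (real^'n \<Rightarrow> real^'n) \<Rightarrow> (real^'n \<Rightarrow> real^'n)
    \<Rightarrow> (real^'n \<Rightarrow> real^'n) set \<Rightarrow> (real^'n \<Rightarrow> real^'n) \<Rightarrow> bool" where
  "unique_solution rot A b F V r \<longleftrightarrow> solves rot A b F V r \<and>
     (\<forall>s. solves rot A b F V s \<longrightarrow> (AE x in cube_measure. s x = r x))"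

end

theory Submission
  imports Defs
begin

text \<open>
  After multiplication by \<open>\<gamma>\<close> the Cordes condition reads \<open>|\<gamma> A - I|\<^sup>2 + |\<gamma> b|\<^sup>2 \<le> 1 - \<delta>\<close>, so the bilinear form
  is a perturbation of \<open>(div \<rho>, div w) + (rot \<rho>, rot w)\<close>.  For fields with vanishing tangential
  trace on the cube this principal part equals \<open>(D \<rho>, D w)\<close>, and the Poincare inequality with the
  sharp constant \<open>1 / \<pi>\<close> bounds \<open>w\<close> by \<open>D w\<close>; the perturbation then has norm less than one
  relative to the norm \<open>D w\<close>, which gives solvability on every closed subspace by contraction and
  the error bound by Cea's argument.

  Both facts about the cube are first verified for the smooth functions \<open>sin (\<pi> x\<^sub>i) q\<close>, which are dense in
  \<open>H1\<close> among the functions with zero trace on the faces normal to \<open>e\<^sub>i\<close>: a function in the \<open>H1\<close>-orthogonal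
  complement is \<open>L2\<close>-orthogonal to all eigenfunctions \<open>sin (k\<^sub>i \<pi> x\<^sub>i) \<Prod> cos (k\<^sub>l \<pi> x\<^sub>l)\<close> of the Laplacian,
  hence zero by the Stone-Weierstrass theorem.
\<close>

section \<open>Semi-inner product spaces of functions\<close>

text \<open>Elements of the function spaces are functions, not classes, so all Hilbert space
  arguments are made for a positive semidefinite form on a set of functions, with distance zero in
  place of equality. The obstacle is that a zero trace is witnessed by smooth functions that are
  merely small on one face, with an unrelated sequence for every face, while the computations call
  for approximants that vanish exactly on two opposite faces. This is why zero trace is first turned
  into integral identities, which are stable under limits, and the approximants are then produced by
  duality. The threshold for \<delta> is the size of the perturbation: with norms in L2, |(div u,
  pert w)| <= |Du| |pert w| and |pert w|^2 <= (1 - \<delta>)(|Dw|^2 + |w|^2) <= (1 - \<delta>)(1 +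
  1/pi^2) |Dw|^2, and the last factor is below one exactly for \<delta> > 1/(1 + pi^2). Without
  \<open>b\<close> the term |w|^2 is absent and \<delta> > 0 suffices. A weaker Poincare constant,
  or a bound of div u by Du with a constant above one, would miss this threshold.\<close>

locale semi_inner_space =
  fixes V :: "('x \<Rightarrow> 'b::real_vector) set" and ip :: "('x \<Rightarrow> 'b) \<Rightarrow> ('x \<Rightarrow> 'b) \<Rightarrow> real"
  assumes zero: "(\<lambda>_. 0) \<in> V"
    and add: "u \<in> V \<Longrightarrow> v \<in> V \<Longrightarrow> (\<lambda>x. u x + v x) \<in> V"
    and scale: "u \<in> V \<Longrightarrow> (\<lambda>x. a *\<^sub>R u x) \<in> V"
    and sym: "u \<in> V \<Longrightarrow> v \<in> V \<Longrightarrow> ip u v = ip v u"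
    and ip_add: "u \<in> V \<Longrightarrow> v \<in> V \<Longrightarrow> w \<in> V \<Longrightarrow> ip (\<lambda>x. u x + v x) w = ip u w + ip v w"
    and ip_scale: "u \<in> V \<Longrightarrow> w \<in> V \<Longrightarrow> ip (\<lambda>x. a *\<^sub>R u x) w = a * ip u w"
    and nonneg: "u \<in> V \<Longrightarrow> 0 \<le> ip u u"
begin

definition sn :: "('x \<Rightarrow> 'b) \<Rightarrow> real" where "sn u = sqrt (ip u u)"

text \<open>Linearity is part of the notion. A bound by the seminorm makes \<open>l\<close> agree on
  functions at distance zero, so \<open>l\<close> is in effect a functional on classes.\<close>

definition bounded_functional :: "(('x \<Rightarrow> 'b) \<Rightarrow> real) \<Rightarrow> bool" where
  "bounded_functional l \<longleftrightarrow>
     (\<forall>u\<in>V. \<forall>v\<in>V. l (\<lambda>x. u x + v x) = l u + l v) \<and>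
     (\<forall>u\<in>V. \<forall>a. l (\<lambda>x. a *\<^sub>R u x) = a * l u) \<and>
     (\<exists>K\<ge>0. \<forall>u\<in>V. \<bar>l u\<bar> \<le> K * sn u)"

lemma bounded_functionalI:
  assumes "\<And>u v. u \<in> V \<Longrightarrow> v \<in> V \<Longrightarrow> l (\<lambda>x. u x + v x) = l u + l v"
    and "\<And>u a. u \<in> V \<Longrightarrow> l (\<lambda>x. a *\<^sub>R u x) = a * l u"
    and "0 \<le> K" "\<And>u. u \<in> V \<Longrightarrow> \<bar>l u\<bar> \<le> K * sn u"
  shows "bounded_functional l"
  using assms unfolding bounded_functional_def by auto

lemma diff: "u \<in> V \<Longrightarrow> v \<in> V \<Longrightarrow> (\<lambda>x. u x - v x) \<in> V"
  using add[of u "\<lambda>x. (-1) *\<^sub>R v x"] scale[of v "-1"] by simp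

lemma ip_diff:
  assumes "u \<in> V" "v \<in> V" "w \<in> V"
  shows "ip (\<lambda>x. u x - v x) w = ip u w - ip v w"
  using ip_add[of u "\<lambda>x. (-1) *\<^sub>R v x" w] scale[of v "-1"] ip_scale[of v w "-1"] assms by simp

lemma ip_add_right:
  assumes "u \<in> V" "v \<in> V" "w \<in> V"
  shows "ip w (\<lambda>x. u x + v x) = ip w u + ip w v"
  using ip_add[OF assms] sym[OF assms(3) add[OF assms(1,2)]] sym[OF assms(3,1)] sym[OF assms(3,2)] by simp

lemma ip_scale_right:
  assumes "u \<in> V" "w \<in> V"
  shows "ip w (\<lambda>x. a *\<^sub>R u x) = a * ip w u"
  using ip_scale[OF assms, of a] sym[OF assms(2) scale[OF assms(1)]] sym[OF assms(2,1)] by simp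

lemma ip_diff_right:
  assumes "u \<in> V" "v \<in> V" "w \<in> V"
  shows "ip w (\<lambda>x. u x - v x) = ip w u - ip w v"
  using ip_diff[OF assms] sym[OF assms(3) diff[OF assms(1,2)]] sym[OF assms(3,1)] sym[OF assms(3,2)] by simp

lemma sn_nonneg [simp]: "u \<in> V \<Longrightarrow> 0 \<le> sn u"
  by (simp add: sn_def nonneg)

lemma sn_square: "u \<in> V \<Longrightarrow> (sn u)\<^sup>2 = ip u u"
  by (simp add: sn_def nonneg)

lemma ip_expand:
  assumes "u \<in> V" "v \<in> V"
  shows "ip (\<lambda>x. u x + t *\<^sub>R v x) (\<lambda>x. u x + t *\<^sub>R v x) = ip u u + 2 * t * ip u v + t\<^sup>2 * ip v v"
proof -
  have tv: "(\<lambda>x. t *\<^sub>R v x) \<in> V" using assms scale by auto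
  have "ip (\<lambda>x. u x + t *\<^sub>R v x) (\<lambda>x. u x + t *\<^sub>R v x)
      = ip u (\<lambda>x. u x + t *\<^sub>R v x) + ip (\<lambda>x. t *\<^sub>R v x) (\<lambda>x. u x + t *\<^sub>R v x)"
    using assms tv add by (intro ip_add) auto
  also have "\<dots> = ip u u + ip u (\<lambda>x. t *\<^sub>R v x) + (ip (\<lambda>x. t *\<^sub>R v x) u + ip (\<lambda>x. t *\<^sub>R v x) (\<lambda>x. t *\<^sub>R v x))"
    using assms tv by (simp add: ip_add_right)
  also have "\<dots> = ip u u + 2 * t * ip u v + t\<^sup>2 * ip v v"
    using assms tv by (simp add: ip_scale_right ip_scale sym[of v u] power2_eq_square)
  finally show ?thesis .
qed

text \<open>The quadratic in \<open>t\<close> given by \<open>ip_expand\<close> is never negative.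
  If \<open>ip v v > 0\<close>, its minimum gives the claim. As the form is only semidefinite,
  \<open>ip v v = 0\<close> does not make \<open>v\<close> zero; then the quadratic is affine in
  \<open>t\<close>, so its slope must vanish.\<close>

lemma Cauchy_Schwarz:
  assumes u: "u \<in> V" and v: "v \<in> V"
  shows "\<bar>ip u v\<bar> \<le> sn u * sn v"
proof -
  have q: "0 \<le> ip u u + 2 * t * ip u v + t\<^sup>2 * ip v v" for t
    using nonneg[OF add[OF u scale[OF v, of t]]] ip_expand[OF u v, of t] by simp
  have "(ip u v)\<^sup>2 \<le> ip u u * ip v v"
  proof (cases "ip v v = 0")
    case True
    have "ip u v = 0"
    proof (rule ccontr)
      assume "ip u v \<noteq> 0"
      \<comment> \<open>At this \<open>t\<close> the affine function takes the value -1.\<close>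
      with q[of "- (ip u u + 1) / (2 * ip u v)"] True show False by (simp add: field_simps)
    qed
    with True show ?thesis by simp
  next
    case False
    then have pos: "ip v v > 0" using nonneg[OF v] by simp
    have "0 \<le> ip u u - (ip u v)\<^sup>2 / ip v v"
      using q[of "- ip u v / ip v v"] pos by (simp add: power2_eq_square field_simps)
    then show ?thesis using pos by (simp add: field_simps)
  qed
  then have "sqrt ((ip u v)\<^sup>2) \<le> sqrt (ip u u * ip v v)" by (rule real_sqrt_le_mono)
  then show ?thesis by (simp add: sn_def real_sqrt_mult)
qed

lemma sn_triangle:
  assumes u: "u \<in> V" and v: "v \<in> V"
  shows "sn (\<lambda>x. u x + v x) \<le> sn u + sn v"
proof -
  have "(sn (\<lambda>x. u x + v x))\<^sup>2 = (sn u)\<^sup>2 + 2 * ip u v + (sn v)\<^sup>2"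
    using ip_expand[OF u v, of 1] by (simp add: sn_square u v add)
  also have "\<dots> \<le> (sn u)\<^sup>2 + 2 * (sn u * sn v) + (sn v)\<^sup>2"
    using Cauchy_Schwarz[OF u v] by simp
  also have "\<dots> = (sn u + sn v)\<^sup>2" by (simp add: power2_sum)
  finally show ?thesis by (rule power2_le_imp_le) (simp add: u v)
qed

lemma sn_scale: "u \<in> V \<Longrightarrow> sn (\<lambda>x. a *\<^sub>R u x) = \<bar>a\<bar> * sn u"
  by (simp add: sn_def ip_scale ip_scale_right scale real_sqrt_mult)

lemma sn_commute:
  assumes "u \<in> V" "v \<in> V"
  shows "sn (\<lambda>x. u x - v x) = sn (\<lambda>x. v x - u x)"
  using sn_scale[OF diff[OF assms], of "-1"] by simp

lemma sn_triangle_diff: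
  assumes "u \<in> V" "v \<in> V" "w \<in> V"
  shows "sn (\<lambda>x. u x - w x) \<le> sn (\<lambda>x. u x - v x) + sn (\<lambda>x. v x - w x)"
  using sn_triangle[OF diff[OF assms(1,2)] diff[OF assms(2,3)]] by simp

definition Cauchy_in :: "(nat \<Rightarrow> 'x \<Rightarrow> 'b) \<Rightarrow> bool" where
  "Cauchy_in s \<longleftrightarrow> (\<forall>e>0. \<exists>N. \<forall>m\<ge>N. \<forall>n\<ge>N. sn (\<lambda>x. s m x - s n x) < e)"

text \<open>
  The minimizing sequence of the quadratic functional \<open>ip v v - 2 * l v\<close> is Cauchy by the
  parallelogram law, and first-order optimality holds in the limit; no completeness is needed.
\<close>

lemma Riesz_sequence:
  assumes l: "bounded_functional l"
  obtains d where "\<And>k. d k \<in> V" "Cauchy_in d" "\<And>z. z \<in> V \<Longrightarrow> (\<lambda>k. ip (d k) z) \<longlonglongrightarrow> l z"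
proof -
  from l obtain K where l_add: "\<And>u v. u \<in> V \<Longrightarrow> v \<in> V \<Longrightarrow> l (\<lambda>x. u x + v x) = l u + l v"
    and l_scale: "\<And>u a. u \<in> V \<Longrightarrow> l (\<lambda>x. a *\<^sub>R u x) = a * l u"
    and K: "\<And>u. u \<in> V \<Longrightarrow> \<bar>l u\<bar> \<le> K * sn u"
    unfolding bounded_functional_def by blast
  define J where "J v = ip v v - 2 * l v" for v
  have J_lower: "- K\<^sup>2 \<le> J v" if "v \<in> V" for v
  proof -
    have "l v \<le> K * sn v" using K[OF that] by simp
    moreover have "0 \<le> (sn v - K)\<^sup>2" by simp
    ultimately show ?thesis
      unfolding J_def sn_square[OF that, symmetric] by (simp add: power2_diff mult.commute)
  qed
  define I where "I = Inf (J ` V)"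
  have bdd: "bdd_below (J ` V)" using J_lower by (intro bdd_belowI2)
  have I_le: "I \<le> J v" if "v \<in> V" for v
    unfolding I_def using bdd that by (simp add: cINF_lower)
  have "\<exists>v\<in>V. J v < I + 1 / (real k + 1)" for k :: nat
  proof -
    have "Inf (J ` V) < I + 1 / (real k + 1)" unfolding I_def by simp
    then show ?thesis using cInf_lessD[of "J ` V"] zero by auto
  qed
  then obtain d where dV: "\<And>k. d k \<in> V" and d: "\<And>k. J (d k) < I + 1 / (real k + 1)"
    by metis
  \<comment> \<open>The midpoint of \<open>d m\<close> and \<open>d n\<close> lies in
    \<open>V\<close>, so \<open>J\<close> there is at least \<open>I\<close>, while
    \<open>J (d k)\<close> exceeds \<open>I\<close> by less than \<open>1 / (k + 1)\<close>; the
    parallelogram law turns this gap into a bound of the distance.\<close>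
  have close: "ip (\<lambda>x. d m x - d n x) (\<lambda>x. d m x - d n x) \<le> 2 * (1 / (real m + 1) + 1 / (real n + 1))" for m n
  proof -
    let ?s = "\<lambda>x. (1/2) *\<^sub>R (d m x + d n x)"
    have s: "?s \<in> V" using scale[OF add[OF dV dV], of "1/2" m n] by simp
    have e1: "ip (\<lambda>x. d m x + d n x) (\<lambda>x. d m x + d n x) = ip (d m) (d m) + 2 * ip (d m) (d n) + ip (d n) (d n)"
      using ip_expand[OF dV dV, of m 1 n] by simp
    have e2: "ip (\<lambda>x. d m x - d n x) (\<lambda>x. d m x - d n x) = ip (d m) (d m) - 2 * ip (d m) (d n) + ip (d n) (d n)"
      using ip_expand[OF dV dV, of m "-1" n] by simp
    have e3: "ip ?s ?s = (1/4) * ip (\<lambda>x. d m x + d n x) (\<lambda>x. d m x + d n x)"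
      using add[OF dV dV, of m n] s by (simp add: ip_scale ip_scale_right del: scaleR_add_right)
    have e4: "l ?s = (1/2) * (l (d m) + l (d n))"
      using l_scale[OF add[OF dV dV, of m n], of "1/2"] l_add[OF dV dV] by simp
    have "2 * J ?s = J (d m) + J (d n) - (1/2) * ip (\<lambda>x. d m x - d n x) (\<lambda>x. d m x - d n x)"
      unfolding J_def e3 e1 e2 e4 by (simp add: field_simps)
    then show ?thesis using I_le[OF s] d[of m] d[of n] by simp
  qed
  have "Cauchy_in d"
    unfolding Cauchy_in_def
  proof (intro allI impI)
    fix e :: real assume e: "e > 0"
    \<comment> \<open>By \<open>close\<close> the squared distance is at most
      \<open>4 / (N + 1)\<close> beyond \<open>N\<close>.\<close>
    obtain N :: nat where N: "4 / e\<^sup>2 < real N" using reals_Archimedean2 by blast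
    show "\<exists>N. \<forall>m\<ge>N. \<forall>n\<ge>N. sn (\<lambda>x. d m x - d n x) < e"
    proof (intro exI allI impI)
      fix m n assume mn: "N \<le> m" "N \<le> n"
      have N0: "0 < real N + 1" by simp
      have "1 / (real m + 1) \<le> 1 / (real N + 1)" "1 / (real n + 1) \<le> 1 / (real N + 1)"
        using mn by (auto intro!: divide_left_mono)
      then have "ip (\<lambda>x. d m x - d n x) (\<lambda>x. d m x - d n x) \<le> 4 / (real N + 1)"
        using close[of m n] by simp
      also have "\<dots> < e\<^sup>2" using N e N0 by (simp add: field_simps) (smt (verit) zero_less_power)
      finally show "sn (\<lambda>x. d m x - d n x) < e"
        unfolding sn_def using e real_sqrt_less_mono by fastforce
    qed
  qed
  moreover have "(\<lambda>k. ip (d k) z) \<longlonglongrightarrow> l z" if z: "z \<in> V" for z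
  proof -
    define s where "s = ip z z"
    have bound: "\<bar>ip (d k) z - l z\<bar> \<le> sqrt (1 / (real k + 1)) * ((s + 1) / 2)" for k
    proof -
      define r where "r = ip (d k) z - l z"
      define e where "e = 1 / (real k + 1)"
      have e: "e > 0" unfolding e_def by simp
      have q: "0 \<le> 2 * t * r + t\<^sup>2 * s + e" for t
      proof -
        have tz: "(\<lambda>x. t *\<^sub>R z x) \<in> V" using z scale by auto
        have "J (\<lambda>x. d k x + t *\<^sub>R z x) = J (d k) + 2 * t * r + t\<^sup>2 * s"
          unfolding J_def r_def s_def ip_expand[OF dV z] l_add[OF dV tz] l_scale[OF z]
          by (simp add: algebra_simps)
        then show ?thesis using I_le[OF add[OF dV tz], of k] d[of k] unfolding e_def by simp
      qed
      \<comment> \<open>Perturbing the near-minimizer by \<open>t z\<close> lowers \<open>J\<close>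
        by at most \<open>e\<close>. Taking \<open>t\<close> as plus or minus \<open>sqrt e\<close>
        balances the linear term \<open>2 t r\<close> against the errors \<open>t\<^sup>2 s\<close>
        and \<open>e\<close>.\<close>
      have "2 * sqrt e * \<bar>r\<bar> \<le> e * s + e"
        using q[of "sqrt e"] q[of "- sqrt e"] e by (cases "r \<ge> 0") auto
      moreover have "sqrt e * (sqrt e * (s + 1)) = e * (s + 1)"
        using e by (simp flip: mult.assoc)
      ultimately have "sqrt e * (2 * \<bar>r\<bar>) \<le> sqrt e * (sqrt e * (s + 1))"
        by (simp add: algebra_simps)
      then have "2 * \<bar>r\<bar> \<le> sqrt e * (s + 1)" using e by simp
      then show ?thesis unfolding r_def e_def by simp
    qed
    have "(\<lambda>k. sqrt (1 / (real k + 1)) * ((s + 1) / 2)) \<longlonglongrightarrow> sqrt 0 * ((s + 1) / 2)"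
      by (intro tendsto_intros) (use LIMSEQ_inverse_real_of_nat in \<open>simp add: inverse_eq_divide add.commute\<close>)
    then have "(\<lambda>k. sqrt (1 / (real k + 1)) * ((s + 1) / 2)) \<longlonglongrightarrow> 0" by simp
    then have "(\<lambda>k. ip (d k) z - l z) \<longlonglongrightarrow> 0"
      by (rule Lim_null_comparison[OF always_eventually, rotated]) (use bound in auto)
    then show ?thesis by (simp add: LIM_zero_iff)
  qed
  ultimately show ?thesis by (rule that[of d, OF dV])
qed

lemma tendsto_ip:
  assumes "\<And>k. d k \<in> V" "u \<in> V" "z \<in> V" "(\<lambda>k. sn (\<lambda>x. d k x - u x)) \<longlonglongrightarrow> 0"
  shows "(\<lambda>k. ip (d k) z) \<longlonglongrightarrow> ip u z"
proof -
  have "(\<lambda>k. sn (\<lambda>x. d k x - u x) * sn z) \<longlonglongrightarrow> 0"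
    using tendsto_mult_right[OF assms(4), of "sn z"] by simp
  then have "(\<lambda>k. ip (d k) z - ip u z) \<longlonglongrightarrow> 0"
    by (rule Lim_null_comparison[OF always_eventually, rotated])
       (use Cauchy_Schwarz[OF diff[OF assms(1,2)] assms(3)] assms in \<open>simp add: ip_diff\<close>)
  then show ?thesis by (simp add: LIM_zero_iff)
qed

end

section \<open>Riesz representation and its perturbation in complete spaces\<close>

locale complete_semi_inner_space = semi_inner_space +
  assumes complete: "(\<And>k. s k \<in> V) \<Longrightarrow> Cauchy_in s \<Longrightarrow> \<exists>u\<in>V. (\<lambda>k. sn (\<lambda>x. s k x - u x)) \<longlonglongrightarrow> 0"
begin

lemma Riesz:
  assumes "bounded_functional l"
  obtains u where "u \<in> V" "\<And>z. z \<in> V \<Longrightarrow> ip u z = l z"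
proof -
  obtain d where d: "\<And>k. d k \<in> V" "Cauchy_in d" "\<And>z. z \<in> V \<Longrightarrow> (\<lambda>k. ip (d k) z) \<longlonglongrightarrow> l z"
    using Riesz_sequence[OF assms] by blast
  obtain u where u: "u \<in> V" "(\<lambda>k. sn (\<lambda>x. d k x - u x)) \<longlonglongrightarrow> 0"
    using complete[OF d(1,2)] by blast
  have "ip u z = l z" if "z \<in> V" for z
    using LIMSEQ_unique[OF tendsto_ip[OF d(1) u(1) that u(2)] d(3)[OF that]] .
  with u that show ?thesis by blast
qed

text \<open>Banach's iteration from the zero function. Limits are determined only up to distance
  zero, so the conclusion is that \<open>T u\<close> and \<open>u\<close> have distance zero, not
  that they are equal.\<close>

lemma contraction_fixpoint:
  assumes T: "\<And>u. u \<in> V \<Longrightarrow> T u \<in> V"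
    and contr: "\<And>u v. u \<in> V \<Longrightarrow> v \<in> V \<Longrightarrow> sn (\<lambda>x. T u x - T v x) \<le> \<kappa> * sn (\<lambda>x. u x - v x)"
    and \<kappa>: "0 \<le> \<kappa>" "\<kappa> < 1"
  obtains u where "u \<in> V" "sn (\<lambda>x. T u x - u x) = 0"
proof -
  define d where "d k = (T ^^ k) (\<lambda>_. 0)" for k :: nat
  have d_Suc: "d (Suc k) = T (d k)" for k by (simp add: d_def)
  have dV: "d k \<in> V" for k by (induction k) (auto simp: d_Suc T, simp add: d_def zero)
  define c where "c = sn (\<lambda>x. d 1 x - d 0 x)"
  have c: "c \<ge> 0" unfolding c_def by (intro sn_nonneg diff dV)
  have step: "sn (\<lambda>x. d (Suc k) x - d k x) \<le> \<kappa> ^ k * c" for k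
  proof (induction k)
    case (Suc k)
    have "sn (\<lambda>x. d (Suc (Suc k)) x - d (Suc k) x) \<le> \<kappa> * sn (\<lambda>x. d (Suc k) x - d k x)"
      using contr[OF dV[of "Suc k"] dV[of k]] by (simp add: d_Suc)
    also have "\<dots> \<le> \<kappa> * (\<kappa> ^ k * c)" using Suc \<kappa> by (intro mult_left_mono) auto
    finally show ?case by simp
  qed (simp add: c_def)
  \<comment> \<open>A geometric sum, kept multiplied by \<open>1 - \<kappa>\<close> so that the
    induction involves no division; the factor \<open>1 - \<kappa> ^ j\<close> telescopes.\<close>
  have far: "sn (\<lambda>x. d (m + j) x - d m x) * (1 - \<kappa>) \<le> \<kappa> ^ m * c * (1 - \<kappa> ^ j)" for m j
  proof (induction j)
    case 0
    show ?case using sn_scale[OF zero, of 0] by simp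
  next
    case (Suc j)
    have "sn (\<lambda>x. d (m + Suc j) x - d m x) \<le> sn (\<lambda>x. d (Suc (m + j)) x - d (m + j) x) + sn (\<lambda>x. d (m + j) x - d m x)"
      using sn_triangle_diff[of "d (Suc (m + j))" "d (m + j)" "d m"] dV by simp
    also have "\<dots> \<le> \<kappa> ^ (m + j) * c + sn (\<lambda>x. d (m + j) x - d m x)" using step[of "m + j"] by simp
    finally have "sn (\<lambda>x. d (m + Suc j) x - d m x) * (1 - \<kappa>)
        \<le> (\<kappa> ^ (m + j) * c + sn (\<lambda>x. d (m + j) x - d m x)) * (1 - \<kappa>)"
      using \<kappa> by (intro mult_right_mono) auto
    also have "\<dots> \<le> \<kappa> ^ (m + j) * c * (1 - \<kappa>) + \<kappa> ^ m * c * (1 - \<kappa> ^ j)"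
      using Suc by (simp add: distrib_right)
    also have "\<dots> = \<kappa> ^ m * c * (1 - \<kappa> ^ Suc j)" by (simp add: power_add algebra_simps)
    finally show ?case .
  qed
  have far': "sn (\<lambda>x. d n x - d m x) \<le> \<kappa> ^ m * (c / (1 - \<kappa>))" if "m \<le> n" for m n
  proof -
    have "sn (\<lambda>x. d n x - d m x) * (1 - \<kappa>) \<le> \<kappa> ^ m * c * (1 - \<kappa> ^ (n - m))"
      using far[of m "n - m"] that by simp
    also have "\<dots> \<le> \<kappa> ^ m * c * 1" using \<kappa> c by (intro mult_left_mono) auto
    finally show ?thesis using \<kappa> by (simp add: field_simps)
  qed
  have lim0: "(\<lambda>m. \<kappa> ^ m * (c / (1 - \<kappa>))) \<longlonglongrightarrow> 0"
    using tendsto_mult_right[OF LIMSEQ_power_zero[of \<kappa>], of "c / (1 - \<kappa>)"] \<kappa> by simp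
  have "Cauchy_in d"
    unfolding Cauchy_in_def
  proof (intro allI impI)
    fix e :: real assume "e > 0"
    then obtain N where N: "\<And>m. m \<ge> N \<Longrightarrow> \<kappa> ^ m * (c / (1 - \<kappa>)) < e"
      using order_tendstoD(2)[OF lim0] unfolding eventually_sequentially by blast
    show "\<exists>N. \<forall>m\<ge>N. \<forall>n\<ge>N. sn (\<lambda>x. d m x - d n x) < e"
    proof (intro exI allI impI)
      fix m n assume "N \<le> m" "N \<le> n"
      then show "sn (\<lambda>x. d m x - d n x) < e"
        using far'[of m n] far'[of n m] N[of m] N[of n] sn_commute[OF dV dV, of m n]
        by (cases "m \<le> n") auto
    qed
  qed
  then obtain u where u: "u \<in> V" "(\<lambda>k. sn (\<lambda>x. d k x - u x)) \<longlonglongrightarrow> 0"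
    using complete[of d] dV by blast
  \<comment> \<open>Both \<open>T u\<close> and \<open>u\<close> are compared with the iterate
    \<open>d (Suc k) = T (d k)\<close>, and both distances vanish in the limit.\<close>
  have "sn (\<lambda>x. T u x - u x) \<le> \<kappa> * sn (\<lambda>x. d k x - u x) + sn (\<lambda>x. d (Suc k) x - u x)" for k
    using sn_triangle_diff[of "T u" "d (Suc k)" u] T[OF u(1)] T[OF dV[of k]] u(1) contr[OF u(1) dV, of k]
      sn_commute[OF u(1) dV, of k] by (simp add: d_Suc)
  moreover have "(\<lambda>k. \<kappa> * sn (\<lambda>x. d k x - u x) + sn (\<lambda>x. d (Suc k) x - u x)) \<longlonglongrightarrow> \<kappa> * 0 + 0"
    by (intro tendsto_intros u(2) LIMSEQ_Suc)
  ultimately have "sn (\<lambda>x. T u x - u x) \<le> 0"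
    by (metis (no_types, lifting) LIMSEQ_le_const add.right_neutral mult_zero_right)
  then show ?thesis using that[OF u(1)] sn_nonneg[OF diff[OF T[OF u(1)] u(1)]] by simp
qed

text \<open>\<open>E\<close> need not be symmetric, so \<open>Riesz\<close> does not apply to
  \<open>ip + E\<close>. Instead \<open>T u\<close> is taken to represent \<open>l - E u\<close>: a
  fixed point of \<open>T\<close> solves the equation, and \<open>E_bound\<close> with
  \<open>\<kappa> < 1\<close> makes \<open>T\<close> a contraction.\<close>

lemma perturbed_Riesz:
  assumes l: "bounded_functional l"
    and E: "\<And>u. u \<in> V \<Longrightarrow> bounded_functional (E u)"
    and E_diff: "\<And>u v w. u \<in> V \<Longrightarrow> v \<in> V \<Longrightarrow> w \<in> V \<Longrightarrow> E (\<lambda>x. u x - v x) w = E u w - E v w"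
    and E_bound: "\<And>u w. u \<in> V \<Longrightarrow> w \<in> V \<Longrightarrow> \<bar>E u w\<bar> \<le> \<kappa> * sn u * sn w"
    and \<kappa>: "0 \<le> \<kappa>" "\<kappa> < 1"
  obtains u where "u \<in> V" "\<And>w. w \<in> V \<Longrightarrow> ip u w + E u w = l w"
proof -
  have "bounded_functional (\<lambda>w. l w - E u w)" if u: "u \<in> V" for u
  proof -
    obtain K1 where K1: "K1 \<ge> 0" "\<And>w. w \<in> V \<Longrightarrow> \<bar>l w\<bar> \<le> K1 * sn w"
      using l unfolding bounded_functional_def by blast
    obtain K2 where K2: "K2 \<ge> 0" "\<And>w. w \<in> V \<Longrightarrow> \<bar>E u w\<bar> \<le> K2 * sn w"
      using E[OF u] unfolding bounded_functional_def by blast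
    show ?thesis
    proof (rule bounded_functionalI[of _ "K1 + K2"])
      fix w assume w: "w \<in> V"
      show "\<bar>l w - E u w\<bar> \<le> (K1 + K2) * sn w"
        using K1(2)[OF w] K2(2)[OF w] by (simp add: distrib_right)
    qed (use l E[OF u] K1 K2 in \<open>auto simp: bounded_functional_def algebra_simps\<close>)
  qed
  then have "\<forall>u\<in>V. \<exists>v\<in>V. \<forall>w\<in>V. ip v w = l w - E u w"
    by (meson Riesz)
  then obtain T where T: "\<And>u. u \<in> V \<Longrightarrow> T u \<in> V"
    and T_eq: "\<And>u w. u \<in> V \<Longrightarrow> w \<in> V \<Longrightarrow> ip (T u) w = l w - E u w"
    by metis
  have contr: "sn (\<lambda>x. T u x - T v x) \<le> \<kappa> * sn (\<lambda>x. u x - v x)" if u: "u \<in> V" and v: "v \<in> V" for u v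
  proof -
    let ?d = "\<lambda>x. T u x - T v x"
    have d: "?d \<in> V" using T u v diff by auto
    have uv: "(\<lambda>x. u x - v x) \<in> V" using u v diff by auto
    have "(sn ?d)\<^sup>2 = - E (\<lambda>x. u x - v x) ?d"
      using d u v T by (simp add: sn_square ip_diff T_eq E_diff)
    also have "\<dots> \<le> \<kappa> * sn (\<lambda>x. u x - v x) * sn ?d" using E_bound[OF uv d] by simp
    finally have "sn ?d * sn ?d \<le> (\<kappa> * sn (\<lambda>x. u x - v x)) * sn ?d" by (simp add: power2_eq_square)
    then show ?thesis
      using sn_nonneg[OF d] sn_nonneg[OF uv] \<kappa> mult_right_le_imp_le
      by (cases "sn ?d = 0") (auto simp: less_le)
  qed
  obtain u where u: "u \<in> V" "sn (\<lambda>x. T u x - u x) = 0"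
    by (rule contraction_fixpoint[of T \<kappa>, OF T contr \<kappa>]) auto
  \<comment> \<open>Distance zero between \<open>T u\<close> and \<open>u\<close> is enough: by
    Cauchy-Schwarz \<open>ip (T u) w = ip u w\<close>.\<close>
  have "ip u w + E u w = l w" if w: "w \<in> V" for w
    using Cauchy_Schwarz[OF diff[OF T[OF u(1)] u(1)] w] u w T T_eq[OF u(1) w] by (simp add: ip_diff)
  with u that show ?thesis by blast
qed

end

section \<open>The space \<open>L2\<close>\<close>

lemma L2_measurable [measurable_dest]: "f \<in> L2 M \<Longrightarrow> f \<in> borel_measurable M"
  by (simp add: L2_def)

lemma L2_integrable: "f \<in> L2 M \<Longrightarrow> integrable M (\<lambda>x. (norm (f x))\<^sup>2)"
  by (simp add: L2_def)

lemma L2_bound: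
  assumes "f \<in> borel_measurable M" "integrable M h" "AE x in M. (norm (f x))\<^sup>2 \<le> h x"
  shows "f \<in> L2 M"
  unfolding L2_def using assms by (auto intro!: Bochner_Integration.integrable_bound[OF assms(2)])

lemma L2_zero: "(\<lambda>_. 0) \<in> L2 M"
  by (simp add: L2_def)

lemma L2_add:
  assumes "f \<in> L2 M" "g \<in> L2 M"
  shows "(\<lambda>x. f x + g x) \<in> L2 M"
proof (rule L2_bound[where h = "\<lambda>x. 2 * (norm (f x))\<^sup>2 + 2 * (norm (g x))\<^sup>2"])
  show "AE x in M. (norm (f x + g x))\<^sup>2 \<le> 2 * (norm (f x))\<^sup>2 + 2 * (norm (g x))\<^sup>2"
  proof (rule AE_I2)
    fix x
    have "(norm (f x + g x))\<^sup>2 \<le> (norm (f x) + norm (g x))\<^sup>2"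
      by (intro power_mono norm_triangle_ineq) auto
    also have "\<dots> \<le> 2 * (norm (f x))\<^sup>2 + 2 * (norm (g x))\<^sup>2"
      using zero_le_power2[of "norm (f x) - norm (g x)"] by (simp add: power2_sum power2_diff)
    finally show "(norm (f x + g x))\<^sup>2 \<le> 2 * (norm (f x))\<^sup>2 + 2 * (norm (g x))\<^sup>2" .
  qed
qed (use assms in \<open>auto intro!: Bochner_Integration.integrable_add integrable_mult_right simp: L2_def\<close>)

lemma L2_scaleR: "f \<in> L2 M \<Longrightarrow> (\<lambda>x. a *\<^sub>R f x) \<in> L2 M"
  by (auto simp: L2_def power_mult_distrib)

lemma L2_integrable_inner:
  assumes "f \<in> L2 M" "g \<in> L2 M"
  shows "integrable M (\<lambda>x. f x \<bullet> g x)"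
proof (rule Bochner_Integration.integrable_bound)
  show "integrable M (\<lambda>x. (norm (f x))\<^sup>2 + (norm (g x))\<^sup>2)"
    using assms by (auto simp: L2_def)
  show "(\<lambda>x. f x \<bullet> g x) \<in> borel_measurable M"
    using assms by (auto simp: L2_def)
  have "\<bar>f x \<bullet> g x\<bar> \<le> (norm (f x))\<^sup>2 + (norm (g x))\<^sup>2" for x
  proof -
    have "\<bar>f x \<bullet> g x\<bar> \<le> norm (f x) * norm (g x)" by (rule Cauchy_Schwarz_ineq2)
    moreover have "2 * (norm (f x) * norm (g x)) \<le> (norm (f x))\<^sup>2 + (norm (g x))\<^sup>2"
      using sum_squares_bound[of "norm (f x)" "norm (g x)"] by (simp add: mult.assoc)
    moreover have "0 \<le> norm (f x) * norm (g x)" by simp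
    ultimately show ?thesis by linarith
  qed
  then show "AE x in M. norm (f x \<bullet> g x) \<le> norm ((norm (f x))\<^sup>2 + (norm (g x))\<^sup>2)"
    by (auto intro!: AE_I2)
qed

lemma semi_inner_space_L2: "semi_inner_space (L2 M) (L2_inner M)"
proof
  fix u v w :: "'a \<Rightarrow> 'b::euclidean_space"
  assume "u \<in> L2 M" "v \<in> L2 M" "w \<in> L2 M"
  then show "L2_inner M (\<lambda>x. u x + v x) w = L2_inner M u w + L2_inner M v w"
    by (simp add: L2_inner_def inner_add_left L2_integrable_inner)
qed (simp_all add: L2_zero L2_add L2_scaleR L2_inner_def inner_commute)

text \<open>The rewrite turns the seminorm of the locale into \<open>L2_norm\<close>, so that its
  facts come out in the notation of the theorem.\<close>

interpretation L2: semi_inner_space "L2 M" "L2_inner M"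
  rewrites "semi_inner_space.sn (L2_inner M) = L2_norm M"
  by (rule semi_inner_space_L2)
     (auto simp: semi_inner_space.sn_def[OF semi_inner_space_L2] L2_norm_def L2_inner_def power2_norm_eq_inner)

lemma L2_norm_nonneg [simp]: "0 \<le> L2_norm M f"
  by (simp add: L2_norm_def)

lemma L2_norm_square: "(L2_norm M f)\<^sup>2 = (LINT x|M. (norm (f x))\<^sup>2)"
  by (simp add: L2_norm_def)

lemma L2_inner_AE_cong:
  assumes "f \<in> L2 M" "f' \<in> L2 M" "g \<in> L2 M" "g' \<in> L2 M"
    "AE x in M. f x = f' x" "AE x in M. g x = g' x"
  shows "L2_inner M f g = L2_inner M f' g'"
  unfolding L2_inner_def
  by (rule integral_cong_AE) (use assms in \<open>auto simp: L2_def\<close>)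

lemma L2_norm_AE_cong:
  assumes "f \<in> L2 M" "f' \<in> L2 M" "AE x in M. f x = f' x"
  shows "L2_norm M f = L2_norm M f'"
  unfolding L2_norm_def
  by (rule arg_cong[where f = sqrt], rule integral_cong_AE) (use assms in \<open>auto simp: L2_def\<close>)

lemma L2_norm_mono_AE:
  assumes "f \<in> L2 M" "g \<in> L2 M" "AE x in M. norm (f x) \<le> norm (g x)"
  shows "L2_norm M f \<le> L2_norm M g"
  unfolding L2_norm_def
  by (rule real_sqrt_le_mono, rule integral_mono_AE) (use assms in \<open>auto simp: L2_def intro!: power_mono\<close>)

lemma L2_norm_eq_0:
  assumes "f \<in> L2 M" "L2_norm M f = 0"
  shows "AE x in M. f x = 0"
proof -
  have "(LINT x|M. (norm (f x))\<^sup>2) = 0" using assms(2) by (simp add: L2_norm_def)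
  then have "AE x in M. (norm (f x))\<^sup>2 = 0"
    using integral_nonneg_eq_0_iff_AE[OF L2_integrable[OF assms(1)]] by simp
  then show ?thesis by eventually_elim simp
qed

lemma L2_bounded_mult:
  fixes f :: "'a \<Rightarrow> 'b::euclidean_space"
  assumes "f \<in> L2 M" "g \<in> borel_measurable M" "AE x in M. \<bar>g x\<bar> \<le> K"
  shows "(\<lambda>x. g x *\<^sub>R f x) \<in> L2 M"
proof (rule L2_bound[where h = "\<lambda>x. K\<^sup>2 * (norm (f x))\<^sup>2"])
  show "AE x in M. (norm (g x *\<^sub>R f x))\<^sup>2 \<le> K\<^sup>2 * (norm (f x))\<^sup>2"
    using assms(3)
  proof eventually_elim
    case (elim x)
    then have "\<bar>g x\<bar>\<^sup>2 \<le> K\<^sup>2" by (intro power_mono) auto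
    then show ?case by (simp add: power_mult_distrib mult_right_mono)
  qed
qed (use assms in \<open>auto simp: L2_def\<close>)

lemma L2_inner_bounded:
  fixes f g :: "'a \<Rightarrow> 'b::euclidean_space"
  assumes f: "f \<in> L2 M" and g: "g \<in> borel_measurable M" and K: "AE x in M. norm (g x) \<le> K"
  shows "(\<lambda>x. g x \<bullet> f x) \<in> L2 M"
proof (rule L2_bound[where h = "\<lambda>x. K\<^sup>2 * (norm (f x))\<^sup>2"])
  show "AE x in M. (norm (g x \<bullet> f x))\<^sup>2 \<le> K\<^sup>2 * (norm (f x))\<^sup>2"
    using K
  proof eventually_elim
    case (elim x)
    then have "\<bar>g x \<bullet> f x\<bar> \<le> K * norm (f x)"
      using Cauchy_Schwarz_ineq2[of "g x" "f x"] mult_right_mono[OF elim, of "norm (f x)"] by simp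
    then have "\<bar>g x \<bullet> f x\<bar>\<^sup>2 \<le> (K * norm (f x))\<^sup>2" by (intro power_mono) auto
    then show ?case by (simp add: power_mult_distrib)
  qed
qed (use f g in \<open>auto simp: L2_def\<close>)

lemma (in finite_measure) L2_of_bounded:
  fixes f :: "'a \<Rightarrow> 'b::euclidean_space"
  assumes "f \<in> borel_measurable M" "AE x in M. norm (f x) \<le> K"
  shows "f \<in> L2 M"
proof (rule L2_bound[where h = "\<lambda>x. K\<^sup>2"])
  show "AE x in M. (norm (f x))\<^sup>2 \<le> K\<^sup>2"
    using assms(2) by eventually_elim (simp add: power_mono)
qed (use assms in auto)

text \<open>Cauchy-Schwarz against the constant function one, which is square integrable because the
  measure is finite.\<close>

lemma (in finite_measure) L1_le_L2:
  fixes f :: "'a \<Rightarrow> 'b::euclidean_space"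
  assumes f: "f \<in> L2 M"
  shows "integrable M f" "(LINT x|M. norm (f x)) \<le> L2_norm M f * sqrt (measure M (space M))"
proof -
  have n: "(\<lambda>x. norm (f x)) \<in> L2 M" using f by (auto simp: L2_def)
  have o: "(\<lambda>_. 1::real) \<in> L2 M" by (rule L2_of_bounded[where K=1]) auto
  show "integrable M f"
    using L2_integrable_inner[OF n o] f
    by (subst integrable_norm_iff[symmetric]) (auto simp: L2_def)
  show "(LINT x|M. norm (f x)) \<le> L2_norm M f * sqrt (measure M (space M))"
    using L2.Cauchy_Schwarz[OF n o] by (simp add: L2_inner_def L2_norm_def)
qed

text \<open>Riesz-Fischer for finite measure: an \<open>L2\<close> Cauchy sequence is Cauchy in
  \<open>L1\<close>, so a subsequence converges almost everywhere, and Fatou's lemma makes the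
  pointwise limit an \<open>L2\<close> limit of the whole sequence.\<close>

lemma (in finite_measure) L2_complete:
  fixes s :: "nat \<Rightarrow> 'a \<Rightarrow> 'b::euclidean_space"
  assumes s: "\<And>k. s k \<in> L2 M"
    and C: "\<And>e. e > 0 \<Longrightarrow> \<exists>N. \<forall>m\<ge>N. \<forall>n\<ge>N. L2_norm M (\<lambda>x. s m x - s n x) < e"
  obtains u where "u \<in> L2 M" "(\<lambda>k. L2_norm M (\<lambda>x. s k x - u x)) \<longlonglongrightarrow> 0"
proof -
  have [measurable]: "s k \<in> borel_measurable M" for k using s by (simp add: L2_def)
  have "\<exists>N. \<forall>i\<ge>N. \<forall>j\<ge>N. LINT x|M. norm (s i x - s j x) < e" if e: "e > 0" for e
  proof -
    \<comment> \<open>The summand one keeps \<open>c\<close> positive even when the whole space has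
      measure zero.\<close>
    define c where "c = sqrt (measure M (space M)) + 1"
    have c: "c > 0" unfolding c_def by (simp add: add_nonneg_pos)
    obtain N where N: "\<And>m n. m \<ge> N \<Longrightarrow> n \<ge> N \<Longrightarrow> L2_norm M (\<lambda>x. s m x - s n x) < e / c"
      using C[of "e / c"] e c by auto
    have "(LINT x|M. norm (s i x - s j x)) < e" if "i \<ge> N" "j \<ge> N" for i j
    proof -
      have "(LINT x|M. norm (s i x - s j x)) \<le> L2_norm M (\<lambda>x. s i x - s j x) * sqrt (measure M (space M))"
        using L1_le_L2(2)[OF L2.diff[OF s s]] by simp
      also have "\<dots> \<le> L2_norm M (\<lambda>x. s i x - s j x) * c"
        unfolding c_def by (intro mult_left_mono) auto
      also have "\<dots> < e" using N[OF that] c by (simp add: field_simps)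
      finally show ?thesis .
    qed
    then show ?thesis by blast
  qed
  then obtain r where r: "strict_mono r" and rC: "AE x in M. Cauchy (\<lambda>i. s (r i) x)"
    using cauchy_L1_AE_cauchy_subseq[of M s] L1_le_L2(1)[OF s] by metis
  define u where "u x = lim (\<lambda>i. s (r i) x)" for x
  have [measurable]: "u \<in> borel_measurable M"
    unfolding u_def by (rule borel_measurable_lim_metric) measurable
  have lim: "AE x in M. (\<lambda>i. s (r i) x) \<longlonglongrightarrow> u x"
    using rC by eventually_elim (simp add: u_def Cauchy_convergent_iff convergent_LIMSEQ_iff)
  have tail: "(\<lambda>x. s m x - u x) \<in> L2 M \<and> L2_norm M (\<lambda>x. s m x - u x) \<le> e"
    if e: "e > 0" and N: "\<forall>m\<ge>N. \<forall>n\<ge>N. L2_norm M (\<lambda>x. s m x - s n x) < e" and m: "m \<ge> N" for m N e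
  proof -
    have "(\<integral>\<^sup>+x. ennreal ((norm (s m x - u x))\<^sup>2) \<partial>M)
        = (\<integral>\<^sup>+x. liminf (\<lambda>i. ennreal ((norm (s m x - s (r i) x))\<^sup>2)) \<partial>M)"
    proof (rule nn_integral_cong_AE)
      show "AE x in M. ennreal ((norm (s m x - u x))\<^sup>2) = liminf (\<lambda>i. ennreal ((norm (s m x - s (r i) x))\<^sup>2))"
        using lim
      proof eventually_elim
        case (elim x)
        then have "(\<lambda>i. ennreal ((norm (s m x - s (r i) x))\<^sup>2)) \<longlonglongrightarrow> ennreal ((norm (s m x - u x))\<^sup>2)"
          by (intro tendsto_ennrealI tendsto_intros)
        from lim_imp_Liminf[OF sequentially_bot this] show ?case by (rule sym)
      qed
    qed
    \<comment> \<open>Fatou's lemma with \<open>m\<close> fixed, as the index \<open>i\<close> of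
      the subsequence grows.\<close>
    also have "\<dots> \<le> liminf (\<lambda>i. \<integral>\<^sup>+x. ennreal ((norm (s m x - s (r i) x))\<^sup>2) \<partial>M)"
      by (rule nn_integral_liminf) measurable
    also have "\<dots> \<le> liminf (\<lambda>i. ennreal (e\<^sup>2))"
    proof (rule Liminf_mono)
      have "(\<integral>\<^sup>+x. ennreal ((norm (s m x - s (r i) x))\<^sup>2) \<partial>M) \<le> ennreal (e\<^sup>2)" if "i \<ge> N" for i
      proof -
        have "r i \<ge> N" using that strict_mono_imp_increasing[OF r, of i] by simp
        then have "(L2_norm M (\<lambda>x. s m x - s (r i) x))\<^sup>2 \<le> e\<^sup>2"
          using N m by (intro power_mono) (auto intro: less_imp_le)
        moreover have "integrable M (\<lambda>x. (norm (s m x - s (r i) x))\<^sup>2)"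
          using L2_integrable[OF L2.diff[OF s s]] by simp
        ultimately show ?thesis
          by (simp add: nn_integral_eq_integral L2_norm_square ennreal_leI)
      qed
      then show "\<forall>\<^sub>F i in sequentially. (\<integral>\<^sup>+x. ennreal ((norm (s m x - s (r i) x))\<^sup>2) \<partial>M) \<le> ennreal (e\<^sup>2)"
        unfolding eventually_sequentially by blast
    qed
    also have "\<dots> = ennreal (e\<^sup>2)" by (simp add: Liminf_const)
    finally have le: "(\<integral>\<^sup>+x. ennreal ((norm (s m x - u x))\<^sup>2) \<partial>M) \<le> ennreal (e\<^sup>2)" .
    then have int: "integrable M (\<lambda>x. (norm (s m x - u x))\<^sup>2)"
      by (intro integrableI_nonneg) (auto simp: le_less_trans[OF _ ennreal_less_top])
    then have "ennreal (LINT x|M. (norm (s m x - u x))\<^sup>2) \<le> ennreal (e\<^sup>2)"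
      using le by (simp add: nn_integral_eq_integral)
    then have "(LINT x|M. (norm (s m x - u x))\<^sup>2) \<le> e\<^sup>2" by (simp add: ennreal_le_iff)
    then show ?thesis using int e by (auto simp: L2_def L2_norm_def intro!: real_le_lsqrt)
  qed
  obtain N where N: "\<forall>m\<ge>N. \<forall>n\<ge>N. L2_norm M (\<lambda>x. s m x - s n x) < 1" using C[of 1] by auto
  have "u \<in> L2 M"
    using L2.diff[OF s[of N] conjunct1[OF tail[OF _ N order_refl]]] by simp
  moreover have "(\<lambda>k. L2_norm M (\<lambda>x. s k x - u x)) \<longlonglongrightarrow> 0"
  proof (rule LIMSEQ_I)
    fix e :: real assume e: "e > 0"
    obtain N where N: "\<forall>m\<ge>N. \<forall>n\<ge>N. L2_norm M (\<lambda>x. s m x - s n x) < e/2" using C[of "e/2"] e by auto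
    show "\<exists>N. \<forall>n\<ge>N. norm (L2_norm M (\<lambda>x. s n x - u x) - 0) < e"
      using tail[OF _ N] e by (intro exI[of _ N]) force
  qed
  ultimately show ?thesis by (rule that)
qed

section \<open>Smooth functions\<close>

lemma partialI: "(f has_derivative D) (at x) \<Longrightarrow> partial i f x = D (axis i 1)"
  unfolding partial_def using frechet_derivative_at by metis

lemma Ck_differentiable: "Ck (Suc k) f \<Longrightarrow> f differentiable (at x)"
  by (simp add: differentiable_on_def)

lemma Ck_SucI:
  assumes "\<And>x. f differentiable (at x)" "\<And>i. Ck k (partial i f)"
  shows "Ck (Suc k) f"
  using assms by (simp add: differentiable_on_def)

text \<open>\<open>Ck (Suc k) f\<close> demands \<open>Ck k\<close> of the partial derivatives but
  not of \<open>f\<close> itself, hence the induction.\<close>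

lemma Ck_Suc_imp_Ck: "Ck (Suc k) f \<Longrightarrow> Ck k f"
proof (induction k arbitrary: f)
  case 0
  then show ?case by (simp add: differentiable_imp_continuous_on)
qed auto

lemma partial_const: "partial i (\<lambda>_. c) = (\<lambda>_. 0)"
  by (rule ext) (simp add: partialI[OF has_derivative_const])

lemma partial_add:
  assumes "\<And>x. f differentiable (at x)" "\<And>x. g differentiable (at x)"
  shows "partial i (\<lambda>x. f x + g x) = (\<lambda>x. partial i f x + partial i g x)"
proof
  fix x
  obtain D E where D: "(f has_derivative D) (at x)" and E: "(g has_derivative E) (at x)"
    using assms unfolding differentiable_def by blast
  show "partial i (\<lambda>x. f x + g x) x = partial i f x + partial i g x"
    by (simp add: partialI[OF has_derivative_add[OF D E]] partialI[OF D] partialI[OF E])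
qed

lemma partial_mult:
  assumes "\<And>x. f differentiable (at x)" "\<And>x. g differentiable (at x)"
  shows "partial i (\<lambda>x. f x * g x) = (\<lambda>x. f x * partial i g x + partial i f x * g x)"
proof
  fix x
  obtain D E where D: "(f has_derivative D) (at x)" and E: "(g has_derivative E) (at x)"
    using assms unfolding differentiable_def by blast
  show "partial i (\<lambda>x. f x * g x) x = f x * partial i g x + partial i f x * g x"
    by (simp add: partialI[OF has_derivative_mult[OF D E]] partialI[OF D] partialI[OF E])
qed

lemma Ck_const: "Ck k (\<lambda>_. c)"
  by (induction k arbitrary: c) (auto simp: partial_const differentiable_on_const)

lemma Ck_add: "Ck k f \<Longrightarrow> Ck k g \<Longrightarrow> Ck k (\<lambda>x. f x + g x)"
proof (induction k arbitrary: f g)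
  case 0
  then show ?case by (auto intro: continuous_on_add)
next
  case (Suc k)
  have d: "f differentiable (at x)" "g differentiable (at x)" for x
    using Suc.prems Ck_differentiable by auto
  show ?case
    using Suc d by (intro Ck_SucI) (auto simp: partial_add)
qed

lemma Ck_mult: "Ck k f \<Longrightarrow> Ck k g \<Longrightarrow> Ck k (\<lambda>x. f x * g x)"
proof (induction k arbitrary: f g)
  case 0
  then show ?case by (auto intro: continuous_on_mult)
next
  case (Suc k)
  have d: "f differentiable (at x)" "g differentiable (at x)" for x
    using Suc.prems Ck_differentiable by auto
  show ?case
    using Suc.IH Suc.prems Ck_Suc_imp_Ck[of k f] Ck_Suc_imp_Ck[of k g] d
    by (intro Ck_SucI) (auto simp: partial_mult intro!: Ck_add)
qed

lemma smooth_const: "smooth (\<lambda>_. c)"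
  by (simp add: smooth_def Ck_const)

lemma smooth_add: "smooth f \<Longrightarrow> smooth g \<Longrightarrow> smooth (\<lambda>x. f x + g x)"
  by (simp add: smooth_def Ck_add)

lemma smooth_mult: "smooth f \<Longrightarrow> smooth g \<Longrightarrow> smooth (\<lambda>x. f x * g x)"
  by (simp add: smooth_def Ck_mult)

lemma smooth_diff: "smooth f \<Longrightarrow> smooth g \<Longrightarrow> smooth (\<lambda>x. f x - g x)"
  using smooth_add[of f "\<lambda>x. (-1) * g x"] smooth_mult[OF smooth_const, of g "-1"] by simp

lemma smooth_prod: "finite A \<Longrightarrow> (\<And>i. i \<in> A \<Longrightarrow> smooth (f i)) \<Longrightarrow> smooth (\<lambda>x. \<Prod>i\<in>A. f i x)"
  by (induction A rule: finite_induct) (auto simp: smooth_const smooth_mult)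

lemma smooth_differentiable: "smooth f \<Longrightarrow> f differentiable (at x)"
  using Ck_differentiable unfolding smooth_def by blast

lemma smooth_partial: "smooth f \<Longrightarrow> smooth (partial i f)"
  unfolding smooth_def using Ck.simps(2) by blast

lemma smooth_continuous: "smooth f \<Longrightarrow> continuous_on UNIV f"
  by (metis Ck.simps(1) smooth_def)

lemma smooth_borel_measurable: "smooth f \<Longrightarrow> f \<in> borel_measurable borel"
  by (simp add: smooth_continuous borel_measurable_continuous_onI)

lemma smooth_has_derivative:
  assumes "smooth f"
  shows "(f has_derivative frechet_derivative f (at x)) (at x)"
  using smooth_differentiable[OF assms] frechet_derivative_works by blast

text \<open>The line is affine in \<open>s\<close> with direction \<open>axis j 1\<close>, so the
  chain rule applies. This brings \<open>partial\<close> down to one-variable calculus and feeds the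
  fundamental theorem of calculus in \<open>integral_cube_partial\<close>.\<close>

lemma smooth_partial_deriv:
  assumes "smooth f"
  shows "((\<lambda>s. f (\<chi> k. if k = j then s else x $ k)) has_real_derivative
            partial j f (\<chi> k. if k = j then s else x $ k)) (at s)"
proof -
  let ?p = "\<lambda>s. (\<chi> k. if k = j then s else x $ k) :: real^'a"
  have "((\<lambda>s. f (?p s)) has_derivative (\<lambda>h. frechet_derivative f (at (?p s)) (h *\<^sub>R axis j 1))) (at s)"
  proof (rule has_derivative_compose[of ?p, OF _ smooth_has_derivative[OF assms]])
    define c where "c = (\<chi> k. if k = j then 0 else x $ k)"
    have eq: "?p = (\<lambda>s. c + s *\<^sub>R axis j 1)"
      by (auto simp: c_def vec_eq_iff axis_def)
    show "(?p has_derivative (\<lambda>h. h *\<^sub>R axis j 1)) (at s)"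
      unfolding eq by (auto intro!: derivative_eq_intros)
  qed
  moreover have "frechet_derivative f (at (?p s)) (h *\<^sub>R axis j 1) = partial j f (?p s) * h" for h
    using linear_frechet_derivative[OF smooth_differentiable[OF assms], of "?p s"]
    by (simp add: partial_def linear_cmul)
  ultimately show ?thesis by (simp add: has_field_derivative_def mult_commute_abs)
qed

text \<open>The tower \<open>G\<close> holds all derivatives at once: a concrete function is shown
  smooth by exhibiting one explicit family, and an induction that generalizes over the levels of the
  tower gives \<open>Ck k\<close> after composition with a coordinate.\<close>

definition smooth1 :: "(real \<Rightarrow> real) \<Rightarrow> bool" where
  "smooth1 g \<longleftrightarrow> (\<exists>G. G 0 = g \<and> (\<forall>m t. (G m has_real_derivative G (Suc m) t) (at t)))"

lemma partial_coord:
  assumes "\<And>t. (g has_real_derivative g' t) (at t)"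
  shows "partial j (\<lambda>x. g (x $ i)) = (\<lambda>x. (if j = i then 1 else 0) * g' (x $ i))"
    and "(\<lambda>x. g (x $ i)) differentiable (at x)"
proof -
  have *: "((\<lambda>x. g (x $ i)) has_derivative (\<lambda>h. g' (x $ i) * (h $ i))) (at x)" for x
    by (rule has_derivative_compose[OF bounded_linear_imp_has_derivative[OF bounded_linear_vec_nth]
          assms[unfolded has_field_derivative_def]])
  show "partial j (\<lambda>x. g (x $ i)) = (\<lambda>x. (if j = i then 1 else 0) * g' (x $ i))"
    by (rule ext) (simp add: partialI[OF *] axis_def)
  show "(\<lambda>x. g (x $ i)) differentiable (at x)"
    using * unfolding differentiable_def by blast
qed

lemma smooth_coord:
  assumes "smooth1 g"
  shows "smooth (\<lambda>x. g (x $ i))"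
proof -
  obtain G where G: "G 0 = g" "\<And>m t. (G m has_real_derivative G (Suc m) t) (at t)"
    using assms unfolding smooth1_def by blast
  have "Ck k (\<lambda>x. G m (x $ i))" for k m
  proof (induction k arbitrary: m)
    case 0
    have "continuous_on UNIV (G m)"
      using G(2) by (meson DERIV_continuous_on has_field_derivative_at_within)
    then show ?case
      by (auto intro!: continuous_on_compose2[of UNIV "G m"] continuous_intros)
  next
    case (Suc k)
    show ?case
      by (rule Ck_SucI) (auto simp: partial_coord[OF G(2)] intro!: Ck_mult Ck_const Suc)
  qed
  then show ?thesis unfolding smooth_def using G(1) by blast
qed

lemma smooth1_affine:
  assumes "smooth1 g"
  shows "smooth1 (\<lambda>t. g (c * t + d))"
proof -
  obtain G where G: "G 0 = g" "\<And>m t. (G m has_real_derivative G (Suc m) t) (at t)"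
    using assms unfolding smooth1_def by blast
  have "((\<lambda>t. c ^ m * G m (c * t + d)) has_real_derivative c ^ Suc m * G (Suc m) (c * t + d)) (at t)" for m t
  proof -
    have "((\<lambda>t. c * t + d) has_real_derivative c) (at t)"
      by (auto intro!: derivative_eq_intros)
    from DERIV_cmult[OF DERIV_chain2[OF G(2) this], of "c ^ m" m] show ?thesis
      by (simp add: mult_ac)
  qed
  then show ?thesis
    unfolding smooth1_def by (intro exI[of _ "\<lambda>m t. c ^ m * G m (c * t + d)"]) (use G(1) in auto)
qed

lemma smooth1_id: "smooth1 (\<lambda>t. t)"
  unfolding smooth1_def
  by (rule exI[of _ "\<lambda>m t. case m of 0 \<Rightarrow> t | Suc 0 \<Rightarrow> 1 | _ \<Rightarrow> 0"])
     (auto split: nat.splits intro!: derivative_eq_intros)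

text \<open>Each derivative advances the phase by \<open>pi / 2\<close>.\<close>

lemma smooth1_sin: "smooth1 sin"
  unfolding smooth1_def
proof (rule exI[of _ "\<lambda>m t. sin (t + real m * (pi / 2))"], intro conjI allI)
  fix m t
  have "sin (t + real (Suc m) * (pi / 2)) = cos (t + real m * (pi / 2))"
  proof -
    have "t + real (Suc m) * (pi / 2) = (t + real m * (pi / 2)) + pi / 2" by (simp add: field_simps)
    then show ?thesis by (simp only: sin_add) simp
  qed
  then show "((\<lambda>t. sin (t + real m * (pi / 2))) has_real_derivative sin (t + real (Suc m) * (pi / 2))) (at t)"
    by (auto intro!: derivative_eq_intros)
qed simp

lemma smooth1_cos: "smooth1 cos"
proof -
  have "smooth1 (\<lambda>t. sin (1 * t + pi / 2))" by (intro smooth1_affine smooth1_sin)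
  then show ?thesis by (simp add: sin_add)
qed

section \<open>The flat function exp(-1/t)\<close>

definition bump :: "real \<Rightarrow> real" where
  "bump t = (if t > 0 then exp (- (1 / t)) else 0)"

lemma tendsto_poly_div_exp: "((\<lambda>t. poly p t * exp (- t)) \<longlongrightarrow> 0) at_top" for p :: "real poly"
proof (induction p)
  case 0
  then show ?case by simp
next
  case (pCons a p)
  have e: "((\<lambda>t::real. exp (- t)) \<longlongrightarrow> 0) at_top"
    using tendsto_power_div_exp_0[of 0] by (simp add: exp_minus inverse_eq_divide)
  have *: "((\<lambda>t::real. t ^ k * exp (- t)) \<longlongrightarrow> 0) at_top" for k :: nat
    using tendsto_power_div_exp_0[of k] by (simp add: exp_minus inverse_eq_divide)
  have "((\<lambda>t. a * exp (- t) + (\<Sum>i\<le>degree p. coeff p i * (t ^ Suc i * exp (- t)))) \<longlongrightarrow> a * 0 + (\<Sum>i\<le>degree p. coeff p i * 0)) at_top"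
    by (intro tendsto_intros e *)
  moreover have "poly (pCons a p) t * exp (- t) = a * exp (- t) + (\<Sum>i\<le>degree p. coeff p i * (t ^ Suc i * exp (- t)))" for t
  proof -
    have "poly (pCons a p) t * exp (- t) = a * exp (- t) + poly p t * (t * exp (- t))"
      by (simp add: algebra_simps)
    also have "poly p t * (t * exp (- t)) = (\<Sum>i\<le>degree p. coeff p i * (t ^ Suc i * exp (- t)))"
      unfolding poly_altdef sum_distrib_right by (simp add: mult_ac)
    finally show ?thesis .
  qed
  ultimately show ?case by simp
qed

text \<open>For \<open>t > 0\<close> the \<open>m\<close>-th derivative is \<open>P m\<close> at
  \<open>1/t\<close> times \<open>exp (- (1/t))\<close>; differentiating gives the recursion
  P_(m+1)(s) = s^2 (P_m(s) - P_m'(s)), which is \<open>q\<close>. Only at 0 is a limit needed, and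
  there the exponential beats every polynomial in \<open>1/t\<close>.\<close>

lemma smooth1_bump: "smooth1 bump"
proof -
  define q where "q p = monom 1 2 * (p - pderiv p)" for p :: "real poly"
  define P where "P m = (q ^^ m) 1" for m :: nat
  define G where "G m t = (if t > 0 then poly (P m) (1 / t) * exp (- (1 / t)) else 0)" for m t
  have P_Suc: "P (Suc m) = q (P m)" for m by (simp add: P_def)
  have "(G m has_real_derivative G (Suc m) t) (at t)" for m t
  proof -
    consider "t > 0" | "t < 0" | "t = 0" by linarith
    then show ?thesis
    proof cases
      case 1
      have "((\<lambda>t. poly (P m) (1 / t) * exp (- (1 / t))) has_real_derivative G (Suc m) t) (at t)"
        using 1
        by (auto intro!: derivative_eq_intros DERIV_chain2[OF poly_DERIV]
            simp: G_def P_Suc q_def poly_monom field_simps power2_eq_square)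
      then show ?thesis
        by (rule has_field_derivative_transform_within_open[where S = "{0<..}"]) (use 1 in \<open>auto simp: G_def\<close>)
    next
      case 2
      have "((\<lambda>_. 0) has_real_derivative G (Suc m) t) (at t)" using 2 by (simp add: G_def)
      then show ?thesis
        by (rule has_field_derivative_transform_within_open[where S = "{..<0}"]) (use 2 in \<open>auto simp: G_def\<close>)
    next
      case 3
      \<comment> \<open>With \<open>s = 1/h\<close> the difference quotient is \<open>s\<close>
        times \<open>P m\<close> at \<open>s\<close> times \<open>exp (- s)\<close>;
        \<open>pCons 0\<close> supplies the factor \<open>s\<close>.\<close>
      have "((\<lambda>h. poly (pCons 0 (P m)) (inverse h) * exp (- inverse h)) \<longlongrightarrow> 0) (at_right 0)"
        by (rule filterlim_compose[OF tendsto_poly_div_exp filterlim_inverse_at_top_right])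
      then have "((\<lambda>h. G m h / h) \<longlongrightarrow> 0) (at_right 0)"
        by (rule Lim_transform_eventually)
           (auto simp: eventually_at_filter G_def field_simps intro!: always_eventually)
      moreover have "((\<lambda>h. G m h / h) \<longlongrightarrow> 0) (at_left 0)"
        by (rule Lim_transform_eventually[OF tendsto_const])
           (auto simp: eventually_at_filter G_def intro!: always_eventually)
      ultimately have "((\<lambda>h. G m h / h) \<longlongrightarrow> 0) (at 0)"
        by (intro filterlim_split_at)
      then show ?thesis using 3 by (simp add: DERIV_def G_def)
    qed
  qed
  moreover have "G 0 = bump" by (auto simp: G_def P_def bump_def)
  ultimately show ?thesis unfolding smooth1_def by blast
qed

lemma bump_bounds: "0 \<le> bump t" "bump t \<le> 1"
  by (auto simp: bump_def)

lemma bump_eq_0_iff: "bump t = 0 \<longleftrightarrow> t \<le> 0"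
  by (auto simp: bump_def)

lemma tendsto_bump:
  assumes "c > 0"
  shows "(\<lambda>k. bump (real k * c - 1)) \<longlonglongrightarrow> 1"
proof -
  have f: "filterlim (\<lambda>k. real k * c - 1) at_top sequentially"
    using filterlim_tendsto_add_at_top[OF tendsto_const[of "-1"]
        filterlim_tendsto_pos_mult_at_top[OF tendsto_const[of c] assms filterlim_real_sequentially]]
    by (simp add: mult.commute)
  have "(\<lambda>k. exp (- inverse (real k * c - 1))) \<longlonglongrightarrow> exp (- 0)"
    by (intro tendsto_intros filterlim_compose[OF tendsto_inverse_0_at_top f] filterlim_ident)
  then have "(\<lambda>k. exp (- (1 / (real k * c - 1)))) \<longlonglongrightarrow> 1" by (simp add: inverse_eq_divide)
  then show ?thesis
    by (rule Lim_transform_eventually)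
       (use filterlim_at_top_dense[THEN iffD1, OF f, rule_format, of 0] in \<open>auto simp: bump_def elim!: eventually_mono\<close>)
qed

section \<open>The fundamental lemma of the calculus of variations on the cube\<close>

lemma cube_eq_box: "cube = box 0 1"
  by (auto simp: cube_def mem_box_cart)

lemma cube_sets [measurable]: "cube \<in> sets borel" "cube \<in> sets lborel" "cube \<in> sets lebesgue"
  by (auto simp: cube_eq_box)

lemma space_cube_measure: "space cube_measure = cube"
  by (simp add: space_restrict_space)

lemma emeasure_cube: "emeasure lborel (cube :: (real^'n::finite) set) = 1"
proof -
  have "emeasure lborel (box 0 1 :: (real^'n) set) = ennreal (\<Prod>b\<in>Basis. (1 - 0 :: real^'n) \<bullet> b)"
    by (rule emeasure_lborel_box) (auto simp: Basis_vec_def inner_axis)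
  also have "(\<Prod>b\<in>Basis. (1 - 0 :: real^'n) \<bullet> b) = 1"
    by (rule prod.neutral) (auto simp: Basis_vec_def inner_axis)
  finally show ?thesis by (simp add: cube_eq_box)
qed

interpretation cube: finite_measure "cube_measure :: (real^'n::finite) measure"
  by standard (simp add: space_cube_measure emeasure_restrict_space emeasure_cube)

lemma borel_measurable_cube: "f \<in> borel_measurable borel \<Longrightarrow> f \<in> borel_measurable cube_measure"
  by (simp add: borel_measurable_if_I measurable_completion measurable_restrict_space1)

text \<open>A smooth approximation of the indicator of the open box. The shift by one keeps the
  points with nonzero value at distance at least \<open>1/k\<close> from the faces, so that the
  support is a compact subset of the box.\<close>

definition box_bump :: "real^'n::finite \<Rightarrow> real^'n \<Rightarrow> nat \<Rightarrow> real^'n \<Rightarrow> real" where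
  "box_bump a b k x = (\<Prod>i\<in>UNIV. bump (real k * (x $ i - a $ i) - 1) * bump (real k * (b $ i - x $ i) - 1))"

lemma smooth_box_bump: "smooth (box_bump a b k)"
proof -
  have "smooth (\<lambda>x. \<Prod>i\<in>UNIV. bump (real k * x $ i + (- real k * a $ i - 1)) * bump ((- real k) * x $ i + (real k * b $ i - 1)))"
    by (intro smooth_prod smooth_mult smooth_coord[where g = "\<lambda>t. bump (_ * t + _)"] smooth1_affine smooth1_bump) auto
  then show ?thesis by (simp add: box_bump_def[abs_def] algebra_simps)
qed

lemma box_bump_nonzero:
  assumes "box_bump a b k x \<noteq> 0"
  shows "k > 0" "a $ i + 1 / real k \<le> x $ i" "x $ i \<le> b $ i - 1 / real k"
proof -
  have *: "real k * (x $ i - a $ i) > 1" "real k * (b $ i - x $ i) > 1" for i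
    using assms by (auto simp: box_bump_def bump_eq_0_iff not_le)
  show k: "k > 0" using *(1)[of i] by (cases k) auto
  show "a $ i + 1 / real k \<le> x $ i" "x $ i \<le> b $ i - 1 / real k"
    using *[of i] k by (auto simp: field_simps)
qed

lemma box_bump_test:
  assumes "\<And>i. 0 \<le> a $ i" "\<And>i. b $ i \<le> 1"
  shows "box_bump a b k \<in> test_functions cube"
proof (cases "k > 0")
  case True
  let ?C = "cbox (\<chi> i. a $ i + 1 / real k) (\<chi> i. b $ i - 1 / real k)"
  have "{x. box_bump a b k x \<noteq> 0} \<subseteq> ?C"
    using box_bump_nonzero[of a b k] by (auto simp: mem_box_cart)
  then have sub: "closure {x. box_bump a b k x \<noteq> 0} \<subseteq> ?C"
    by (rule closure_minimal) auto
  have "?C \<subseteq> cube"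
  proof
    fix x assume x: "x \<in> ?C"
    have "0 < x $ i \<and> x $ i < 1" for i
    proof -
      have "a $ i + 1 / real k \<le> x $ i" "x $ i \<le> b $ i - 1 / real k" using x by (auto simp: mem_box_cart)
      moreover have "1 / real k > 0" using True by simp
      ultimately show ?thesis using assms[of i] by linarith
    qed
    then show "x \<in> cube" by (simp add: cube_def)
  qed
  moreover have "compact (closure {x. box_bump a b k x \<noteq> 0})"
    using bounded_subset[OF bounded_cbox sub] by (simp add: compact_eq_bounded_closed)
  ultimately show ?thesis
    unfolding test_functions_def using sub smooth_box_bump by auto
next
  case False
  then have "{x. box_bump a b k x \<noteq> 0} = {}" using box_bump_nonzero(1)[of a b k] by auto
  then show ?thesis unfolding test_functions_def using smooth_box_bump[of a b k] by simp
qed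

lemma box_bump_bounds: "0 \<le> box_bump a b k x" "box_bump a b k x \<le> 1"
proof -
  show "0 \<le> box_bump a b k x" unfolding box_bump_def by (intro prod_nonneg) (auto simp: bump_bounds)
  have "box_bump a b k x \<le> (\<Prod>i\<in>(UNIV::'a set). 1)"
    unfolding box_bump_def by (intro prod_mono) (auto simp: bump_bounds mult_le_one)
  then show "box_bump a b k x \<le> 1" by simp
qed

lemma tendsto_box_bump: "(\<lambda>k. box_bump a b k x) \<longlonglongrightarrow> indicator (box a b) x"
proof (cases "x \<in> box a b")
  case True
  then have "(\<lambda>k. box_bump a b k x) \<longlonglongrightarrow> (\<Prod>i\<in>(UNIV::'a set). 1 * 1)"
    unfolding box_bump_def by (intro tendsto_prod tendsto_mult tendsto_bump) (auto simp: mem_box_cart)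
  then show ?thesis using True by simp
next
  case False
  have "box_bump a b k x = 0" for k
  proof (rule ccontr)
    assume nz: "box_bump a b k x \<noteq> 0"
    have "a $ i < x $ i \<and> x $ i < b $ i" for i
    proof -
      have "1 / real k > 0" using box_bump_nonzero(1)[OF nz] by simp
      then show ?thesis using box_bump_nonzero(2,3)[OF nz, of i] by linarith
    qed
    with False show False by (auto simp: mem_box_cart)
  qed
  then show ?thesis using False by simp
qed

text \<open>Dominated convergence replaces test functions by indicators of boxes. Boxes are stable
  under intersection and generate the Borel sets, so \<open>g\<close> has integral zero over every
  measurable part of the cube.\<close>

lemma AE_zero_if_test_integrals_zero:
  fixes g :: "real^'n::finite \<Rightarrow> real"
  assumes g: "integrable cube_measure g"
    and zero: "\<And>\<phi>. \<phi> \<in> test_functions cube \<Longrightarrow> (LINT x|cube_measure. g x * \<phi> x) = 0"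
  shows "AE x in cube_measure. g x = 0"
proof (rule cube.density_zero[OF g])
  let ?I = "\<lambda>A. set_lebesgue_integral cube_measure (A \<inter> cube) g"
  have sets: "A \<inter> cube \<in> sets cube_measure" if "A \<in> sets borel" for A :: "(real^'n) set"
    using that by (auto simp: sets_restrict_space)
  have si: "set_integrable cube_measure (A \<inter> cube) g" if "A \<in> sets borel" for A
    unfolding set_integrable_def by (rule integrable_mult_indicator[OF sets[OF that] g])
  have box0: "?I (box a b) = 0" if ab: "\<And>i. 0 \<le> a $ i" "\<And>i. b $ i \<le> 1" for a b
  proof -
    have "(\<lambda>k. LINT x|cube_measure. g x * box_bump a b k x) \<longlonglongrightarrow> (LINT x|cube_measure. g x * indicator (box a b) x)"
    proof (rule integral_dominated_convergence[where w = "\<lambda>x. norm (g x)"])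
      show "AE x in cube_measure. norm (g x * box_bump a b k x) \<le> norm (g x)" for k
        using box_bump_bounds[of a b k] mult_left_le[of "box_bump a b k _" "\<bar>g _\<bar>"]
        by (intro AE_I2) (simp add: abs_mult)
      show "(\<lambda>x. g x * box_bump a b k x) \<in> borel_measurable cube_measure" for k
        by (intro borel_measurable_times borel_measurable_integrable[OF g] borel_measurable_cube[OF smooth_borel_measurable[OF smooth_box_bump]])
      show "(\<lambda>x. g x * indicator (box a b) x) \<in> borel_measurable cube_measure"
        by (intro borel_measurable_times borel_measurable_integrable[OF g] borel_measurable_cube[of "indicator (box a b)"]) auto
      show "AE x in cube_measure. (\<lambda>k. g x * box_bump a b k x) \<longlonglongrightarrow> g x * indicator (box a b) x"
        by (intro AE_I2 tendsto_mult_left tendsto_box_bump)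
    qed (use g in auto)
    moreover have "(LINT x|cube_measure. g x * box_bump a b k x) = 0" for k
      by (rule zero[OF box_bump_test[OF ab]])
    ultimately have "(LINT x|cube_measure. g x * indicator (box a b) x) = 0"
      by (simp add: LIMSEQ_const_iff)
    moreover have "?I (box a b) = (LINT x|cube_measure. g x * indicator (box a b) x)"
      unfolding set_lebesgue_integral_def
      by (rule Bochner_Integration.integral_cong) (auto simp: space_cube_measure indicator_def)
    ultimately show ?thesis by simp
  qed
  \<comment> \<open>Only the part of the box inside the cube matters, so its corners may be clipped
    to the unit interval, where \<open>box_bump\<close> is a test function.\<close>
  have box: "?I (box a b) = 0" for a b :: "real^'n"
  proof -
    have "?I (box a b) = ?I (box (\<chi> i. max 0 (a $ i)) (\<chi> i. min 1 (b $ i)))"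
      unfolding set_lebesgue_integral_def
      by (rule Bochner_Integration.integral_cong)
         (auto simp: space_cube_measure cube_def mem_box_cart indicator_def)
    also have "\<dots> = 0" by (rule box0) auto
    finally show ?thesis .
  qed
  have univ: "?I UNIV = 0"
  proof -
    have "?I UNIV = ?I (box 0 1)"
      unfolding set_lebesgue_integral_def
      by (rule Bochner_Integration.integral_cong) (auto simp: space_cube_measure cube_eq_box)
    then show ?thesis using box by simp
  qed
  have borel0: "?I A = 0" if A: "A \<in> sets borel" for A
  proof -
    have Int: "Int_stable (range (\<lambda>(a, b). box a b :: (real^'n) set))"
      by (auto simp: Int_stable_def box_Int_box)
    have sb: "sigma_sets UNIV (range (\<lambda>(a, b). box a b :: (real^'n) set)) = sets borel"
      by (subst borel_eq_box) simp
    have A': "A \<in> sigma_sets UNIV (range (\<lambda>(a, b). box a b :: (real^'n) set))"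
      using A sb by simp
    have "range (\<lambda>(a, b). box a b :: (real^'n) set) \<subseteq> Pow UNIV" by simp
    from Int this A' show ?thesis
    proof (induction rule: sigma_sets_induct_disjoint)
      case (basic A)
      then show ?case using box by auto
    next
      case empty
      then show ?case by (simp add: set_lebesgue_integral_def)
    next
      case (compl A)
      then have A: "A \<in> sets borel" using sb by simp
      have "set_lebesgue_integral cube_measure ((A \<inter> cube) \<union> ((UNIV - A) \<inter> cube)) g = ?I A + ?I (UNIV - A)"
        by (rule set_integral_Un) (use A si in auto)
      moreover have "(A \<inter> cube) \<union> ((UNIV - A) \<inter> cube) = UNIV \<inter> cube" by auto
      ultimately have "?I UNIV = ?I A + ?I (UNIV - A)" by simp
      then show ?case using compl univ by simp
    next
      case (union A)
      then have A: "A i \<in> sets borel" for i using sb by auto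
      have "set_lebesgue_integral cube_measure (\<Union>i. A i \<inter> cube) g = (\<Sum>i. ?I (A i))"
        by (rule lebesgue_integral_countable_add)
           (use A union(1) sets si[of "\<Union>i. A i"] in \<open>auto simp: disjoint_family_on_def UN_simps\<close>)
      then show ?case using union by simp
    qed
  qed
  \<comment> \<open>A Lebesgue set is a Borel set up to a null set, so the Borel case
    suffices.\<close>
  fix A assume A: "A \<in> sets (cube_measure :: (real^'n) measure)"
  then have "A \<in> sets (completion lborel)"
    by (auto simp: sets_restrict_space)
  then obtain S N N' where S: "A = S \<union> N" "N \<subseteq> N'" "N' \<in> null_sets lborel" "S \<in> sets lborel"
    by (rule sets_completionE)
  have "AE x in lebesgue. x \<notin> N'"
    using S(3) by (intro AE_not_in) (simp add: null_sets_completionI)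
  then have "AE x in cube_measure. x \<notin> N'"
    by (subst AE_restrict_space_iff) (auto elim: eventually_mono)
  then have "set_lebesgue_integral cube_measure A g = ?I S"
    unfolding set_lebesgue_integral_def
  proof (intro integral_cong_AE)
    show "AE x in cube_measure. indicat_real A x *\<^sub>R g x = indicat_real (S \<inter> cube) x *\<^sub>R g x"
      if "AE x in cube_measure. x \<notin> N'"
      using that AE_space by eventually_elim (use S in \<open>auto simp: indicator_def space_cube_measure\<close>)
    show "(\<lambda>x. indicat_real A x *\<^sub>R g x) \<in> borel_measurable cube_measure"
      using integrable_mult_indicator[OF A g] by auto
    show "(\<lambda>x. indicat_real (S \<inter> cube) x *\<^sub>R g x) \<in> borel_measurable cube_measure"
      using integrable_mult_indicator[OF sets g, of S] S by auto
  qed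
  then show "set_lebesgue_integral cube_measure A g = 0" using borel0 S by simp
qed

section \<open>Integration by parts on the cube\<close>

abbreviation upd :: "'n::finite \<Rightarrow> real \<Rightarrow> real^'n \<Rightarrow> real^'n" where
  "upd j s x \<equiv> (\<chi> k. if k = j then s else x $ k)"

lemma prod_Basis_vec: "(\<Prod>b\<in>Basis. (x :: real^'n::finite) \<bullet> b) = (\<Prod>i\<in>UNIV. x $ i)"
proof -
  have B: "(Basis :: (real^'n) set) = (\<lambda>i. axis i 1) ` UNIV" by (auto simp: Basis_vec_def)
  have "inj (\<lambda>i. axis i (1::real) :: real^'n)" by (auto simp: inj_on_def axis_eq_axis)
  then show ?thesis unfolding B by (simp add: prod.reindex inner_axis)
qed

lemma continuous_on_upd:
  assumes "continuous_on S f" "continuous_on S g"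
  shows "continuous_on S (\<lambda>p. upd j (f p) (g p))"
proof (rule continuous_on_vec_lambda)
  fix k
  show "continuous_on S (\<lambda>p. if k = j then f p else g p $ k)"
    using assms by (cases "k = j") (auto intro: continuous_on_component)
qed

lemma continuous_on_upd_value: "continuous_on S (\<lambda>s. upd j s x)"
  by (intro continuous_on_upd continuous_on_id continuous_on_const)

lemma continuous_on_upd_vector: "continuous_on S (upd j c)"
  by (intro continuous_on_upd continuous_on_id continuous_on_const)

lemma measurable_upd [measurable]: "(\<lambda>p. upd j (snd p) (fst p)) \<in> borel_measurable (lborel \<Otimes>\<^sub>M lborel)"
  unfolding lborel_prod measurable_lborel1 measurable_lborel2
  by (intro borel_measurable_continuous_onI continuous_on_upd continuous_intros)

lemma measurable_upd_cube: "upd j c \<in> borel_measurable cube_measure"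
proof (rule borel_measurable_cube, rule borel_measurable_continuous_onI)
  show "continuous_on UNIV (upd j c)"
    by (rule continuous_on_upd_vector)
qed

text \<open>Resampling one coordinate in a slab of width one preserves Lebesgue measure; this replaces a
  splitting of the \<open>n\<close>-dimensional integral into iterated ones.\<close>

lemma lborel_eq_distr_upd:
  fixes j :: "'n::finite"
  defines "S \<equiv> {p :: (real^'n) \<times> real. 0 < fst p $ j \<and> fst p $ j < 1}"
  shows "lborel = distr (restrict_space (lborel \<Otimes>\<^sub>M lborel) S) borel (\<lambda>p. upd j (snd p) (fst p))"
proof (rule lborel_eqI)
  have S: "S \<in> sets (lborel \<Otimes>\<^sub>M lborel)"
  proof -
    have "open S" unfolding S_def by (intro open_Collect_conj open_Collect_less continuous_intros)
    then show ?thesis by (subst lborel_prod) simp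
  qed
  fix l u :: "real^'n"
  assume lu: "\<And>b. b \<in> Basis \<Longrightarrow> l \<bullet> b \<le> u \<bullet> b"
  have lui: "l $ i \<le> u $ i" for i using lu[of "axis i 1"] by (simp add: inner_axis)
  \<comment> \<open>The old value of coordinate \<open>j\<close> ranges freely over (0,1) and
    contributes the factor one; the new value \<open>snd p\<close> takes its place in the
    box.\<close>
  have pre: "(\<lambda>p. upd j (snd p) (fst p)) -` box l u \<inter> S = box (upd j 0 l) (upd j 1 u) \<times> {l $ j<..<u $ j}"
    unfolding S_def by (auto simp: mem_box_cart split: if_splits)
  have le': "(upd j 0 l) \<bullet> b \<le> (upd j 1 u) \<bullet> b" if "b \<in> Basis" for b
    using that lui by (auto simp: Basis_vec_def inner_axis)
  have "emeasure (distr (restrict_space (lborel \<Otimes>\<^sub>M lborel) S) borel (\<lambda>p. upd j (snd p) (fst p))) (box l u)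
      = emeasure (restrict_space (lborel \<Otimes>\<^sub>M lborel) S) ((\<lambda>p. upd j (snd p) (fst p)) -` box l u \<inter> S)"
    by (subst emeasure_distr) (auto intro!: measurable_restrict_space1 simp: space_restrict_space space_pair_measure)
  also have "\<dots> = emeasure (lborel \<Otimes>\<^sub>M lborel) (box (upd j 0 l) (upd j 1 u) \<times> {l $ j<..<u $ j})"
    using S unfolding pre[symmetric] by (subst emeasure_restrict_space) auto
  also have "\<dots> = emeasure lborel (box (upd j 0 l) (upd j 1 u)) * emeasure lborel {l $ j<..<u $ j}"
    by (rule lborel.emeasure_pair_measure_Times) auto
  also have "\<dots> = ennreal (\<Prod>i\<in>UNIV. (upd j 1 u - upd j 0 l) $ i) * ennreal (u $ j - l $ j)"
    using lui by (simp only: emeasure_lborel_box[OF le'] prod_Basis_vec emeasure_lborel_Ioo)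
  also have "\<dots> = ennreal ((\<Prod>i\<in>UNIV. (upd j 1 u - upd j 0 l) $ i) * (u $ j - l $ j))"
    using lui by (subst ennreal_mult) (auto intro!: prod_nonneg)
  also have "(\<Prod>i\<in>UNIV. (upd j 1 u - upd j 0 l) $ i) * (u $ j - l $ j) = (\<Prod>i\<in>UNIV. (u - l) $ i)"
    by (simp add: prod.remove[of UNIV j])
  finally show "emeasure (distr (restrict_space (lborel \<Otimes>\<^sub>M lborel) S) borel (\<lambda>p. upd j (snd p) (fst p))) (box l u)
      = ennreal (\<Prod>b\<in>Basis. (u - l) \<bullet> b)"
    by (simp only: prod_Basis_vec)
qed simp

lemma integral_cube_eq_lborel:
  fixes f :: "real^'n::finite \<Rightarrow> real"
  assumes f: "f \<in> borel_measurable borel"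
  shows "(LINT x|cube_measure. f x) = (LINT x|lborel. indicator cube x * f x)"
proof -
  have "(LINT x|cube_measure. f x) = (LINT x|lebesgue. indicator cube x * f x)"
    by (subst integral_restrict_space) auto
  also have "\<dots> = (LINT x|lborel. indicator cube x * f x)"
    using f by (intro integral_completion) auto
  finally show ?thesis .
qed

lemma cube_subset_cbox: "cube \<subseteq> cbox 0 1"
  by (auto simp: cube_def mem_box_cart less_imp_le)

lemma bounded_on_cbox:
  fixes f :: "real^'n::finite \<Rightarrow> real"
  assumes "continuous_on UNIV f"
  obtains K where "K \<ge> 0" "\<And>x. x \<in> cbox 0 1 \<Longrightarrow> \<bar>f x\<bar> \<le> K"
proof -
  have "compact (f ` cbox 0 1)"
    by (rule compact_continuous_image[OF continuous_on_subset[OF assms]]) auto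
  then have "\<exists>K. \<forall>x\<in>cbox 0 1. \<bar>f x\<bar> \<le> K"
    by (auto dest!: compact_imp_bounded simp: bounded_iff)
  then obtain K where K: "\<And>x. x \<in> cbox 0 1 \<Longrightarrow> \<bar>f x\<bar> \<le> K" by blast
  show ?thesis by (rule that[of "max K 0"]) (use K in \<open>auto simp: max.coboundedI1\<close>)
qed

text \<open>Fubini for the pair space of \<open>lborel_eq_distr_upd\<close>. Coordinate
  \<open>j\<close> of the outer \<open>x\<close> is still integrated, but the inner integral ignores
  it and it runs over an interval of length one.\<close>

lemma integral_cube_upd:
  fixes f :: "real^'n::finite \<Rightarrow> real"
  assumes f: "continuous_on UNIV f"
  shows "(LINT x|cube_measure. f x)
       = (LINT x|lborel. indicator cube x * (LINT s|lborel. indicator {0..1} s * f (upd j s x)))"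
proof -
  let ?S = "{p :: (real^'n) \<times> real. 0 < fst p $ j \<and> fst p $ j < 1}"
  let ?u = "\<lambda>p :: (real^'n) \<times> real. upd j (snd p) (fst p)"
  have S: "?S \<in> sets (lborel \<Otimes>\<^sub>M lborel)"
  proof -
    have "open ?S" by (intro open_Collect_conj open_Collect_less continuous_intros)
    then show ?thesis by (subst lborel_prod) simp
  qed
  have fm [measurable]: "f \<in> borel_measurable borel" using f by (rule borel_measurable_continuous_onI)
  have fu [measurable]: "(\<lambda>p. f (?u p)) \<in> borel_measurable (lborel \<Otimes>\<^sub>M lborel)"
    by measurable
  have split: "indicator ?S p * (indicator cube (?u p) * f (?u p))
      = indicator cube (fst p) * (indicator {0<..<1} (snd p) * f (?u p))" for p
  proof -
    have "(p \<in> ?S \<and> ?u p \<in> cube) \<longleftrightarrow> (fst p \<in> cube \<and> snd p \<in> {0<..<1})"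
      by (auto simp: cube_def split: if_splits)
    then show ?thesis by (auto simp: indicator_def)
  qed
  obtain K where K: "K \<ge> 0" "\<And>x. x \<in> cbox 0 1 \<Longrightarrow> \<bar>f x\<bar> \<le> K" using bounded_on_cbox[OF f] by blast
  have "emeasure (lborel \<Otimes>\<^sub>M lborel) ((cube :: (real^'n) set) \<times> {0<..<1::real}) = 1"
    by (subst lborel.emeasure_pair_measure_Times) (auto simp: emeasure_cube)
  then have "integrable (lborel \<Otimes>\<^sub>M lborel) (indicator ((cube :: (real^'n) set) \<times> {0<..<1::real}) :: _ \<Rightarrow> real)"
    by (intro integrable_real_indicator) auto
  then have "integrable (lborel \<Otimes>\<^sub>M lborel) (\<lambda>p. K * indicator ((cube :: (real^'n) set) \<times> {0<..<1::real}) p)"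
    by simp
  then have int: "integrable (lborel \<Otimes>\<^sub>M lborel) (\<lambda>p. indicator cube (fst p) * (indicator {0<..<1} (snd p) * f (?u p)))"
  proof (rule Bochner_Integration.integrable_bound)
    show "AE p in lborel \<Otimes>\<^sub>M lborel. norm (indicator cube (fst p) * (indicator {0<..<1} (snd p) * f (?u p)))
        \<le> norm (K * indicator ((cube :: (real^'n) set) \<times> {0<..<1::real}) p)"
    proof (rule AE_I2)
      fix p :: "(real^'n) \<times> real"
      have "?u p \<in> cbox 0 1" if "fst p \<in> cube" "snd p \<in> {0<..<1}"
        using that by (auto simp: cube_def mem_box_cart less_imp_le)
      then show "norm (indicator cube (fst p) * (indicator {0<..<1} (snd p) * f (?u p)))
        \<le> norm (K * indicator ((cube :: (real^'n) set) \<times> {0<..<1::real}) p)"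
        using K by (cases p) (auto simp: indicator_def)
    qed
  qed measurable
  have "(LINT x|cube_measure. f x) = (LINT x|lborel. indicator cube x * f x)"
    by (rule integral_cube_eq_lborel[OF fm])
  also have "\<dots> = (LINT x|(distr (restrict_space (lborel \<Otimes>\<^sub>M lborel) ?S) borel ?u). indicator cube x * f x)"
    by (subst lborel_eq_distr_upd[of j]) (rule refl)
  also have "\<dots> = (LINT p|(restrict_space (lborel \<Otimes>\<^sub>M lborel) ?S). indicator cube (?u p) * f (?u p))"
    by (rule integral_distr) (auto intro!: measurable_restrict_space1)
  also have "\<dots> = (LINT p|(lborel \<Otimes>\<^sub>M lborel). indicator ?S p * (indicator cube (?u p) * f (?u p)))"
    using S by (subst integral_restrict_space) auto
  also have "\<dots> = (LINT p|(lborel \<Otimes>\<^sub>M lborel). indicator cube (fst p) * (indicator {0<..<1} (snd p) * f (?u p)))"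
    by (simp only: split)
  also have "\<dots> = (LINT x|lborel. LINT s|lborel. indicator cube x * (indicator {0<..<1} s * f (upd j s x)))"
    by (rule lborel_pair.integral_fst'[OF int, unfolded fst_conv snd_conv, symmetric])
  also have "\<dots> = (LINT x|lborel. indicator cube x * (LINT s|lborel. indicator {0..1} s * f (upd j s x)))"
  proof (rule Bochner_Integration.integral_cong[OF refl])
    fix x :: "real^'n"
    have [measurable]: "(\<lambda>s. f (upd j s x)) \<in> borel_measurable borel"
      by (rule borel_measurable_continuous_onI, rule continuous_on_compose2[OF f])
         (auto intro: continuous_on_upd_value)
    \<comment> \<open>Closing the interval adds two points of measure zero and suits the fundamental
      theorem of calculus.\<close>
    have "(LINT s|lborel. indicator {0<..<1} s * f (upd j s x)) = (LINT s|lborel. indicator {0..1} s * f (upd j s x))"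
    proof (rule integral_cong_AE)
      show "AE s in lborel. indicator {0<..<1} s * f (upd j s x) = indicator {0..1} s * f (upd j s x)"
        using AE_lborel_singleton[of 0] AE_lborel_singleton[of 1]
        by eventually_elim (auto simp: indicator_def)
    qed measurable
    then show "(LINT s|lborel. indicator cube x * (indicator {0<..<1} s * f (upd j s x)))
        = indicator cube x * (LINT s|lborel. indicator {0..1} s * f (upd j s x))"
      by simp
  qed
  finally show ?thesis .
qed

text \<open>The fundamental theorem of calculus on every segment in direction \<open>j\<close>. As
  the cube has width one, integrating \<open>f (upd j c x)\<close> over the cube amounts to
  integrating \<open>f\<close> over a face; all boundary terms are written in this way.\<close>

lemma integral_cube_partial:
  assumes f: "smooth f"
  shows "(LINT x|cube_measure. partial j f x) = (LINT x|cube_measure. f (upd j 1 x) - f (upd j 0 x))"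
proof -
  have cont: "continuous_on UNIV (\<lambda>s. g (upd j s x))" if "continuous_on UNIV g" for g :: "real^'a \<Rightarrow> real" and x
    by (rule continuous_on_compose2[OF that continuous_on_upd_value]) auto
  have *: "(LINT s|lborel. indicator {0..1} s * partial j f (upd j s x)) = f (upd j 1 x) - f (upd j 0 x)" for x
  proof -
    have "(LINT s|lborel. indicator {0..1} s *\<^sub>R partial j f (upd j s x)) = f (upd j 1 x) - f (upd j 0 x)"
    proof (rule integral_FTC_atLeastAtMost)
      show "continuous_on {0..1} (\<lambda>s. partial j f (upd j s x))"
        using cont[OF smooth_continuous[OF smooth_partial[OF f]]] continuous_on_subset by blast
    qed (use smooth_partial_deriv[OF f] in
         \<open>auto simp: has_real_derivative_iff_has_vector_derivative intro: has_vector_derivative_at_within\<close>)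
    then show ?thesis by simp
  qed
  have "(LINT x|cube_measure. partial j f x) = (LINT x|lborel. indicator cube x * (f (upd j 1 x) - f (upd j 0 x)))"
    by (subst integral_cube_upd[OF smooth_continuous[OF smooth_partial[OF f]], where j = j]) (simp only: *)
  also have "\<dots> = (LINT x|cube_measure. f (upd j 1 x) - f (upd j 0 x))"
  proof -
    have "continuous_on UNIV (\<lambda>x. f (upd j c x))" for c
      by (rule continuous_on_compose2[OF smooth_continuous[OF f] continuous_on_upd_vector]) auto
    then show ?thesis
      by (intro integral_cube_eq_lborel[symmetric] borel_measurable_continuous_onI continuous_on_diff)
  qed
  finally show ?thesis .
qed

lemma L2_continuous:
  fixes f :: "real^'n::finite \<Rightarrow> real"
  assumes f: "continuous_on UNIV f"
  shows "f \<in> L2 cube_measure"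
proof -
  obtain K where "\<And>x. x \<in> cbox 0 1 \<Longrightarrow> \<bar>f x\<bar> \<le> K" using bounded_on_cbox[OF f] by blast
  then show ?thesis
    using cube_subset_cbox
    by (intro cube.L2_of_bounded[where K = K] borel_measurable_cube borel_measurable_continuous_onI f AE_I2)
       (auto simp: space_cube_measure)
qed

lemma L2_smooth: "smooth f \<Longrightarrow> f \<in> L2 cube_measure"
  by (rule L2_continuous[OF smooth_continuous])

lemma integrable_mult_L2:
  fixes f g :: "'a \<Rightarrow> real"
  shows "f \<in> L2 M \<Longrightarrow> g \<in> L2 M \<Longrightarrow> integrable M (\<lambda>x. f x * g x)"
  using L2_integrable_inner[of f M g] by simp

lemma Green_smooth:
  assumes f: "smooth f" and g: "smooth g"
  shows "(LINT x|cube_measure. partial j f x * g x) + (LINT x|cube_measure. f x * partial j g x)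
       = (LINT x|cube_measure. f (upd j 1 x) * g (upd j 1 x) - f (upd j 0 x) * g (upd j 0 x))"
proof -
  have "(LINT x|cube_measure. partial j (\<lambda>x. f x * g x) x)
      = (LINT x|cube_measure. partial j f x * g x) + (LINT x|cube_measure. f x * partial j g x)"
    using f g by (subst Bochner_Integration.integral_add[symmetric])
      (auto simp: partial_mult smooth_differentiable add.commute intro!: integrable_mult_L2 L2_smooth smooth_partial)
  then show ?thesis by (simp add: integral_cube_partial[OF smooth_mult[OF f g]])
qed

lemma Green_smooth_vanishing:
  assumes "smooth f" "smooth g" "\<And>x c. c \<in> {0, 1} \<Longrightarrow> g (upd j c x) = 0"
  shows "(LINT x|cube_measure. partial j f x * g x) = - (LINT x|cube_measure. f x * partial j g x)"
  using Green_smooth[OF assms(1,2), of j] assms(3) by simp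

lemma test_function_smooth: "\<phi> \<in> test_functions \<Omega> \<Longrightarrow> smooth \<phi>"
  by (simp add: test_functions_def)

lemma test_function_vanishes:
  assumes "\<phi> \<in> test_functions cube" "c \<in> {0, 1}"
  shows "\<phi> (upd j c x) = 0"
proof (rule ccontr)
  assume "\<phi> (upd j c x) \<noteq> 0"
  then have "upd j c x \<in> cube"
    using assms(1) closure_subset[of "{x. \<phi> x \<noteq> 0}"] unfolding test_functions_def by blast
  then have "0 < upd j c x $ j \<and> upd j c x $ j < 1" unfolding cube_def by blast
  then show False using assms(2) by auto
qed

section \<open>Weak derivatives on the cube\<close>

lemma has_weak_partial_smooth:
  assumes "smooth f"
  shows "has_weak_partial cube i f (partial i f)"
  unfolding has_weak_partial_def
proof
  fix \<phi> :: "real^'a \<Rightarrow> real" assume \<phi>: "\<phi> \<in> test_functions cube"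
  have "(LINT x|cube_measure. partial i f x * \<phi> x) = - (LINT x|cube_measure. f x * partial i \<phi> x)"
    by (rule Green_smooth_vanishing[OF assms test_function_smooth[OF \<phi>] test_function_vanishes[OF \<phi>]])
  then show "(LINT x|cube_measure. f x * partial i \<phi> x) = - (LINT x|cube_measure. partial i f x * \<phi> x)"
    by simp
qed

lemma smooth_H1: "smooth f \<Longrightarrow> f \<in> H1 cube"
  unfolding H1_def using has_weak_partial_smooth L2_smooth smooth_partial by blast

lemma H1_L2: "u \<in> H1 \<Omega> \<Longrightarrow> u \<in> L2 (lebesgue_on \<Omega>)"
  by (simp add: H1_def)

lemma weak_partial:
  assumes "u \<in> H1 \<Omega>"
  shows "weak_partial \<Omega> i u \<in> L2 (lebesgue_on \<Omega>)" "has_weak_partial \<Omega> i u (weak_partial \<Omega> i u)"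
proof -
  have "\<exists>g. g \<in> L2 (lebesgue_on \<Omega>) \<and> has_weak_partial \<Omega> i u g" using assms unfolding H1_def by blast
  from someI_ex[OF this]
  show "weak_partial \<Omega> i u \<in> L2 (lebesgue_on \<Omega>)" "has_weak_partial \<Omega> i u (weak_partial \<Omega> i u)"
    unfolding weak_partial_def by auto
qed

lemma has_weak_partial_unique:
  assumes g: "g \<in> L2 cube_measure" "g' \<in> L2 cube_measure"
    and w: "has_weak_partial cube i u g" "has_weak_partial cube i u g'"
  shows "AE x in cube_measure. g x = g' x"
proof -
  have "AE x in cube_measure. g x - g' x = 0"
  proof (rule AE_zero_if_test_integrals_zero)
    show "integrable cube_measure (\<lambda>x. g x - g' x)" by (rule cube.L1_le_L2(1)[OF L2.diff[OF g]])
    fix \<phi> :: "real^'a \<Rightarrow> real" assume \<phi>: "\<phi> \<in> test_functions cube"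
    then have "(LINT x|cube_measure. g x * \<phi> x) = (LINT x|cube_measure. g' x * \<phi> x)"
      using w[unfolded has_weak_partial_def, THEN bspec, OF \<phi>] by simp
    then show "(LINT x|cube_measure. (g x - g' x) * \<phi> x) = 0"
      using g L2_smooth[OF test_function_smooth[OF \<phi>]] by (simp add: left_diff_distrib integrable_mult_L2)
  qed
  then show ?thesis by eventually_elim simp
qed

lemma weak_partial_unique:
  assumes "u \<in> H1 cube" "g \<in> L2 cube_measure" "has_weak_partial cube i u g"
  shows "AE x in cube_measure. weak_partial cube i u x = g x"
  by (rule has_weak_partial_unique[OF weak_partial(1)[OF assms(1)] assms(2) weak_partial(2)[OF assms(1)] assms(3)])

lemma weak_partial_smooth:
  "smooth f \<Longrightarrow> AE x in cube_measure. weak_partial cube i f x = partial i f x"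
  by (rule weak_partial_unique[OF smooth_H1 L2_smooth[OF smooth_partial] has_weak_partial_smooth])

lemma has_weak_partial_add:
  assumes u: "u \<in> L2 cube_measure" "g \<in> L2 cube_measure" "has_weak_partial cube i u g"
    and v: "v \<in> L2 cube_measure" "h \<in> L2 cube_measure" "has_weak_partial cube i v h"
  shows "has_weak_partial cube i (\<lambda>x. u x + v x) (\<lambda>x. g x + h x)"
  unfolding has_weak_partial_def
proof
  fix \<phi> :: "real^'a \<Rightarrow> real" assume \<phi>: "\<phi> \<in> test_functions cube"
  have [simp]: "\<phi> \<in> L2 cube_measure" "partial i \<phi> \<in> L2 cube_measure"
    using test_function_smooth[OF \<phi>] by (auto intro: L2_smooth smooth_partial)
  show "(LINT x|cube_measure. (u x + v x) * partial i \<phi> x) = - (LINT x|cube_measure. (g x + h x) * \<phi> x)"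
    using u v \<phi> by (simp add: distrib_right integrable_mult_L2 has_weak_partial_def)
qed

lemma has_weak_partial_scale:
  "has_weak_partial \<Omega> i u g \<Longrightarrow> has_weak_partial \<Omega> i (\<lambda>x. a *\<^sub>R u x) (\<lambda>x. a *\<^sub>R g x)"
  by (simp add: has_weak_partial_def mult.assoc)

lemma H1_add: "u \<in> H1 cube \<Longrightarrow> v \<in> H1 cube \<Longrightarrow> (\<lambda>x. u x + v x) \<in> H1 cube"
  unfolding H1_def using has_weak_partial_add L2.add by blast

lemma H1_scale: "u \<in> H1 cube \<Longrightarrow> (\<lambda>x. a *\<^sub>R u x) \<in> H1 cube"
  unfolding H1_def using has_weak_partial_scale L2.scale by blast

lemma weak_partial_add:
  assumes "u \<in> H1 cube" "v \<in> H1 cube"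
  shows "AE x in cube_measure. weak_partial cube i (\<lambda>x. u x + v x) x = weak_partial cube i u x + weak_partial cube i v x"
  by (rule weak_partial_unique[OF H1_add[OF assms] L2.add[OF weak_partial(1)[OF assms(1)] weak_partial(1)[OF assms(2)]]
        has_weak_partial_add[OF H1_L2[OF assms(1)] weak_partial[OF assms(1)] H1_L2[OF assms(2)] weak_partial[OF assms(2)]]])

lemma weak_partial_scale:
  assumes "u \<in> H1 cube"
  shows "AE x in cube_measure. weak_partial cube i (\<lambda>x. a *\<^sub>R u x) x = a *\<^sub>R weak_partial cube i u x"
  by (rule weak_partial_unique[OF H1_scale[OF assms] L2.scale[OF weak_partial(1)[OF assms]]
        has_weak_partial_scale[OF weak_partial(2)[OF assms]]])

text \<open>With value and gradient in one vector, the \<open>H1\<close> norm of \<open>u\<close> is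
  the \<open>L2\<close> norm of \<open>jet u\<close>, so that inner product, Cauchy-Schwarz and
  completeness are inherited from \<open>L2\<close>.\<close>

definition jet :: "(real^'n::finite \<Rightarrow> real) \<Rightarrow> real^'n \<Rightarrow> real \<times> (real^'n)" where
  "jet u x = (u x, \<chi> i. weak_partial cube i u x)"

lemma L2_Pair:
  assumes "f \<in> L2 M" "g \<in> L2 M"
  shows "(\<lambda>x. (f x, g x)) \<in> L2 M"
  using assms by (auto simp: L2_def norm_Pair)

lemma norm_vec_square: "(norm (x :: 'a::euclidean_space^'n::finite))\<^sup>2 = (\<Sum>i\<in>UNIV. (norm (x $ i))\<^sup>2)"
  by (simp add: norm_vec_def L2_set_def sum_nonneg)

lemma L2_vec:
  fixes f :: "'n::finite \<Rightarrow> 'a \<Rightarrow> 'b::euclidean_space"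
  assumes "\<And>i. f i \<in> L2 M"
  shows "(\<lambda>x. \<chi> i. f i x) \<in> L2 M"
proof -
  have "(\<lambda>x. \<chi> i. f i x) \<in> borel_measurable M"
    by (subst borel_measurable_euclidean_space)
       (use assms in \<open>auto simp: L2_def Basis_vec_def inner_axis intro!: borel_measurable_inner\<close>)
  then show ?thesis using assms by (auto simp: L2_def norm_vec_square)
qed

lemma L2_vec_nth:
  fixes f :: "'a \<Rightarrow> 'b::euclidean_space^'n::finite"
  assumes "f \<in> L2 M"
  shows "(\<lambda>x. f x $ i) \<in> L2 M"
proof (rule L2_bound[OF _ L2_integrable[OF assms]])
  show "(\<lambda>x. f x $ i) \<in> borel_measurable M"
    using measurable_compose[OF L2_measurable[OF assms], of "\<lambda>v. v $ i" borel]
    by (simp add: borel_measurable_continuous_onI continuous_on_component)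
qed (auto intro!: AE_I2 power_mono Finite_Cartesian_Product.norm_nth_le)

lemma jet_L2: "u \<in> H1 cube \<Longrightarrow> jet u \<in> L2 cube_measure"
  unfolding jet_def by (intro L2_Pair L2_vec H1_L2 weak_partial)

lemma jet_add:
  assumes "u \<in> H1 cube" "v \<in> H1 cube"
  shows "AE x in cube_measure. jet (\<lambda>x. u x + v x) x = jet u x + jet v x"
proof -
  have "AE x in cube_measure. \<forall>i\<in>UNIV. weak_partial cube i (\<lambda>x. u x + v x) x = weak_partial cube i u x + weak_partial cube i v x"
    by (intro AE_finite_allI finite weak_partial_add assms)
  then show ?thesis by eventually_elim (simp add: jet_def vec_eq_iff)
qed

lemma jet_scale:
  assumes "u \<in> H1 cube"
  shows "AE x in cube_measure. jet (\<lambda>x. a *\<^sub>R u x) x = a *\<^sub>R jet u x"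
proof -
  have "AE x in cube_measure. \<forall>i\<in>UNIV. weak_partial cube i (\<lambda>x. a *\<^sub>R u x) x = a *\<^sub>R weak_partial cube i u x"
    by (intro AE_finite_allI finite weak_partial_scale assms)
  then show ?thesis by eventually_elim (simp add: jet_def vec_eq_iff)
qed

definition jet_norm :: "(real^'n::finite \<Rightarrow> real) \<Rightarrow> real" where
  "jet_norm u = L2_norm cube_measure (jet u)"

lemma H1_norm_jet:
  assumes "u \<in> H1 cube"
  shows "H1_norm cube u = jet_norm u"
proof -
  have "(LINT x|cube_measure. (norm (jet u x))\<^sup>2)
      = (LINT x|cube_measure. (norm (u x))\<^sup>2 + (\<Sum>i\<in>UNIV. (norm (weak_partial cube i u x))\<^sup>2))"
    by (simp add: jet_def norm_Pair norm_vec_square add_nonneg_nonneg sum_nonneg)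
  also have "\<dots> = (LINT x|cube_measure. (norm (u x))\<^sup>2) + (\<Sum>i\<in>UNIV. LINT x|cube_measure. (norm (weak_partial cube i u x))\<^sup>2)"
    using L2_integrable[OF H1_L2[OF assms]] L2_integrable[OF weak_partial(1)[OF assms]] by simp
  finally show ?thesis unfolding H1_norm_def jet_norm_def L2_norm_square by (simp add: L2_norm_def)
qed

definition H1_inner :: "(real^'n::finite \<Rightarrow> real) \<Rightarrow> (real^'n \<Rightarrow> real) \<Rightarrow> real" where
  "H1_inner u v = L2_inner cube_measure (jet u) (jet v)"

lemma semi_inner_space_H1: "semi_inner_space (H1 cube) H1_inner"
proof
  show "(\<lambda>_. 0) \<in> H1 cube" by (rule smooth_H1[OF smooth_const])
  fix u v w :: "real^'a \<Rightarrow> real" and a :: real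
  assume u: "u \<in> H1 cube" and w: "w \<in> H1 cube"
  show "H1_inner (\<lambda>x. a *\<^sub>R u x) w = a * H1_inner u w"
    unfolding H1_inner_def L2.ip_scale[OF jet_L2[OF u] jet_L2[OF w], symmetric]
    by (rule L2_inner_AE_cong[OF jet_L2[OF H1_scale[OF u]] L2.scale[OF jet_L2[OF u]]
          jet_L2[OF w] jet_L2[OF w] jet_scale[OF u] AE_I2]) (rule refl)
  assume v: "v \<in> H1 cube"
  show "H1_inner (\<lambda>x. u x + v x) w = H1_inner u w + H1_inner v w"
    unfolding H1_inner_def L2.ip_add[OF jet_L2[OF u] jet_L2[OF v] jet_L2[OF w], symmetric]
    by (rule L2_inner_AE_cong[OF jet_L2[OF H1_add[OF u v]] L2.add[OF jet_L2[OF u] jet_L2[OF v]]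
          jet_L2[OF w] jet_L2[OF w] jet_add[OF u v] AE_I2]) (rule refl)
  show "H1_inner u v = H1_inner v u"
    unfolding H1_inner_def using u v by (intro L2.sym jet_L2)
  show "0 \<le> H1_inner u u"
    unfolding H1_inner_def using u by (intro L2.nonneg jet_L2)
  show "(\<lambda>x. u x + v x) \<in> H1 cube" using u v by (rule H1_add)
  show "(\<lambda>x. a *\<^sub>R u x) \<in> H1 cube" using u by (rule H1_scale)
qed

interpretation H1: semi_inner_space "H1 cube" H1_inner
  rewrites "semi_inner_space.sn H1_inner = jet_norm"
  by (rule semi_inner_space_H1)
     (auto simp: semi_inner_space.sn_def[OF semi_inner_space_H1] jet_norm_def H1_inner_def
       L2_norm_def L2_inner_def power2_norm_eq_inner)

section \<open>Convergence in \<open>H1\<close> and Green's formula\<close>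

lemma L2_norm_diff_commute:
  "f \<in> L2 M \<Longrightarrow> g \<in> L2 M \<Longrightarrow> L2_norm M (\<lambda>x. f x - g x) = L2_norm M (\<lambda>x. g x - f x)"
  by (rule L2.sn_commute)

lemma tendsto_L2_mult:
  fixes f :: "nat \<Rightarrow> 'a \<Rightarrow> real"
  assumes "\<And>k. f k \<in> L2 M" "g \<in> L2 M" "\<phi> \<in> L2 M" "(\<lambda>k. L2_norm M (\<lambda>x. f k x - g x)) \<longlonglongrightarrow> 0"
  shows "(\<lambda>k. LINT x|M. f k x * \<phi> x) \<longlonglongrightarrow> (LINT x|M. g x * \<phi> x)"
  using L2.tendsto_ip[OF assms] by (simp add: L2_inner_def)

lemma null_comparison:
  fixes f g :: "nat \<Rightarrow> real"
  assumes "\<And>k. \<bar>f k\<bar> \<le> g k" "g \<longlonglongrightarrow> 0"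
  shows "f \<longlonglongrightarrow> 0"
  by (rule Lim_null_comparison[OF always_eventually assms(2)]) (simp add: assms(1))

lemma jet_norm_nonneg [simp]: "0 \<le> jet_norm u"
  by (simp add: jet_norm_def)

lemma tendsto_L2_norm:
  fixes f :: "nat \<Rightarrow> 'a \<Rightarrow> 'b::euclidean_space"
  assumes f: "\<And>k. f k \<in> L2 M" and g: "g \<in> L2 M" and lim: "(\<lambda>k. L2_norm M (\<lambda>x. f k x - g x)) \<longlonglongrightarrow> 0"
  shows "(\<lambda>k. L2_norm M (f k)) \<longlonglongrightarrow> L2_norm M g"
proof -
  have "\<bar>L2_norm M (f k) - L2_norm M g\<bar> \<le> L2_norm M (\<lambda>x. f k x - g x)" for k
    using L2.sn_triangle[OF L2.diff[OF f g] g, of k] L2.sn_triangle[OF L2.diff[OF g f[of k]] f[of k]]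
      L2_norm_diff_commute[OF f g, of k] by simp
  then have "(\<lambda>k. L2_norm M (f k) - L2_norm M g) \<longlonglongrightarrow> 0"
    by (rule null_comparison[OF _ lim])
  then show ?thesis by (simp add: LIM_zero_iff)
qed

lemma jet_diff:
  assumes "u \<in> H1 cube" "v \<in> H1 cube"
  shows "AE x in cube_measure. jet (\<lambda>x. u x - v x) x = jet u x - jet v x"
proof -
  have "AE x in cube_measure. jet (\<lambda>x. u x + (-1) *\<^sub>R v x) x = jet u x + jet (\<lambda>x. (-1) *\<^sub>R v x) x"
    by (rule jet_add[OF assms(1) H1_scale[OF assms(2)]])
  with jet_scale[OF assms(2), of "-1"] show ?thesis
    by eventually_elim (simp del: add_uminus_conv_diff add: diff_conv_add_uminus)
qed

lemma weak_partial_diff: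
  assumes "u \<in> H1 cube" "v \<in> H1 cube"
  shows "AE x in cube_measure. weak_partial cube i (\<lambda>x. u x - v x) x = weak_partial cube i u x - weak_partial cube i v x"
  using jet_diff[OF assms] by eventually_elim (simp add: jet_def vec_eq_iff)

lemma jet_norm_diff:
  assumes "u \<in> H1 cube" "v \<in> H1 cube"
  shows "jet_norm (\<lambda>x. u x - v x) = L2_norm cube_measure (\<lambda>x. jet u x - jet v x)"
  unfolding jet_norm_def
  by (rule L2_norm_AE_cong[OF jet_L2[OF H1.diff[OF assms]] L2.diff[OF jet_L2[OF assms(1)] jet_L2[OF assms(2)]]
        jet_diff[OF assms]])

lemma norm_fst_snd_le: "norm (fst z) \<le> norm z" "norm (snd z) \<le> norm z"
  by (cases z; simp add: norm_fst_le norm_snd_le)+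

lemma L2_norm_le_jet_norm:
  assumes "u \<in> H1 cube"
  shows "L2_norm cube_measure u \<le> jet_norm u" "L2_norm cube_measure (weak_partial cube i u) \<le> jet_norm u"
proof -
  have "norm (u x) \<le> norm (jet u x)" for x
    using norm_fst_snd_le(1)[of "jet u x"] by (simp add: jet_def)
  then show "L2_norm cube_measure u \<le> jet_norm u"
    unfolding jet_norm_def by (intro L2_norm_mono_AE H1_L2 jet_L2 assms AE_I2)
  have "norm (weak_partial cube i u x) \<le> norm (jet u x)" for x
    using norm_fst_snd_le(2)[of "jet u x"] Finite_Cartesian_Product.norm_nth_le[of "snd (jet u x)" i] by (simp add: jet_def)
  then show "L2_norm cube_measure (weak_partial cube i u) \<le> jet_norm u"
    unfolding jet_norm_def by (intro L2_norm_mono_AE weak_partial jet_L2 assms AE_I2)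
qed

lemma jet_norm_tendsto_L2:
  assumes s: "\<And>k. s k \<in> H1 cube" and u: "u \<in> H1 cube"
    and lim: "(\<lambda>k. jet_norm (\<lambda>x. s k x - u x)) \<longlonglongrightarrow> 0"
  shows "(\<lambda>k. L2_norm cube_measure (\<lambda>x. s k x - u x)) \<longlonglongrightarrow> 0"
    and "(\<lambda>k. L2_norm cube_measure (\<lambda>x. weak_partial cube i (s k) x - weak_partial cube i u x)) \<longlonglongrightarrow> 0"
proof -
  show "(\<lambda>k. L2_norm cube_measure (\<lambda>x. s k x - u x)) \<longlonglongrightarrow> 0"
    by (rule null_comparison[OF _ lim])
       (use L2_norm_le_jet_norm(1)[OF H1.diff[OF s u]] in simp)
  have "L2_norm cube_measure (\<lambda>x. weak_partial cube i (s k) x - weak_partial cube i u x)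
      = L2_norm cube_measure (weak_partial cube i (\<lambda>x. s k x - u x))" for k
    by (rule L2_norm_AE_cong[OF L2.diff[OF weak_partial(1)[OF s] weak_partial(1)[OF u]]
          weak_partial(1)[OF H1.diff[OF s u]]])
       (use weak_partial_diff[OF s[of k] u, of i] in \<open>eventually_elim, simp\<close>)
  then show "(\<lambda>k. L2_norm cube_measure (\<lambda>x. weak_partial cube i (s k) x - weak_partial cube i u x)) \<longlonglongrightarrow> 0"
    using L2_norm_le_jet_norm(2)[OF H1.diff[OF s u]] by - (rule null_comparison[OF _ lim], simp)
qed

text \<open>The jets converge in \<open>L2\<close> to some \<open>U\<close>. The identity that
  defines weak derivatives passes to the limit, so the vector part of \<open>U\<close> is the weak
  gradient of its scalar part.\<close>

lemma H1_complete:
  fixes s :: "nat \<Rightarrow> real^'n::finite \<Rightarrow> real"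
  assumes s: "\<And>k. s k \<in> H1 cube" and C: "H1.Cauchy_in s"
  obtains u where "u \<in> H1 cube" "(\<lambda>k. jet_norm (\<lambda>x. s k x - u x)) \<longlonglongrightarrow> 0"
proof -
  have "\<exists>N. \<forall>m\<ge>N. \<forall>n\<ge>N. L2_norm cube_measure (\<lambda>x. jet (s m) x - jet (s n) x) < e" if "e > 0" for e
    using C that unfolding H1.Cauchy_in_def by (simp add: jet_norm_diff s)
  then obtain U :: "real^'n \<Rightarrow> real \<times> (real^'n)" where U: "U \<in> L2 cube_measure"
    and lim: "(\<lambda>k. L2_norm cube_measure (\<lambda>x. jet (s k) x - U x)) \<longlonglongrightarrow> 0"
    using cube.L2_complete[of "\<lambda>k. jet (s k)"] jet_L2[OF s] by blast
  define u where "u x = fst (U x)" for x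
  have "(fst :: real \<times> (real^'n) \<Rightarrow> real) \<in> borel_measurable borel" "(snd :: real \<times> (real^'n) \<Rightarrow> real^'n) \<in> borel_measurable borel"
    by (auto intro!: borel_measurable_continuous_onI continuous_on_fst continuous_on_snd continuous_on_id)
  from this[THEN measurable_compose[OF L2_measurable[OF U]]]
  have u: "u \<in> L2 cube_measure" and sndU: "(\<lambda>x. snd (U x)) \<in> L2 cube_measure"
    unfolding u_def
    by (auto intro!: L2_bound[OF _ L2_integrable[OF U]] AE_I2 power_mono norm_fst_snd_le simp del: real_norm_def)
  have g: "(\<lambda>x. snd (U x) $ i) \<in> L2 cube_measure" for i by (rule L2_vec_nth[OF sndU])
  have diffL2: "(\<lambda>x. jet (s k) x - U x) \<in> L2 cube_measure" for k by (rule L2.diff[OF jet_L2[OF s] U])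
  have lim_u: "(\<lambda>k. L2_norm cube_measure (\<lambda>x. s k x - u x)) \<longlonglongrightarrow> 0"
  proof (rule null_comparison[OF _ lim])
    fix k
    have "norm (s k x - u x) \<le> norm (jet (s k) x - U x)" for x
      using norm_fst_snd_le(1)[of "jet (s k) x - U x"] by (simp add: jet_def u_def)
    then show "\<bar>L2_norm cube_measure (\<lambda>x. s k x - u x)\<bar> \<le> L2_norm cube_measure (\<lambda>x. jet (s k) x - U x)"
      using L2_norm_mono_AE[OF L2.diff[OF H1_L2[OF s] u] diffL2] by simp
  qed
  have lim_g: "(\<lambda>k. L2_norm cube_measure (\<lambda>x. weak_partial cube i (s k) x - snd (U x) $ i)) \<longlonglongrightarrow> 0" for i
  proof (rule null_comparison[OF _ lim])
    fix k
    have "norm (weak_partial cube i (s k) x - snd (U x) $ i) \<le> norm (jet (s k) x - U x)" for x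
      using norm_fst_snd_le(2)[of "jet (s k) x - U x"] Finite_Cartesian_Product.norm_nth_le[of "snd (jet (s k) x - U x)" i]
      by (simp add: jet_def)
    then show "\<bar>L2_norm cube_measure (\<lambda>x. weak_partial cube i (s k) x - snd (U x) $ i)\<bar>
        \<le> L2_norm cube_measure (\<lambda>x. jet (s k) x - U x)"
      using L2_norm_mono_AE[OF L2.diff[OF weak_partial(1)[OF s] g] diffL2] by simp
  qed
  have wp: "has_weak_partial cube i u (\<lambda>x. snd (U x) $ i)" for i
    unfolding has_weak_partial_def
  proof
    fix \<phi> :: "real^'n \<Rightarrow> real" assume \<phi>: "\<phi> \<in> test_functions cube"
    have sm: "smooth \<phi>" using \<phi> by (rule test_function_smooth)
    have "(LINT x|cube_measure. s k x * partial i \<phi> x) = - (LINT x|cube_measure. weak_partial cube i (s k) x * \<phi> x)" for k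
      using weak_partial(2)[OF s[of k], of i] \<phi> unfolding has_weak_partial_def by blast
    then have "(\<lambda>k. - (LINT x|cube_measure. weak_partial cube i (s k) x * \<phi> x)) \<longlonglongrightarrow> (LINT x|cube_measure. u x * partial i \<phi> x)"
      using tendsto_L2_mult[OF H1_L2[OF s] u L2_smooth[OF smooth_partial[OF sm]] lim_u, of i] by simp
    moreover have "(\<lambda>k. - (LINT x|cube_measure. weak_partial cube i (s k) x * \<phi> x)) \<longlonglongrightarrow> - (LINT x|cube_measure. snd (U x) $ i * \<phi> x)"
      by (intro tendsto_minus tendsto_L2_mult[OF weak_partial(1)[OF s] g L2_smooth[OF sm] lim_g])
    ultimately show "(LINT x|cube_measure. u x * partial i \<phi> x) = - (LINT x|cube_measure. snd (U x) $ i * \<phi> x)"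
      by (rule LIMSEQ_unique)
  qed
  have uH: "u \<in> H1 cube" unfolding H1_def using u g wp by blast
  have "AE x in cube_measure. \<forall>i\<in>UNIV. weak_partial cube i u x = snd (U x) $ i"
    by (intro AE_finite_allI finite weak_partial_unique[OF uH g wp])
  then have jetU: "AE x in cube_measure. jet u x = U x"
    by eventually_elim (simp add: jet_def u_def vec_eq_iff prod_eq_iff)
  have "jet_norm (\<lambda>x. s k x - u x) = L2_norm cube_measure (\<lambda>x. jet (s k) x - U x)" for k
    unfolding jet_norm_diff[OF s uH]
    by (rule L2_norm_AE_cong[OF L2.diff[OF jet_L2[OF s] jet_L2[OF uH]] diffL2])
       (use jetU in \<open>eventually_elim, simp\<close>)
  then show ?thesis using that[OF uH] lim by simp
qed

text \<open>Integration by parts with no boundary term. For test functions this is what defines the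
  weak derivative; here \<open>\<psi>\<close> may be nonzero on the boundary, so the identity
  carries information on the trace of \<open>u\<close>.\<close>

definition Green :: "'n \<Rightarrow> (real^'n::finite \<Rightarrow> real) \<Rightarrow> (real^'n \<Rightarrow> real) \<Rightarrow> bool" where
  "Green i u \<psi> \<longleftrightarrow> (LINT x|cube_measure. weak_partial cube i u x * \<psi> x) = - (LINT x|cube_measure. u x * partial i \<psi> x)"

lemma Green_limit:
  assumes s: "\<And>k. s k \<in> H1 cube" and u: "u \<in> H1 cube" and \<psi>: "smooth \<psi>"
    and lim: "(\<lambda>k. jet_norm (\<lambda>x. s k x - u x)) \<longlonglongrightarrow> 0"
    and G: "\<And>k. Green i (s k) \<psi>"
  shows "Green i u \<psi>"
proof -
  have "(\<lambda>k. LINT x|cube_measure. weak_partial cube i (s k) x * \<psi> x) \<longlonglongrightarrow> (LINT x|cube_measure. weak_partial cube i u x * \<psi> x)"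
    by (rule tendsto_L2_mult[OF weak_partial(1)[OF s] weak_partial(1)[OF u] L2_smooth[OF \<psi>] jet_norm_tendsto_L2(2)[OF s u lim]])
  moreover have "(\<lambda>k. - (LINT x|cube_measure. s k x * partial i \<psi> x)) \<longlonglongrightarrow> - (LINT x|cube_measure. u x * partial i \<psi> x)"
    by (intro tendsto_minus tendsto_L2_mult[OF H1_L2[OF s] H1_L2[OF u] L2_smooth[OF smooth_partial[OF \<psi>]] jet_norm_tendsto_L2(1)[OF s u lim]])
  ultimately show ?thesis
    using G unfolding Green_def by (auto dest: LIMSEQ_unique)
qed

lemma integral_weak_partial_smooth:
  assumes "smooth f" "\<psi> \<in> L2 cube_measure"
  shows "(LINT x|cube_measure. weak_partial cube i f x * \<psi> x) = (LINT x|cube_measure. partial i f x * \<psi> x)"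
  by (rule integral_cong_AE)
     (use assms weak_partial_smooth[OF assms(1), of i] L2_measurable[OF weak_partial(1)[OF smooth_H1[OF assms(1)], of i]]
        L2_measurable[OF L2_smooth[OF smooth_partial[OF assms(1)], of i]] L2_measurable[OF assms(2)]
      in \<open>auto elim: eventually_mono intro!: borel_measurable_times\<close>)

lemma Green_smooth_weak:
  assumes "smooth f" "smooth \<psi>"
    and "(\<forall>x. \<forall>c\<in>{0, 1}. \<psi> (upd i c x) = 0) \<or> (\<forall>x. \<forall>c\<in>{0, 1}. f (upd i c x) = 0)"
  shows "Green i f \<psi>"
  using Green_smooth[OF assms(1,2), of i] assms(3)
  unfolding Green_def integral_weak_partial_smooth[OF assms(1) L2_smooth[OF assms(2)]] by auto

text \<open>\<open>vanishing i\<close> consists of the functions with zero trace on both faces normal to \<open>e\<^sub>i\<close>, described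
  through Green's formula: no boundary term appears in direction \<open>i\<close>, and in the other directions
  none appears against test functions that vanish on the faces.\<close>

definition vanishing :: "'n::finite \<Rightarrow> (real^'n \<Rightarrow> real) set" where
  "vanishing i = {u \<in> H1 cube. (\<forall>\<psi>. smooth \<psi> \<longrightarrow> Green i u \<psi>) \<and>
     (\<forall>m \<psi>. smooth \<psi> \<and> (\<forall>x. \<forall>c\<in>{0, 1}. \<psi> (upd m c x) = 0) \<longrightarrow> Green m u \<psi>)}"

lemma vanishing_H1: "u \<in> vanishing i \<Longrightarrow> u \<in> H1 cube"
  by (simp add: vanishing_def)

text \<open>Both sides of \<open>Green\<close> are continuous in \<open>H1\<close>, so the
  conditions pass to limits directly; the definition of traces by approximating sequences requires a
  diagonal choice for this.\<close>

lemma vanishing_limit: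
  assumes s: "\<And>k. s k \<in> vanishing i" and u: "u \<in> H1 cube"
    and lim: "(\<lambda>k. jet_norm (\<lambda>x. s k x - u x)) \<longlonglongrightarrow> 0"
  shows "u \<in> vanishing i"
  unfolding vanishing_def
  using u s Green_limit[OF vanishing_H1[OF s] u _ lim] by (auto simp: vanishing_def)

lemma Green_diff:
  assumes u: "u \<in> H1 cube" and v: "v \<in> H1 cube" and \<psi>: "smooth \<psi>" and G: "Green i u \<psi>" "Green i v \<psi>"
  shows "Green i (\<lambda>x. u x - v x) \<psi>"
proof -
  have "(LINT x|cube_measure. weak_partial cube i (\<lambda>x. u x - v x) x * \<psi> x)
      = (LINT x|cube_measure. (weak_partial cube i u x - weak_partial cube i v x) * \<psi> x)"
  proof (rule integral_cong_AE)
    show "AE x in cube_measure. weak_partial cube i (\<lambda>x. u x - v x) x * \<psi> x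
        = (weak_partial cube i u x - weak_partial cube i v x) * \<psi> x"
      using weak_partial_diff[OF u v, of i] by eventually_elim simp
  qed (auto intro!: borel_measurable_times borel_measurable_diff L2_measurable[OF weak_partial(1)]
      L2_measurable[OF L2_smooth[OF \<psi>]] H1.diff u v)
  then show ?thesis
    using G weak_partial(1)[OF u, of i] weak_partial(1)[OF v, of i] L2_smooth[OF \<psi>] H1_L2[OF u] H1_L2[OF v]
      L2_smooth[OF smooth_partial[OF \<psi>], of i]
    by (simp add: Green_def left_diff_distrib integrable_mult_L2)
qed

lemma vanishing_diff:
  assumes "u \<in> vanishing i" "v \<in> vanishing i"
  shows "(\<lambda>x. u x - v x) \<in> vanishing i"
  using assms Green_diff[OF vanishing_H1[OF assms(1)] vanishing_H1[OF assms(2)]]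
    H1.diff[OF vanishing_H1[OF assms(1)] vanishing_H1[OF assms(2)]]
  by (auto simp: vanishing_def)

section \<open>Traces\<close>

text \<open>\<open>face_measure\<close> is the image of the cube measure under
  \<open>upd j c\<close>, so norms on a face can be estimated on the cube.\<close>

lemma L2_norm_face:
  assumes "smooth \<phi>"
  shows "L2_norm (face_measure j c) \<phi> = L2_norm cube_measure (\<lambda>x. \<phi> (upd j c x))"
  unfolding L2_norm_def face_measure_def
  using smooth_borel_measurable[OF assms] measurable_upd_cube[of j c]
  by (subst integral_distr) auto

lemma continuous_upd_comp: "continuous_on UNIV f \<Longrightarrow> continuous_on UNIV (\<lambda>x. f (upd j c x))"
  by (rule continuous_on_compose2[OF _ continuous_on_upd_vector]) auto

lemma has_traceE:
  assumes "has_trace j c u (\<lambda>_. 0)" "u \<in> H1 cube"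
  obtains \<phi> where "\<And>k. smooth (\<phi> k)" "(\<lambda>k. jet_norm (\<lambda>x. \<phi> k x - u x)) \<longlonglongrightarrow> 0"
    "(\<lambda>k. L2_norm cube_measure (\<lambda>x. \<phi> k (upd j c x))) \<longlonglongrightarrow> 0"
proof -
  obtain \<phi> :: "nat \<Rightarrow> real^'a \<Rightarrow> real" where \<phi>: "\<And>k. smooth (\<phi> k)"
    "(\<lambda>k. H1_norm cube (\<lambda>x. \<phi> k x - u x)) \<longlonglongrightarrow> 0"
    "(\<lambda>k. L2_norm (face_measure j c) (\<lambda>x. \<phi> k x - 0)) \<longlonglongrightarrow> 0"
    using assms unfolding has_trace_def by blast
  have "H1_norm cube (\<lambda>x. \<phi> k x - u x) = jet_norm (\<lambda>x. \<phi> k x - u x)" for k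
    by (rule H1_norm_jet[OF H1.diff[OF smooth_H1[OF \<phi>(1)] assms(2)]])
  with \<phi> show ?thesis using that[of \<phi>] by (simp add: L2_norm_face)
qed

lemma has_traceI:
  assumes "\<And>k. smooth (\<phi> k)" "u \<in> H1 cube" "(\<lambda>k. jet_norm (\<lambda>x. \<phi> k x - u x)) \<longlonglongrightarrow> 0"
    "(\<lambda>k. L2_norm cube_measure (\<lambda>x. \<phi> k (upd j c x))) \<longlonglongrightarrow> 0"
  shows "has_trace j c u (\<lambda>_. 0)"
proof -
  have "H1_norm cube (\<lambda>x. \<phi> k x - u x) = jet_norm (\<lambda>x. \<phi> k x - u x)" for k
    by (rule H1_norm_jet[OF H1.diff[OF smooth_H1[OF assms(1)] assms(2)]])
  then show ?thesis
    unfolding has_trace_def using assms by (auto simp: L2_norm_face L2_zero intro!: exI[of _ \<phi>])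
qed

text \<open>For the smooth approximants only the boundary term on the face with coordinate
  \<open>c\<close> survives, since \<open>\<psi>\<close> vanishes on the opposite one.
  Cauchy-Schwarz bounds it by the norm of the approximants on that face, which tends to
  zero.\<close>

lemma zero_trace_Green_one_face:
  assumes u: "u \<in> H1 cube" and tr: "has_trace j c u (\<lambda>_. 0)" and c: "c \<in> {0, 1}"
    and \<psi>: "smooth \<psi>" and v: "\<And>x. \<psi> (upd j (1 - c) x) = 0"
  shows "Green j u \<psi>"
proof -
  obtain \<phi> where \<phi>: "\<And>k. smooth (\<phi> k)" and lim: "(\<lambda>k. jet_norm (\<lambda>x. \<phi> k x - u x)) \<longlonglongrightarrow> 0"
    and tr0: "(\<lambda>k. L2_norm cube_measure (\<lambda>x. \<phi> k (upd j c x))) \<longlonglongrightarrow> 0"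
    by (rule has_traceE[OF tr u]) (rule that)
  note H = smooth_H1[OF \<phi>]
  have "(\<lambda>k. LINT x|cube_measure. weak_partial cube j (\<phi> k) x * \<psi> x) \<longlonglongrightarrow> (LINT x|cube_measure. weak_partial cube j u x * \<psi> x)"
    by (rule tendsto_L2_mult[OF weak_partial(1)[OF H] weak_partial(1)[OF u] L2_smooth[OF \<psi>] jet_norm_tendsto_L2(2)[OF H u lim]])
  moreover have "(\<lambda>k. LINT x|cube_measure. \<phi> k x * partial j \<psi> x) \<longlonglongrightarrow> (LINT x|cube_measure. u x * partial j \<psi> x)"
    by (rule tendsto_L2_mult[OF H1_L2[OF H] H1_L2[OF u] L2_smooth[OF smooth_partial[OF \<psi>]] jet_norm_tendsto_L2(1)[OF H u lim]])
  ultimately have l1: "(\<lambda>k. (LINT x|cube_measure. weak_partial cube j (\<phi> k) x * \<psi> x) + (LINT x|cube_measure. \<phi> k x * partial j \<psi> x))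
      \<longlonglongrightarrow> (LINT x|cube_measure. weak_partial cube j u x * \<psi> x) + (LINT x|cube_measure. u x * partial j \<psi> x)"
    by (rule tendsto_add)
  have "\<bar>(LINT x|cube_measure. weak_partial cube j (\<phi> k) x * \<psi> x) + (LINT x|cube_measure. \<phi> k x * partial j \<psi> x)\<bar>
      \<le> L2_norm cube_measure (\<lambda>x. \<phi> k (upd j c x)) * L2_norm cube_measure (\<lambda>x. \<psi> (upd j c x))" for k
  proof -
    have "(LINT x|cube_measure. weak_partial cube j (\<phi> k) x * \<psi> x) + (LINT x|cube_measure. \<phi> k x * partial j \<psi> x)
        = (LINT x|cube_measure. \<phi> k (upd j 1 x) * \<psi> (upd j 1 x) - \<phi> k (upd j 0 x) * \<psi> (upd j 0 x))"
      using Green_smooth[OF \<phi> \<psi>] by (simp add: integral_weak_partial_smooth[OF \<phi> L2_smooth[OF \<psi>]])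
    also have "\<bar>\<dots>\<bar> = \<bar>LINT x|cube_measure. \<phi> k (upd j c x) * \<psi> (upd j c x)\<bar>"
    proof -
      consider "c = 0" | "c = 1" using c by auto
      then show ?thesis
      proof cases
        case 1
        from v[unfolded 1 diff_zero] show ?thesis unfolding 1 by simp
      next
        case 2
        from v[unfolded 2 diff_self] show ?thesis unfolding 2 by simp
      qed
    qed
    also have "\<dots> \<le> L2_norm cube_measure (\<lambda>x. \<phi> k (upd j c x)) * L2_norm cube_measure (\<lambda>x. \<psi> (upd j c x))"
      using L2.Cauchy_Schwarz[OF L2_continuous[OF continuous_upd_comp[OF smooth_continuous[OF \<phi>]]]
          L2_continuous[OF continuous_upd_comp[OF smooth_continuous[OF \<psi>]]], of k j c j c]
      by (simp add: L2_inner_def)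
    finally show ?thesis .
  qed
  moreover have "(\<lambda>k. L2_norm cube_measure (\<lambda>x. \<phi> k (upd j c x)) * L2_norm cube_measure (\<lambda>x. \<psi> (upd j c x))) \<longlonglongrightarrow> 0"
    using tendsto_mult_right[OF tr0, of "L2_norm cube_measure (\<lambda>x. \<psi> (upd j c x))"] by simp
  ultimately have "(\<lambda>k. (LINT x|cube_measure. weak_partial cube j (\<phi> k) x * \<psi> x) + (LINT x|cube_measure. \<phi> k x * partial j \<psi> x)) \<longlonglongrightarrow> 0"
    by (rule null_comparison)
  from LIMSEQ_unique[OF l1 this] show ?thesis by (simp add: Green_def add_eq_0_iff2)
qed

text \<open>The two traces come with unrelated approximating sequences, so the test function is split as
  \<open>x\<^sub>j \<psi> + (1 - x\<^sub>j) \<psi>\<close> and each summand is seen by one face only.\<close>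

lemma zero_trace_vanishing:
  assumes u: "u \<in> H1 cube" and tr: "has_trace j 0 u (\<lambda>_. 0)" "has_trace j 1 u (\<lambda>_. 0)"
  shows "u \<in> vanishing j"
proof -
  have "Green j u \<psi>" if \<psi>: "smooth \<psi>" for \<psi>
  proof -
    let ?a = "\<lambda>x. x $ j * \<psi> x" and ?b = "\<lambda>x. (1 - x $ j) * \<psi> x"
    have x: "smooth (\<lambda>x. x $ j)" by (rule smooth_coord[OF smooth1_id])
    have a: "smooth ?a" by (rule smooth_mult[OF x \<psi>])
    have b: "smooth ?b" by (rule smooth_mult[OF smooth_diff[OF smooth_const x] \<psi>])
    have "Green j u ?a" by (rule zero_trace_Green_one_face[OF u tr(2) _ a]) auto
    moreover have "Green j u ?b" by (rule zero_trace_Green_one_face[OF u tr(1) _ b]) auto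
    moreover have "\<psi> = (\<lambda>x. ?a x + ?b x)" by (auto simp: algebra_simps)
    then have "partial j \<psi> = (\<lambda>x. partial j ?a x + partial j ?b x)"
      using partial_add[OF smooth_differentiable[OF a] smooth_differentiable[OF b], of j] by simp
    moreover have "(LINT x|cube_measure. weak_partial cube j u x * \<psi> x)
        = (LINT x|cube_measure. weak_partial cube j u x * ?a x) + (LINT x|cube_measure. weak_partial cube j u x * ?b x)"
    proof -
      have "(LINT x|cube_measure. weak_partial cube j u x * \<psi> x)
        = (LINT x|cube_measure. weak_partial cube j u x * ?a x + weak_partial cube j u x * ?b x)"
        by (simp add: algebra_simps)
      then show ?thesis
        using integrable_mult_L2[OF weak_partial(1)[OF u] L2_smooth[OF a]]
          integrable_mult_L2[OF weak_partial(1)[OF u] L2_smooth[OF b]] by simp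
    qed
    moreover have "(LINT x|cube_measure. u x * (partial j ?a x + partial j ?b x))
        = (LINT x|cube_measure. u x * partial j ?a x) + (LINT x|cube_measure. u x * partial j ?b x)"
      using integrable_mult_L2[OF H1_L2[OF u] L2_smooth[OF smooth_partial[OF a]]]
        integrable_mult_L2[OF H1_L2[OF u] L2_smooth[OF smooth_partial[OF b]]]
      by (simp add: distrib_left)
    ultimately show ?thesis by (simp add: Green_def)
  qed
  \<comment> \<open>Here \<open>\<psi>\<close> itself kills the boundary term, so any smooth
    approximation of \<open>u\<close> in \<open>H1\<close> will do.\<close>
  moreover have "Green m u \<psi>" if "smooth \<psi>" "\<forall>x. \<forall>c\<in>{0, 1}. \<psi> (upd m c x) = 0" for m \<psi>
  proof -
    obtain \<phi> where \<phi>: "\<And>k. smooth (\<phi> k)" and lim: "(\<lambda>k. jet_norm (\<lambda>x. \<phi> k x - u x)) \<longlonglongrightarrow> 0"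
      by (rule has_traceE[OF tr(1) u]) (rule that)
    show ?thesis
      by (rule Green_limit[OF smooth_H1[OF \<phi>] u that(1) lim Green_smooth_weak[OF \<phi> that(1)]])
         (use that(2) in auto)
  qed
  ultimately show ?thesis using u by (simp add: vanishing_def)
qed

text \<open>A diagonal choice: for every \<open>k\<close> a smooth function that is within
  \<open>1 / real (Suc k)\<close> of \<open>s k\<close> in \<open>H1\<close> and has norm below that
  bound on the face.\<close>

lemma has_trace_limit:
  assumes s: "\<And>k. s k \<in> H1 cube" "\<And>k. has_trace j c (s k) (\<lambda>_. 0)" and u: "u \<in> H1 cube"
    and lim: "(\<lambda>k. jet_norm (\<lambda>x. s k x - u x)) \<longlonglongrightarrow> 0"
  shows "has_trace j c u (\<lambda>_. 0)"
proof -
  have "\<exists>\<phi>. smooth \<phi> \<and> jet_norm (\<lambda>x. \<phi> x - s k x) < 1 / real (Suc k)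
      \<and> L2_norm cube_measure (\<lambda>x. \<phi> (upd j c x)) < 1 / real (Suc k)" for k
  proof -
    obtain \<phi> where \<phi>: "\<And>m. smooth (\<phi> m)" "(\<lambda>m. jet_norm (\<lambda>x. \<phi> m x - s k x)) \<longlonglongrightarrow> 0"
      "(\<lambda>m. L2_norm cube_measure (\<lambda>x. \<phi> m (upd j c x))) \<longlonglongrightarrow> 0"
      by (rule has_traceE[OF s(2) s(1)]) (rule that)
    have "\<forall>\<^sub>F m in sequentially. jet_norm (\<lambda>x. \<phi> m x - s k x) < 1 / real (Suc k)
      \<and> L2_norm cube_measure (\<lambda>x. \<phi> m (upd j c x)) < 1 / real (Suc k)"
      by (intro eventually_conj order_tendstoD(2)[OF \<phi>(2)] order_tendstoD(2)[OF \<phi>(3)]) auto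
    then obtain m where "jet_norm (\<lambda>x. \<phi> m x - s k x) < 1 / real (Suc k)
      \<and> L2_norm cube_measure (\<lambda>x. \<phi> m (upd j c x)) < 1 / real (Suc k)"
      by (auto simp: eventually_sequentially)
    with \<phi>(1) show ?thesis by blast
  qed
  then have "\<exists>\<phi>. \<forall>k. smooth (\<phi> k) \<and> jet_norm (\<lambda>x. \<phi> k x - s k x) < 1 / real (Suc k)
      \<and> L2_norm cube_measure (\<lambda>x. \<phi> k (upd j c x)) < 1 / real (Suc k)"
    by (intro choice allI)
  then obtain \<phi> where \<phi>: "\<And>k. smooth (\<phi> k)" "\<And>k. jet_norm (\<lambda>x. \<phi> k x - s k x) < 1 / real (Suc k)"
    "\<And>k. L2_norm cube_measure (\<lambda>x. \<phi> k (upd j c x)) < 1 / real (Suc k)" by auto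
  have l: "(\<lambda>k. 1 / real (Suc k)) \<longlonglongrightarrow> 0" using LIMSEQ_inverse_real_of_nat by (simp add: inverse_eq_divide)
  show ?thesis
  proof (rule has_traceI[OF \<phi>(1) u])
    have "jet_norm (\<lambda>x. \<phi> k x - u x) \<le> 1 / real (Suc k) + jet_norm (\<lambda>x. s k x - u x)" for k
      using H1.sn_triangle_diff[OF smooth_H1[OF \<phi>(1)] s(1) u, of k k] \<phi>(2)[of k] by simp
    moreover have "(\<lambda>k. 1 / real (Suc k) + jet_norm (\<lambda>x. s k x - u x)) \<longlonglongrightarrow> 0"
      using tendsto_add[OF l lim] by simp
    ultimately show "(\<lambda>k. jet_norm (\<lambda>x. \<phi> k x - u x)) \<longlonglongrightarrow> 0"
      by - (rule null_comparison[where g = "\<lambda>k. 1 / real (Suc k) + jet_norm (\<lambda>x. s k x - u x)"], auto)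
    show "(\<lambda>k. L2_norm cube_measure (\<lambda>x. \<phi> k (upd j c x))) \<longlonglongrightarrow> 0"
      by (rule null_comparison[OF _ l]) (use \<phi>(3) in \<open>auto intro: less_imp_le simp del: of_nat_Suc\<close>)
  qed
qed

lemma has_trace_add:
  assumes u: "u \<in> H1 cube" "has_trace j c u (\<lambda>_. 0)" and v: "v \<in> H1 cube" "has_trace j c v (\<lambda>_. 0)"
  shows "has_trace j c (\<lambda>x. u x + v x) (\<lambda>_. 0)"
proof -
  obtain \<phi> where \<phi>: "\<And>m. smooth (\<phi> m)" "(\<lambda>m. jet_norm (\<lambda>x. \<phi> m x - u x)) \<longlonglongrightarrow> 0"
    "(\<lambda>m. L2_norm cube_measure (\<lambda>x. \<phi> m (upd j c x))) \<longlonglongrightarrow> 0"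
    by (rule has_traceE[OF u(2,1)]) (rule that)
  obtain \<psi> where \<psi>: "\<And>m. smooth (\<psi> m)" "(\<lambda>m. jet_norm (\<lambda>x. \<psi> m x - v x)) \<longlonglongrightarrow> 0"
    "(\<lambda>m. L2_norm cube_measure (\<lambda>x. \<psi> m (upd j c x))) \<longlonglongrightarrow> 0"
    by (rule has_traceE[OF v(2,1)]) (rule that)
  show ?thesis
  proof (rule has_traceI[OF smooth_add[OF \<phi>(1) \<psi>(1)] H1_add[OF u(1) v(1)]])
    have "jet_norm (\<lambda>x. (\<phi> k x + \<psi> k x) - (u x + v x)) \<le> jet_norm (\<lambda>x. \<phi> k x - u x) + jet_norm (\<lambda>x. \<psi> k x - v x)" for k
      using H1.sn_triangle[OF H1.diff[OF smooth_H1[OF \<phi>(1)] u(1)] H1.diff[OF smooth_H1[OF \<psi>(1)] v(1)], of k k]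
      by (simp add: algebra_simps)
    then show "(\<lambda>k. jet_norm (\<lambda>x. (\<phi> k x + \<psi> k x) - (u x + v x))) \<longlonglongrightarrow> 0"
      using tendsto_add[OF \<phi>(2) \<psi>(2)]
      by - (rule null_comparison[where g = "\<lambda>k. jet_norm (\<lambda>x. \<phi> k x - u x) + jet_norm (\<lambda>x. \<psi> k x - v x)"], simp_all)
    have "L2_norm cube_measure (\<lambda>x. \<phi> k (upd j c x) + \<psi> k (upd j c x))
        \<le> L2_norm cube_measure (\<lambda>x. \<phi> k (upd j c x)) + L2_norm cube_measure (\<lambda>x. \<psi> k (upd j c x))" for k
      by (intro L2.sn_triangle L2_continuous continuous_upd_comp smooth_continuous \<phi> \<psi>)
    then show "(\<lambda>k. L2_norm cube_measure (\<lambda>x. \<phi> k (upd j c x) + \<psi> k (upd j c x))) \<longlonglongrightarrow> 0"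
      using tendsto_add[OF \<phi>(3) \<psi>(3)]
      by - (rule null_comparison[where g = "\<lambda>k. L2_norm cube_measure (\<lambda>x. \<phi> k (upd j c x)) + L2_norm cube_measure (\<lambda>x. \<psi> k (upd j c x))"], simp_all)
  qed
qed

lemma has_trace_scale:
  assumes u: "u \<in> H1 cube" "has_trace j c u (\<lambda>_. 0)"
  shows "has_trace j c (\<lambda>x. a *\<^sub>R u x) (\<lambda>_. 0)"
proof -
  obtain \<phi> where \<phi>: "\<And>m. smooth (\<phi> m)" "(\<lambda>m. jet_norm (\<lambda>x. \<phi> m x - u x)) \<longlonglongrightarrow> 0"
    "(\<lambda>m. L2_norm cube_measure (\<lambda>x. \<phi> m (upd j c x))) \<longlonglongrightarrow> 0"
    by (rule has_traceE[OF u(2,1)]) (rule that)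
  show ?thesis
  proof (rule has_traceI[OF smooth_mult[OF smooth_const \<phi>(1)] H1_scale[OF u(1)]])
    have "jet_norm (\<lambda>x. a * \<phi> k x - a *\<^sub>R u x) = \<bar>a\<bar> * jet_norm (\<lambda>x. \<phi> k x - u x)" for k
      using H1.sn_scale[OF H1.diff[OF smooth_H1[OF \<phi>(1)] u(1)], of a k] by (simp add: right_diff_distrib)
    then show "(\<lambda>k. jet_norm (\<lambda>x. a * \<phi> k x - a *\<^sub>R u x)) \<longlonglongrightarrow> 0"
      using tendsto_mult_left[OF \<phi>(2), of "\<bar>a\<bar>"] by simp
    have "L2_norm cube_measure (\<lambda>x. a * \<phi> k (upd j c x)) = \<bar>a\<bar> * L2_norm cube_measure (\<lambda>x. \<phi> k (upd j c x))" for k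
      using L2.sn_scale[OF L2_continuous[OF continuous_upd_comp[OF smooth_continuous[OF \<phi>(1)]]], of a k j c] by simp
    then show "(\<lambda>k. L2_norm cube_measure (\<lambda>x. a * \<phi> k (upd j c x))) \<longlonglongrightarrow> 0"
      using tendsto_mult_left[OF \<phi>(3), of "\<bar>a\<bar>"] by simp
  qed
qed

section \<open>Trigonometric products\<close>

text \<open>Symmetry of second derivatives is recorded along with smoothness. It is immediate for
  functions of one coordinate and inherited by sums and products, which covers every function built
  from them below.\<close>

definition csmooth :: "(real^'n::finite \<Rightarrow> real) \<Rightarrow> bool" where
  "csmooth f \<longleftrightarrow> smooth f \<and> (\<forall>a b. partial a (partial b f) = partial b (partial a f))"

lemma csmooth_smooth: "csmooth f \<Longrightarrow> smooth f"
  by (simp add: csmooth_def)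

lemma csmooth_const: "csmooth (\<lambda>_. c)"
  by (simp add: csmooth_def smooth_const partial_const)

lemma smooth_partial_add: "smooth f \<Longrightarrow> smooth g \<Longrightarrow> partial i (\<lambda>x. f x + g x) = (\<lambda>x. partial i f x + partial i g x)"
  by (intro partial_add smooth_differentiable)

lemma smooth_partial_mult:
  "smooth f \<Longrightarrow> smooth g \<Longrightarrow> partial i (\<lambda>x. f x * g x) = (\<lambda>x. f x * partial i g x + partial i f x * g x)"
  by (intro partial_mult smooth_differentiable)

lemma smooth_partial_cmult: "smooth f \<Longrightarrow> partial i (\<lambda>x. c * f x) = (\<lambda>x. c * partial i f x)"
  by (simp add: smooth_partial_mult[OF smooth_const] partial_const)

lemma csmooth_add: "csmooth f \<Longrightarrow> csmooth g \<Longrightarrow> csmooth (\<lambda>x. f x + g x)"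
  by (simp add: csmooth_def smooth_add smooth_partial_add smooth_partial)

lemma csmooth_mult:
  assumes "csmooth f" "csmooth g"
  shows "csmooth (\<lambda>x. f x * g x)"
proof -
  have s: "smooth f" "smooth g" using assms by (auto simp: csmooth_def)
  have "partial a (partial b (\<lambda>x. f x * g x))
      = (\<lambda>x. f x * partial a (partial b g) x + partial a f x * partial b g x
           + (partial b f x * partial a g x + partial a (partial b f) x * g x))" for a b
    by (simp add: s smooth_partial_mult smooth_partial_add smooth_mult smooth_partial)
  moreover have "partial a (partial b f) = partial b (partial a f)" "partial a (partial b g) = partial b (partial a g)" for a b
    using assms unfolding csmooth_def by blast+
  ultimately show ?thesis
    unfolding csmooth_def using s by (auto simp: smooth_mult algebra_simps)
qed

lemma csmooth_cmult: "csmooth f \<Longrightarrow> csmooth (\<lambda>x. c * f x)"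
  by (rule csmooth_mult[OF csmooth_const])

lemma csmooth_coord:
  assumes "smooth1 g"
  shows "csmooth (\<lambda>x. g (x $ i))"
proof -
  obtain G where G: "G 0 = g" "\<And>m t. (G m has_real_derivative G (Suc m) t) (at t)"
    using assms unfolding smooth1_def by blast
  have "smooth1 (G (Suc 0))" unfolding smooth1_def
    by (rule exI[of _ "\<lambda>m. G (Suc m)"]) (use G(2) in auto)
  then have sm: "smooth (\<lambda>x. G (Suc 0) (x $ i))" by (rule smooth_coord)
  have p1: "partial b (\<lambda>x. g (x $ i)) = (\<lambda>x. (if b = i then 1 else 0) * G (Suc 0) (x $ i))" for b
    unfolding G(1)[symmetric] by (rule partial_coord(1)[OF G(2)])
  have p2: "partial a (\<lambda>x. G (Suc 0) (x $ i)) = (\<lambda>x. (if a = i then 1 else 0) * G (Suc (Suc 0)) (x $ i))" for a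
    by (rule partial_coord(1)[OF G(2)])
  show ?thesis
    unfolding csmooth_def p1 smooth_partial_cmult[OF sm] p2
    using smooth_coord[OF assms] by (auto simp: mult.left_commute)
qed

lemma csmooth_prod: "finite A \<Longrightarrow> (\<And>i. i \<in> A \<Longrightarrow> csmooth (f i)) \<Longrightarrow> csmooth (\<lambda>x. \<Prod>i\<in>A. f i x)"
  by (induction A rule: finite_induct) (auto simp: csmooth_const csmooth_mult)

lemma smooth1_sin_scaled: "smooth1 (\<lambda>t. sin (c * t))"
  using smooth1_affine[OF smooth1_sin, of c 0] by simp

lemma smooth1_cos_scaled: "smooth1 (\<lambda>t. cos (c * t))"
  using smooth1_affine[OF smooth1_cos, of c 0] by simp

lemma partial_eqI:
  assumes "smooth f" "((\<lambda>s. f (upd j s x)) has_real_derivative D) (at (x $ j))"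
  shows "partial j f x = D"
proof -
  have "upd j (x $ j) x = x" by (simp add: vec_eq_iff)
  with smooth_partial_deriv[OF assms(1), of j x "x $ j"] assms(2) show ?thesis
    by (metis DERIV_unique)
qed

section \<open>Eigenfunctions of the Laplacian as coordinate products\<close>

definition coord_prod :: "('n \<Rightarrow> real \<Rightarrow> real) \<Rightarrow> real^'n::finite \<Rightarrow> real" where
  "coord_prod g x = (\<Prod>l\<in>UNIV. g l (x $ l))"

lemma coord_prod_split: "coord_prod g x = g m (x $ m) * (\<Prod>l\<in>UNIV - {m}. g l (x $ l))"
  unfolding coord_prod_def by (rule prod.remove) auto

lemma coord_prod_upd: "coord_prod g (upd m s x) = g m s * (\<Prod>l\<in>UNIV - {m}. g l (x $ l))"
  unfolding coord_prod_split[of g _ m] by (auto intro: prod.cong)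

lemma coord_prod_fun_upd: "coord_prod (g(m := h)) x = h (x $ m) * (\<Prod>l\<in>UNIV - {m}. g l (x $ l))"
  unfolding coord_prod_split[of _ _ m] by (auto intro: prod.cong)

lemma csmooth_coord_prod: "(\<And>l. smooth1 (g l)) \<Longrightarrow> csmooth (coord_prod g)"
  unfolding coord_prod_def[abs_def] by (intro csmooth_prod csmooth_coord) auto

lemma partial_coord_prod:
  assumes "\<And>l. smooth1 (g l)" "\<And>t. (g m has_real_derivative g' t) (at t)"
  shows "partial m (coord_prod g) = coord_prod (g(m := g'))"
proof
  fix x
  show "partial m (coord_prod g) x = coord_prod (g(m := g')) x"
    by (rule partial_eqI[OF csmooth_smooth[OF csmooth_coord_prod[OF assms(1)]]])
       (auto simp: coord_prod_upd coord_prod_fun_upd intro!: derivative_eq_intros assms(2))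
qed

text \<open>Frequencies are integers so that the product-to-sum formulas may lower them below
  zero.\<close>

definition cos_prod :: "('n \<Rightarrow> int) \<Rightarrow> real^'n::finite \<Rightarrow> real" where
  "cos_prod k = coord_prod (\<lambda>l t. cos (of_int (k l) * pi * t))"

text \<open>A sine in direction \<open>i\<close> has value zero on the faces, a cosine in the other
  directions has normal derivative zero: the mixed boundary conditions that match
  \<open>vanishing i\<close>.\<close>

definition sin_cos :: "'n \<Rightarrow> ('n \<Rightarrow> int) \<Rightarrow> 'n \<Rightarrow> real \<Rightarrow> real" where
  "sin_cos i k l t = (if l = i then sin (of_int (k l) * pi * t) else cos (of_int (k l) * pi * t))"

definition sin_cos_prod :: "'n \<Rightarrow> ('n \<Rightarrow> int) \<Rightarrow> real^'n::finite \<Rightarrow> real" where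
  "sin_cos_prod i k = coord_prod (sin_cos i k)"

lemma smooth1_sin_cos: "smooth1 (sin_cos i k l)"
  by (cases "l = i") (auto simp: sin_cos_def[abs_def] smooth1_sin_scaled smooth1_cos_scaled)

definition sin_cos' :: "'n \<Rightarrow> ('n \<Rightarrow> int) \<Rightarrow> 'n \<Rightarrow> real \<Rightarrow> real" where
  "sin_cos' i k l t = (if l = i then of_int (k l) * pi * cos (of_int (k l) * pi * t)
     else - (of_int (k l) * pi) * sin (of_int (k l) * pi * t))"

lemma sin_cos_deriv:
  "(sin_cos i k l has_real_derivative sin_cos' i k l t) (at t)"
  "(sin_cos' i k l has_real_derivative (- (of_int (k l) * pi)\<^sup>2) * sin_cos i k l t) (at t)"
  by (cases "l = i"; auto simp: sin_cos_def[abs_def] sin_cos'_def[abs_def] power2_eq_square intro!: derivative_eq_intros)+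

lemma smooth1_cmult:
  assumes "smooth1 g"
  shows "smooth1 (\<lambda>t. c * g t)"
proof -
  obtain G where G: "G 0 = g" "\<And>m t. (G m has_real_derivative G (Suc m) t) (at t)"
    using assms unfolding smooth1_def by blast
  then show ?thesis
    unfolding smooth1_def by (intro exI[of _ "\<lambda>m t. c * G m t"]) (auto intro!: derivative_eq_intros)
qed

lemma smooth1_sin_cos': "smooth1 (sin_cos' i k l)"
proof (cases "l = i")
  case True
  then show ?thesis unfolding sin_cos'_def[abs_def] by (simp add: smooth1_cmult smooth1_cos_scaled)
next
  case False
  then have "sin_cos' i k l = (\<lambda>t. (- (of_int (k l) * pi)) * sin (of_int (k l) * pi * t))"
    by (auto simp: sin_cos'_def)
  then show ?thesis by (simp only: smooth1_cmult smooth1_sin_scaled)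
qed

lemma smooth_sin_cos_prod: "smooth (sin_cos_prod i k)"
  unfolding sin_cos_prod_def by (intro csmooth_smooth csmooth_coord_prod smooth1_sin_cos)

lemma partial_sin_cos_prod: "partial m (sin_cos_prod i k) = coord_prod ((sin_cos i k)(m := sin_cos' i k m))"
  unfolding sin_cos_prod_def by (rule partial_coord_prod[OF smooth1_sin_cos sin_cos_deriv(1)])

lemma partial2_sin_cos_prod:
  "partial m (partial m (sin_cos_prod i k)) = (\<lambda>x. - (of_int (k m) * pi)\<^sup>2 * sin_cos_prod i k x)"
proof -
  have "partial m (coord_prod ((sin_cos i k)(m := sin_cos' i k m)))
      = coord_prod ((sin_cos i k)(m := sin_cos' i k m, m := \<lambda>t. - (of_int (k m) * pi)\<^sup>2 * sin_cos i k m t))"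
    by (rule partial_coord_prod) (auto simp: smooth1_sin_cos smooth1_sin_cos' sin_cos_deriv(2)[simplified])
  then show ?thesis
    unfolding partial_sin_cos_prod by (auto simp: coord_prod_fun_upd sin_cos_prod_def coord_prod_split[of _ _ m])
qed

text \<open>The Neumann condition of the cosine factors. It makes the derivative of the
  eigenfunction an admissible \<open>\<psi>\<close> in the second clause of
  \<open>vanishing i\<close>.\<close>

lemma partial_sin_cos_prod_vanishes:
  assumes "m \<noteq> i" "c \<in> {0, 1}"
  shows "partial m (sin_cos_prod i k) (upd m c x) = 0"
proof -
  have "sin (of_int (k m) * pi * c) = 0"
    using assms(2) sin_zero_iff_int2 by fastforce
  then show ?thesis
    unfolding partial_sin_cos_prod coord_prod_upd using assms(1) by (simp add: sin_cos'_def)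
qed

section \<open>Density of smooth functions that vanish on two opposite faces\<close>

text \<open>Keeping the sine as an explicit factor gives exact zero values on both faces, includes
  every \<open>sin_cos_prod i k\<close>, and allows the Poincare inequality to be proved by direct
  computation.\<close>

definition sin_multiples :: "'n::finite \<Rightarrow> (real^'n \<Rightarrow> real) set" where
  "sin_multiples i = {(\<lambda>x. sin (pi * x $ i) * q x) |q. csmooth q}"

lemma sin_multiplesI: "csmooth q \<Longrightarrow> (\<lambda>x. sin (pi * x $ i) * q x) \<in> sin_multiples i"
  unfolding sin_multiples_def by blast

lemma sin_multiples_csmooth: "d \<in> sin_multiples i \<Longrightarrow> csmooth d"
  unfolding sin_multiples_def
  by (auto intro!: csmooth_mult csmooth_coord[where g = "\<lambda>t. sin (pi * t)"] smooth1_sin_scaled)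

lemma sin_multiples_smooth: "d \<in> sin_multiples i \<Longrightarrow> smooth d"
  by (rule csmooth_smooth[OF sin_multiples_csmooth])

lemma sin_multiples_zero_face: "d \<in> sin_multiples i \<Longrightarrow> c \<in> {0, 1} \<Longrightarrow> d (upd i c x) = 0"
  unfolding sin_multiples_def by auto

lemma sin_multiples_vanishing:
  assumes "d \<in> sin_multiples i"
  shows "d \<in> vanishing i"
  unfolding vanishing_def
  using Green_smooth_weak[OF sin_multiples_smooth[OF assms]] sin_multiples_zero_face[OF assms]
    smooth_H1[OF sin_multiples_smooth[OF assms]] by auto

lemma sin_multiples_H1: "d \<in> sin_multiples i \<Longrightarrow> d \<in> H1 cube"
  by (rule smooth_H1[OF sin_multiples_smooth])

lemma sin_multiples_add:
  assumes "u \<in> sin_multiples i" "v \<in> sin_multiples i"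
  shows "(\<lambda>x. u x + v x) \<in> sin_multiples i"
proof -
  obtain p q where pq: "csmooth p" "u = (\<lambda>x. sin (pi * x $ i) * p x)" "csmooth q" "v = (\<lambda>x. sin (pi * x $ i) * q x)"
    using assms unfolding sin_multiples_def by blast
  then show ?thesis using sin_multiplesI[OF csmooth_add[OF pq(1,3)], of i] by (simp add: distrib_left)
qed

lemma sin_multiples_scale:
  assumes "u \<in> sin_multiples i"
  shows "(\<lambda>x. a *\<^sub>R u x) \<in> sin_multiples i"
proof -
  obtain p where p: "csmooth p" "u = (\<lambda>x. sin (pi * x $ i) * p x)"
    using assms unfolding sin_multiples_def by blast
  then show ?thesis using sin_multiplesI[OF csmooth_cmult[OF p(1), of a], of i] by (simp add: mult.left_commute)
qed

lemma semi_inner_space_sin_multiples: "semi_inner_space (sin_multiples i) H1_inner"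
proof
  show "(\<lambda>_. 0) \<in> sin_multiples i" using sin_multiplesI[OF csmooth_const[of 0], of i] by simp
  fix u v w :: "real^'a \<Rightarrow> real" and a :: real
  assume u: "u \<in> sin_multiples i"
  show "(\<lambda>x. a *\<^sub>R u x) \<in> sin_multiples i" by (rule sin_multiples_scale[OF u])
  show "0 \<le> H1_inner u u" by (rule H1.nonneg[OF sin_multiples_H1[OF u]])
  assume v: "v \<in> sin_multiples i"
  show "(\<lambda>x. u x + v x) \<in> sin_multiples i" by (rule sin_multiples_add[OF u v])
  show "H1_inner u v = H1_inner v u" by (rule H1.sym[OF sin_multiples_H1[OF u] sin_multiples_H1[OF v]])
  assume w: "w \<in> sin_multiples i"
  show "H1_inner (\<lambda>x. u x + v x) w = H1_inner u w + H1_inner v w"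
    by (rule H1.ip_add[OF sin_multiples_H1[OF u] sin_multiples_H1[OF v] sin_multiples_H1[OF w]])
next
  fix u w :: "real^'a \<Rightarrow> real" and a :: real
  assume "u \<in> sin_multiples i" "w \<in> sin_multiples i"
  then show "H1_inner (\<lambda>x. a *\<^sub>R u x) w = a * H1_inner u w"
    by (intro H1.ip_scale sin_multiples_H1)
qed

text \<open>Dividing sin(k pi x) by sin(pi x) leaves a polynomial in cos(pi x): the addition formula
  gives the recursion q_(n+1) = q_n cos(pi x) + cos(n pi x). Negative \<open>k\<close> follow since
  sine is odd.\<close>

lemma sin_quotient:
  fixes i :: "'n::finite" and k :: int
  shows "\<exists>q. csmooth q \<and> (\<forall>x :: real^'n. sin (of_int k * pi * x $ i) = sin (pi * x $ i) * q x)"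
proof -
  have cc: "csmooth (\<lambda>x :: real^'n. cos (c * x $ i))" for c
    by (rule csmooth_coord[OF smooth1_cos_scaled])
  have nat: "\<exists>q. csmooth q \<and> (\<forall>x :: real^'n. sin (real n * pi * x $ i) = sin (pi * x $ i) * q x)" for n
  proof (induction n)
    case 0
    show ?case by (rule exI[of _ "\<lambda>_. 0"]) (simp add: csmooth_const)
  next
    case (Suc n)
    then obtain q where q: "csmooth q" "\<And>x :: real^'n. sin (real n * pi * x $ i) = sin (pi * x $ i) * q x" by blast
    have "sin (real (Suc n) * pi * x $ i) = sin (pi * x $ i) * (q x * cos (pi * x $ i) + cos (real n * pi * x $ i))" for x :: "real^'n"
    proof -
      have eq: "real (Suc n) * pi * x $ i = real n * pi * x $ i + pi * x $ i" by (simp add: algebra_simps)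
      show ?thesis unfolding eq sin_add q(2) by (simp add: algebra_simps)
    qed
    moreover have "csmooth (\<lambda>x :: real^'n. q x * cos (pi * x $ i) + cos (real n * pi * x $ i))"
      by (intro csmooth_add csmooth_mult q(1) cc)
    ultimately show ?case by blast
  qed
  show ?thesis
  proof (cases "k \<ge> 0")
    case True
    then show ?thesis using nat[of "nat k"] by simp
  next
    case False
    then obtain q where q: "csmooth q" "\<And>x :: real^'n. sin (real (nat (- k)) * pi * x $ i) = sin (pi * x $ i) * q x"
      using nat by blast
    have "sin (of_int k * pi * x $ i) = sin (pi * x $ i) * (-1 * q x)" for x :: "real^'n"
    proof -
      have "of_int k * pi * x $ i = - (real (nat (- k)) * pi * x $ i)" using False by simp
      then show ?thesis using q(2)[of x] by (simp only: sin_minus)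
    qed
    with csmooth_cmult[OF q(1), of "-1"] show ?thesis by blast
  qed
qed

lemma sin_cos_prod_in_sin_multiples: "sin_cos_prod i k \<in> sin_multiples i"
proof -
  obtain q where q: "csmooth q" "\<And>x. sin (of_int (k i) * pi * x $ i) = sin (pi * x $ i) * q x"
    using sin_quotient by blast
  have eq: "sin_cos_prod i k x = sin (pi * x $ i) * (q x * (\<Prod>l\<in>UNIV - {i}. cos (of_int (k l) * pi * x $ l)))" for x
  proof -
    have "sin_cos_prod i k x = sin (of_int (k i) * pi * x $ i) * (\<Prod>l\<in>UNIV - {i}. cos (of_int (k l) * pi * x $ l))"
      by (simp add: sin_cos_prod_def coord_prod_split[of _ _ i] sin_cos_def)
    then show ?thesis unfolding q(2) by (simp only: mult.assoc)
  qed
  have "csmooth (\<lambda>x. q x * (\<Prod>l\<in>UNIV - {i}. cos (of_int (k l) * pi * x $ l)))"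
    by (intro csmooth_mult q(1) csmooth_prod csmooth_coord smooth1_cos_scaled) auto
  then show ?thesis unfolding eq[abs_def] by (rule sin_multiplesI)
qed

lemma H1_inner_smooth:
  assumes u: "u \<in> H1 cube" and f: "smooth f"
  shows "H1_inner u f = (LINT x|cube_measure. u x * f x)
    + (\<Sum>m\<in>UNIV. LINT x|cube_measure. weak_partial cube m u x * partial m f x)"
proof -
  have "H1_inner u f = (LINT x|cube_measure. u x * f x + (\<Sum>m\<in>UNIV. weak_partial cube m u x * weak_partial cube m f x))"
    by (simp add: H1_inner_def L2_inner_def jet_def inner_vec_def)
  also have "\<dots> = (LINT x|cube_measure. u x * f x) + (\<Sum>m\<in>UNIV. LINT x|cube_measure. weak_partial cube m u x * weak_partial cube m f x)"
    using integrable_mult_L2[OF H1_L2[OF u] L2_smooth[OF f]]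
      integrable_mult_L2[OF weak_partial(1)[OF u] weak_partial(1)[OF smooth_H1[OF f]]] by simp
  moreover have "(LINT x|cube_measure. weak_partial cube m u x * weak_partial cube m f x) = (LINT x|cube_measure. weak_partial cube m u x * partial m f x)" for m
    using integral_weak_partial_smooth[OF f weak_partial(1)[OF u, of m], of m] by (simp add: mult.commute)
  ultimately show ?thesis by (simp only:)
qed

text \<open>Integration by parts moves the derivative from \<open>v\<close> to the eigenfunction, so
  the \<open>H1\<close> product is the \<open>L2\<close> product times 1 plus the sum of all (k_m
  pi)^2, a positive factor. In direction \<open>i\<close> the zero trace of \<open>v\<close> removes
  the boundary term, in the other directions the cosine factors do.\<close>

lemma orthogonal_sin_cos_prod:
  assumes v: "v \<in> vanishing i" and orth: "H1_inner v (sin_cos_prod i k) = 0"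
  shows "(LINT x|cube_measure. v x * sin_cos_prod i k x) = 0"
proof -
  let ?e = "sin_cos_prod i k"
  have "(LINT x|cube_measure. weak_partial cube m v x * partial m ?e x) = (of_int (k m) * pi)\<^sup>2 * (LINT x|cube_measure. v x * ?e x)" for m
  proof -
    have "Green m v (partial m ?e)"
    proof (cases "m = i")
      case True
      then show ?thesis using v smooth_partial[OF smooth_sin_cos_prod] by (auto simp: vanishing_def)
    next
      case False
      then show ?thesis
        using v smooth_partial[OF smooth_sin_cos_prod] partial_sin_cos_prod_vanishes[OF False]
        unfolding vanishing_def by blast
    qed
    then show ?thesis by (simp add: Green_def partial2_sin_cos_prod mult.left_commute[of _ "(of_int (k m) * pi)\<^sup>2"])
  qed
  then have "(1 + (\<Sum>m\<in>UNIV. (of_int (k m) * pi)\<^sup>2)) * (LINT x|cube_measure. v x * ?e x) = 0"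
    using orth H1_inner_smooth[OF vanishing_H1[OF v] smooth_sin_cos_prod[of i k]]
    by (simp add: distrib_right sum_distrib_right)
  moreover have "1 + (\<Sum>m\<in>UNIV. (of_int (k m) * pi)\<^sup>2) > 0"
    by (intro add_pos_nonneg sum_nonneg) auto
  ultimately show ?thesis by simp
qed

section \<open>Completeness of the cosine products\<close>

inductive cos_polynomial :: "(real^'n::finite \<Rightarrow> real) \<Rightarrow> bool" where
  const: "cos_polynomial (\<lambda>_. c)"
| add: "cos_polynomial f \<Longrightarrow> cos_polynomial g \<Longrightarrow> cos_polynomial (\<lambda>x. f x + g x)"
| mult_cos: "cos_polynomial f \<Longrightarrow> cos_polynomial (\<lambda>x. cos (pi * x $ m) * f x)"

lemma cos_polynomial_cmult: "cos_polynomial f \<Longrightarrow> cos_polynomial (\<lambda>x. c * f x)"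
proof (induction rule: cos_polynomial.induct)
  case (const d)
  show ?case by (rule cos_polynomial.const)
next
  case (add f g)
  then show ?case using cos_polynomial.add by (simp add: distrib_left)
next
  case (mult_cos f m)
  then show ?case using cos_polynomial.mult_cos[of "\<lambda>x. c * f x" m] by (simp add: mult.left_commute)
qed

lemma cos_polynomial_mult: "cos_polynomial f \<Longrightarrow> cos_polynomial g \<Longrightarrow> cos_polynomial (\<lambda>x. f x * g x)"
proof (induction arbitrary: g rule: cos_polynomial.induct)
  case (const c)
  then show ?case by (rule cos_polynomial_cmult)
next
  case (add f h)
  then show ?case using cos_polynomial.add[of "\<lambda>x. f x * g x" "\<lambda>x. h x * g x"] by (simp add: distrib_right)
next
  case (mult_cos f m)
  then show ?case using cos_polynomial.mult_cos[of "\<lambda>x. f x * g x" m] by (simp add: mult.assoc)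
qed

lemma cos_polynomial_continuous: "cos_polynomial f \<Longrightarrow> continuous_on UNIV f"
  by (induction rule: cos_polynomial.induct) (auto intro!: continuous_intros)

lemma cos_prod_step:
  "cos (pi * x $ m) * cos_prod k x = (cos_prod (k(m := k m + 1)) x + cos_prod (k(m := k m - 1)) x) / 2"
proof -
  let ?R = "\<Prod>l\<in>UNIV - {m}. cos (of_int (k l) * pi * x $ l)"
  have upd: "cos_prod (k(m := j)) x = cos (of_int j * pi * x $ m) * ?R" for j
    unfolding cos_prod_def coord_prod_split[of _ _ m] by (auto intro: prod.cong)
  have base: "cos_prod k x = cos (of_int (k m) * pi * x $ m) * ?R"
    unfolding cos_prod_def coord_prod_split[of _ _ m] by simp
  have "of_int (k m + 1) * pi * x $ m = of_int (k m) * pi * x $ m + pi * x $ m"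
    "of_int (k m - 1) * pi * x $ m = of_int (k m) * pi * x $ m - pi * x $ m"
    by (simp_all add: algebra_simps)
  then show ?thesis unfolding upd base by (simp only: cos_add cos_diff) (simp add: algebra_simps)
qed

text \<open>Converts orthogonality of \<open>v\<close> to all \<open>sin_cos_prod i k\<close> into
  orthogonality of the product of \<open>sin (pi * x $ i)\<close> and \<open>v\<close> to all cosine
  products.\<close>

lemma sin_mult_cos_prod:
  "sin (pi * x $ i) * cos_prod k x = (sin_cos_prod i (k(i := k i + 1)) x - sin_cos_prod i (k(i := k i - 1)) x) / 2"
proof -
  let ?R = "\<Prod>l\<in>UNIV - {i}. cos (of_int (k l) * pi * x $ l)"
  have upd: "sin_cos_prod i (k(i := j)) x = sin (of_int j * pi * x $ i) * ?R" for j
    unfolding sin_cos_prod_def coord_prod_split[of _ _ i] by (auto simp: sin_cos_def intro: prod.cong)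
  have base: "cos_prod k x = cos (of_int (k i) * pi * x $ i) * ?R"
    unfolding cos_prod_def coord_prod_split[of _ _ i] by simp
  have "of_int (k i + 1) * pi * x $ i = of_int (k i) * pi * x $ i + pi * x $ i"
    "of_int (k i - 1) * pi * x $ i = of_int (k i) * pi * x $ i - pi * x $ i"
    by (simp_all add: algebra_simps)
  then show ?thesis unfolding upd base by (simp only: sin_add sin_diff) (simp add: algebra_simps)
qed

lemma cos_prod_continuous: "continuous_on UNIV (cos_prod k)"
  unfolding cos_prod_def coord_prod_def by (intro continuous_intros)

text \<open>By the product-to-sum formula \<open>w\<close> is orthogonal to all polynomials in the
  functions \<open>cos (pi * x $ m)\<close>. These separate the points of the closed cube, cosine
  being injective on the interval from 0 to pi, so by Stone-Weierstrass they approximate every test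
  function uniformly.\<close>

lemma AE_zero_if_orthogonal_cos_prod:
  fixes w :: "real^'n::finite \<Rightarrow> real"
  assumes w: "w \<in> L2 cube_measure" and orth: "\<And>k. (LINT x|cube_measure. w x * cos_prod k x) = 0"
  shows "AE x in cube_measure. w x = 0"
proof (rule AE_zero_if_test_integrals_zero)
  show int_w: "integrable cube_measure w" by (rule cube.L1_le_L2(1)[OF w])
  have int: "integrable cube_measure (\<lambda>x. w x * h x)" if "continuous_on UNIV h" for h
    by (rule integrable_mult_L2[OF w L2_continuous[OF that]])
  \<comment> \<open>The claim covers all \<open>k\<close> at once because multiplication by a cosine
    shifts \<open>k\<close> up and down.\<close>
  have poly: "\<forall>k. (LINT x|cube_measure. w x * (f x * cos_prod k x)) = 0" if "cos_polynomial f" for f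
    using that
  proof (induction rule: cos_polynomial.induct)
    case (const c)
    show ?case using orth by (simp add: mult.left_commute)
  next
    case (add f g)
    have "integrable cube_measure (\<lambda>x. w x * (f x * cos_prod k x))" "integrable cube_measure (\<lambda>x. w x * (g x * cos_prod k x))" for k
      using add cos_polynomial_continuous cos_prod_continuous by (auto intro!: int continuous_on_mult)
    then show ?case using add by (simp add: distrib_left distrib_right)
  next
    case (mult_cos f m)
    show ?case
    proof
      fix k
      have i: "integrable cube_measure (\<lambda>x. w x * (f x * cos_prod k x))" for k
        using mult_cos cos_polynomial_continuous cos_prod_continuous by (auto intro!: int continuous_on_mult)
      have eq: "w x * (cos (pi * x $ m) * f x * cos_prod k x)
          = (w x * (f x * cos_prod (k(m := k m + 1)) x) + w x * (f x * cos_prod (k(m := k m - 1)) x)) / 2" for x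
      proof -
        have "w x * (cos (pi * x $ m) * f x * cos_prod k x) = w x * f x * (cos (pi * x $ m) * cos_prod k x)"
          by (simp only: mult_ac)
        then show ?thesis unfolding cos_prod_step by (simp add: algebra_simps)
      qed
      show "(LINT x|cube_measure. w x * (cos (pi * x $ m) * f x * cos_prod k x)) = 0"
        unfolding eq using i mult_cos by simp
    qed
  qed
  have one: "cos_prod (\<lambda>_. 0) x = 1" for x :: "real^'n"
    by (simp add: cos_prod_def coord_prod_def)
  fix \<phi> :: "real^'n \<Rightarrow> real" assume "\<phi> \<in> test_functions cube"
  then have \<phi>: "continuous_on UNIV \<phi>" by (intro smooth_continuous test_function_smooth)
  have bound: "\<bar>LINT x|cube_measure. w x * \<phi> x\<bar> \<le> e * (LINT x|cube_measure. \<bar>w x\<bar>)" if e: "e > 0" for e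
  proof -
    have sep: "\<exists>f. cos_polynomial f \<and> f x \<noteq> f y" if xy: "x \<in> cbox 0 1 \<and> y \<in> cbox 0 1 \<and> x \<noteq> y" for x y :: "real^'n"
    proof -
      obtain m where m: "x $ m \<noteq> y $ m" using xy by (auto simp: vec_eq_iff)
      have "0 \<le> pi * x $ m" "pi * x $ m \<le> pi" "0 \<le> pi * y $ m" "pi * y $ m \<le> pi"
        using xy by (auto simp: mem_box_cart)
      then have "cos (pi * x $ m) \<noteq> cos (pi * y $ m)"
        using cos_inj_pi[of "pi * x $ m" "pi * y $ m"] m by auto
      then show ?thesis
        using cos_polynomial.mult_cos[OF cos_polynomial.const[of 1], of m] by auto
    qed
    obtain g where g: "cos_polynomial g" "\<And>x. x \<in> cbox 0 1 \<Longrightarrow> \<bar>\<phi> x - g x\<bar> < e"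
    proof -
      have "\<exists>g. cos_polynomial g \<and> (\<forall>x\<in>cbox 0 1. \<bar>\<phi> x - g x\<bar> < e)"
      proof (rule Stone_Weierstrass_HOL[of "cbox 0 1 :: (real^'n) set" cos_polynomial \<phi> e])
        show "cos_polynomial f \<Longrightarrow> continuous_on (cbox 0 1) f" for f
          using cos_polynomial_continuous continuous_on_subset by blast
        show "continuous_on (cbox 0 1) \<phi>" using \<phi> continuous_on_subset by blast
      qed (auto intro: cos_polynomial.intros cos_polynomial_mult sep e)
      then show ?thesis using that by blast
    qed
    have gc: "continuous_on UNIV g" by (rule cos_polynomial_continuous[OF g(1)])
    have "(LINT x|cube_measure. w x * g x) = 0"
      using poly[OF g(1), rule_format, of "\<lambda>_. 0"] by (simp add: one)
    then have "(LINT x|cube_measure. w x * \<phi> x) = (LINT x|cube_measure. w x * \<phi> x - w x * g x)"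
      using int[OF \<phi>] int[OF gc] by simp
    also have "\<bar>\<dots>\<bar> \<le> (LINT x|cube_measure. \<bar>w x * \<phi> x - w x * g x\<bar>)"
      using integral_abs_bound by blast
    also have "\<dots> \<le> (LINT x|cube_measure. e * \<bar>w x\<bar>)"
    proof (rule integral_mono)
      fix x assume "x \<in> space (cube_measure :: (real^'n) measure)"
      then have "x \<in> cbox 0 1" using cube_subset_cbox by (auto simp: space_cube_measure)
      then have "\<bar>w x\<bar> * \<bar>\<phi> x - g x\<bar> \<le> \<bar>w x\<bar> * e" using g(2) by (intro mult_left_mono) (auto intro: less_imp_le)
      then show "\<bar>w x * \<phi> x - w x * g x\<bar> \<le> e * \<bar>w x\<bar>"
        by (simp only: right_diff_distrib[symmetric] abs_mult mult.commute[of e])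
    qed (use int[OF \<phi>] int[OF gc] int_w in auto)
    finally show ?thesis by simp
  qed
  show "(LINT x|cube_measure. w x * \<phi> x) = 0"
  proof (rule ccontr)
    let ?N = "LINT x|cube_measure. \<bar>w x\<bar>" and ?I = "\<bar>LINT x|cube_measure. w x * \<phi> x\<bar>"
    assume "(LINT x|cube_measure. w x * \<phi> x) \<noteq> 0"
    then have I: "?I > 0" by simp
    have N: "?N \<ge> 0" by simp
    have pos: "2 * (?N + 1) > 0" using N add_nonneg_pos[OF N zero_less_one] by simp
    have less: "?N < 2 * (?N + 1)" using N add_nonneg_pos[OF N zero_less_one] by simp
    \<comment> \<open>This value of \<open>e\<close> brings the bound below \<open>?I\<close>; the
      summand one in the denominator covers the case \<open>?N = 0\<close>.\<close>
    have "?I \<le> ?I / (2 * (?N + 1)) * ?N" by (rule bound[OF divide_pos_pos[OF I pos]])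
    also have "\<dots> = ?I * (?N / (2 * (?N + 1)))" by simp
    also have "\<dots> < ?I * 1" using I pos less by (intro mult_strict_left_mono) (simp_all only: divide_less_eq_1_pos)
    finally show False by simp
  qed
qed

text \<open>After multiplication by \<open>sin (pi * x $ i)\<close> the function is orthogonal to
  all cosine products, hence zero, and the sine is positive inside the cube.\<close>

lemma vanishing_orthogonal_zero:
  assumes v: "v \<in> vanishing i" and orth: "\<And>z. z \<in> sin_multiples i \<Longrightarrow> H1_inner v z = 0"
  shows "AE x in cube_measure. v x = 0"
proof -
  have e0: "(LINT x|cube_measure. v x * sin_cos_prod i k x) = 0" for k
    by (rule orthogonal_sin_cos_prod[OF v orth[OF sin_cos_prod_in_sin_multiples]])
  have vL: "v \<in> L2 cube_measure" by (rule H1_L2[OF vanishing_H1[OF v]])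
  have sin_cont: "continuous_on UNIV (\<lambda>x. sin (pi * x $ i))" by (intro continuous_intros)
  have "AE x in cube_measure. sin (pi * x $ i) * v x = 0"
  proof (rule AE_zero_if_orthogonal_cos_prod)
    show "(\<lambda>x. sin (pi * x $ i) * v x) \<in> L2 cube_measure"
      using L2_bounded_mult[OF vL borel_measurable_cube[OF borel_measurable_continuous_onI[OF sin_cont]], of 1] by simp
    fix k
    have eq: "sin (pi * x $ i) * v x * cos_prod k x
        = (v x * sin_cos_prod i (k(i := k i + 1)) x - v x * sin_cos_prod i (k(i := k i - 1)) x) / 2" for x
    proof -
      have "sin (pi * x $ i) * v x * cos_prod k x = v x * (sin (pi * x $ i) * cos_prod k x)" by (simp only: mult_ac)
      then show ?thesis unfolding sin_mult_cos_prod by (simp add: algebra_simps)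
    qed
    show "(LINT x|cube_measure. sin (pi * x $ i) * v x * cos_prod k x) = 0"
      unfolding eq using integrable_mult_L2[OF vL L2_smooth[OF smooth_sin_cos_prod]] e0 by simp
  qed
  then show ?thesis
    using AE_space
  proof eventually_elim
    case (elim x)
    then have "0 < pi * x $ i" "pi * x $ i < pi" by (auto simp: space_cube_measure cube_def)
    then have "sin (pi * x $ i) > 0" by (rule sin_gt_zero)
    with elim show ?case by simp
  qed
qed

text \<open>Null sets do not affect the test integrals, so zero is a weak derivative of
  \<open>u\<close>, and uniqueness identifies the chosen representative with it.\<close>

lemma jet_norm_AE_zero:
  assumes u: "u \<in> H1 cube" and z: "AE x in cube_measure. u x = 0"
  shows "jet_norm u = 0"
proof -
  have "has_weak_partial cube i u (\<lambda>_. 0)" for i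
    unfolding has_weak_partial_def
  proof
    fix \<phi> :: "real^'a \<Rightarrow> real" assume "\<phi> \<in> test_functions cube"
    have "AE x in cube_measure. u x * partial i \<phi> x = 0" using z by eventually_elim simp
    then have "(LINT x|cube_measure. u x * partial i \<phi> x) = 0" by (rule integral_eq_zero_AE)
    then show "(LINT x|cube_measure. u x * partial i \<phi> x) = - (LINT x|cube_measure. 0 * \<phi> x)" by simp
  qed
  then have "AE x in cube_measure. \<forall>i\<in>UNIV. weak_partial cube i u x = 0"
    by (intro AE_finite_allI finite weak_partial_unique[OF u L2_zero])
  with z have "AE x in cube_measure. jet u x = 0"
    by eventually_elim (simp add: jet_def vec_eq_iff prod_eq_iff)
  then have "AE x in cube_measure. (norm (jet u x))\<^sup>2 = 0" by eventually_elim simp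
  then show ?thesis unfolding jet_norm_def L2_norm_def by (simp add: integral_eq_zero_AE)
qed

text \<open>Orthogonal projection of \<open>u\<close> onto the closure of
  \<open>sin_multiples i\<close>: the Riesz sequence of \<open>H1_inner u\<close> has a limit
  \<open>p\<close> in \<open>H1 cube\<close>, and \<open>p - u\<close> lies in
  \<open>vanishing i\<close> and is orthogonal to \<open>sin_multiples i\<close>, so it
  vanishes.\<close>

lemma sin_multiples_dense:
  assumes u: "u \<in> vanishing i"
  obtains d where "\<And>k. d k \<in> sin_multiples i" "(\<lambda>k. jet_norm (\<lambda>x. d k x - u x)) \<longlonglongrightarrow> 0"
proof -
  interpret D: semi_inner_space "sin_multiples i" H1_inner
    by (rule semi_inner_space_sin_multiples)
  have uH: "u \<in> H1 cube" by (rule vanishing_H1[OF u])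
  have sn: "D.sn = jet_norm"
    by (auto simp: D.sn_def jet_norm_def H1_inner_def L2_norm_def L2_inner_def power2_norm_eq_inner)
  have "D.bounded_functional (H1_inner u)"
  proof (rule D.bounded_functionalI[where K = "jet_norm u"])
    fix z assume "z \<in> sin_multiples i"
    then show "\<bar>H1_inner u z\<bar> \<le> jet_norm u * D.sn z"
      unfolding sn by (intro H1.Cauchy_Schwarz uH sin_multiples_H1)
  next
    fix v w and a :: real assume v: "v \<in> sin_multiples i"
    show "H1_inner u (\<lambda>x. a *\<^sub>R v x) = a * H1_inner u v"
      by (rule H1.ip_scale_right[OF sin_multiples_H1[OF v] uH])
    assume w: "w \<in> sin_multiples i"
    show "H1_inner u (\<lambda>x. v x + w x) = H1_inner u v + H1_inner u w"
      by (rule H1.ip_add_right[OF sin_multiples_H1[OF v] sin_multiples_H1[OF w] uH])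
  qed simp
  then obtain d where d: "\<And>k. d k \<in> sin_multiples i" "D.Cauchy_in d"
    and dz: "\<And>z. z \<in> sin_multiples i \<Longrightarrow> (\<lambda>k. H1_inner (d k) z) \<longlonglongrightarrow> H1_inner u z"
    by (rule D.Riesz_sequence) (rule that)
  have dH: "\<And>k. d k \<in> H1 cube" by (rule sin_multiples_H1[OF d(1)])
  have "H1.Cauchy_in d" using d(2) unfolding D.Cauchy_in_def H1.Cauchy_in_def sn .
  then obtain p where p: "p \<in> H1 cube" "(\<lambda>k. jet_norm (\<lambda>x. d k x - p x)) \<longlonglongrightarrow> 0"
    by (rule H1_complete[OF dH])
  have pv: "p \<in> vanishing i" by (rule vanishing_limit[OF sin_multiples_vanishing[OF d(1)] p])
  have pu: "(\<lambda>x. p x - u x) \<in> vanishing i" by (rule vanishing_diff[OF pv u])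
  have "H1_inner (\<lambda>x. p x - u x) z = 0" if z: "z \<in> sin_multiples i" for z
    using LIMSEQ_unique[OF H1.tendsto_ip[OF dH p(1) sin_multiples_H1[OF z] p(2)] dz[OF z]]
    by (simp add: H1.ip_diff[OF p(1) uH sin_multiples_H1[OF z]])
  then have "AE x in cube_measure. p x - u x = 0" by (rule vanishing_orthogonal_zero[OF pu])
  then have zero: "jet_norm (\<lambda>x. p x - u x) = 0" by (rule jet_norm_AE_zero[OF vanishing_H1[OF pu]])
  have "\<bar>jet_norm (\<lambda>x. d k x - u x)\<bar> \<le> jet_norm (\<lambda>x. d k x - p x)" for k
    using H1.sn_triangle_diff[OF dH p(1) uH, of k] zero by simp
  then have "(\<lambda>k. jet_norm (\<lambda>x. d k x - u x)) \<longlonglongrightarrow> 0" by (rule null_comparison[OF _ p(2)])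
  then show ?thesis by (rule that[OF d(1)])
qed

section \<open>Poincare inequality and commutation of derivatives\<close>

lemma partial_sin_multiple:
  assumes "smooth q"
  shows "partial m (\<lambda>x. sin (pi * x $ i) * q x)
    = (\<lambda>x. sin (pi * x $ i) * partial m q x + (if m = i then pi * cos (pi * x $ i) * q x else 0))"
proof -
  have D: "((\<lambda>t. sin (pi * t)) has_real_derivative pi * cos (pi * t)) (at t)" for t
    by (auto intro!: derivative_eq_intros)
  have "smooth (\<lambda>x. sin (pi * x $ i))" by (rule smooth_coord[OF smooth1_sin_scaled])
  from smooth_partial_mult[OF this assms, of m] show ?thesis
    by (auto simp: partial_coord(1)[OF D])
qed

lemma partial_cos_multiple:
  assumes "smooth q"
  shows "partial m (\<lambda>x. cos (pi * x $ i) * q x)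
    = (\<lambda>x. cos (pi * x $ i) * partial m q x - (if m = i then pi * sin (pi * x $ i) * q x else 0))"
proof -
  have D: "((\<lambda>t. cos (pi * t)) has_real_derivative - (pi * sin (pi * t))) (at t)" for t
    by (auto intro!: derivative_eq_intros)
  have "smooth (\<lambda>x. cos (pi * x $ i))" by (rule smooth_coord[OF smooth1_cos_scaled])
  from smooth_partial_mult[OF this assms, of m] show ?thesis
    by (auto simp: partial_coord(1)[OF D])
qed

text \<open>For \<open>d = sin (\<pi> x\<^sub>i) q\<close> one has \<open>(\<partial>\<^sub>i d)\<^sup>2 - \<pi>\<^sup>2 d\<^sup>2 = sin\<^sup>2 (\<partial>\<^sub>i q)\<^sup>2 + \<partial>\<^sub>i (\<pi> sin cos q\<^sup>2)\<close>,
  and the last term integrates to zero.\<close>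

lemma Poincare_sin_multiples:
  assumes "d \<in> sin_multiples i"
  shows "pi * L2_norm cube_measure d \<le> L2_norm cube_measure (partial i d)"
proof -
  obtain q where "csmooth q" and d: "d = (\<lambda>x. sin (pi * x $ i) * q x)"
    using assms unfolding sin_multiples_def by blast
  then have q: "smooth q" by (simp add: csmooth_smooth)
  note sd = sin_multiples_smooth[OF assms]
  let ?h = "\<lambda>x. sin (pi * x $ i) * (cos (pi * x $ i) * (pi * (q x * q x)))"
  have sc: "smooth (\<lambda>x. cos (pi * x $ i))" by (rule smooth_coord[OF smooth1_cos_scaled])
  have ss: "smooth (\<lambda>x. sin (pi * x $ i))" by (rule smooth_coord[OF smooth1_sin_scaled])
  have sr: "smooth (\<lambda>x. pi * (q x * q x))" by (intro smooth_mult smooth_const q)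
  have sh: "smooth ?h" by (intro smooth_mult sc ss smooth_const q)
  have p1: "partial i d = (\<lambda>x. sin (pi * x $ i) * partial i q x + pi * cos (pi * x $ i) * q x)"
    unfolding d partial_sin_multiple[OF q] by simp
  have p2: "partial i (\<lambda>x. pi * (q x * q x)) = (\<lambda>x. pi * (q x * partial i q x + partial i q x * q x))"
    by (simp only: smooth_partial_cmult[OF smooth_mult[OF q q]] smooth_partial_mult[OF q q])
  have p3: "partial i ?h = (\<lambda>x. sin (pi * x $ i) * (cos (pi * x $ i) * (pi * (q x * partial i q x + partial i q x * q x))
      - pi * sin (pi * x $ i) * (pi * (q x * q x))) + pi * cos (pi * x $ i) * (cos (pi * x $ i) * (pi * (q x * q x))))"
    unfolding partial_sin_multiple[OF smooth_mult[OF sc sr]] partial_cos_multiple[OF sr] p2 by simp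
  have "(partial i d x)\<^sup>2 - pi\<^sup>2 * (d x)\<^sup>2 = (sin (pi * x $ i))\<^sup>2 * (partial i q x)\<^sup>2 + partial i ?h x" for x
    unfolding p1 p3 unfolding d by (simp add: power2_eq_square algebra_simps)
  then have pw: "partial i ?h x \<le> (partial i d x)\<^sup>2 - pi\<^sup>2 * (d x)\<^sup>2" for x by simp
  have i1: "integrable cube_measure (\<lambda>x. (partial i d x)\<^sup>2)" "integrable cube_measure (\<lambda>x. (d x)\<^sup>2)"
    using L2_integrable[OF L2_smooth[OF smooth_partial[OF sd]], of i] L2_integrable[OF L2_smooth[OF sd]] by auto
  have "(LINT x|cube_measure. partial i ?h x) \<le> (LINT x|cube_measure. (partial i d x)\<^sup>2 - pi\<^sup>2 * (d x)\<^sup>2)"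
    by (rule integral_mono) (use pw i1 cube.L1_le_L2(1)[OF L2_smooth[OF smooth_partial[OF sh]]] in auto)
  \<comment> \<open>The sine factor of \<open>?h\<close> is zero on both faces normal to
    \<open>axis i 1\<close>.\<close>
  moreover have "(LINT x|cube_measure. partial i ?h x) = 0"
    unfolding integral_cube_partial[OF sh] by simp
  ultimately have "pi\<^sup>2 * (LINT x|cube_measure. (d x)\<^sup>2) \<le> (LINT x|cube_measure. (partial i d x)\<^sup>2)"
    using i1 by simp
  then have "sqrt (pi\<^sup>2 * (LINT x|cube_measure. (d x)\<^sup>2)) \<le> sqrt (LINT x|cube_measure. (partial i d x)\<^sup>2)"
    by (rule real_sqrt_le_mono)
  then show ?thesis by (simp add: L2_norm_def real_sqrt_mult)
qed

lemma L2_norm_weak_partial_smooth: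
  "smooth f \<Longrightarrow> L2_norm cube_measure (weak_partial cube i f) = L2_norm cube_measure (partial i f)"
  by (rule L2_norm_AE_cong[OF weak_partial(1)[OF smooth_H1] L2_smooth[OF smooth_partial] weak_partial_smooth])

lemma Poincare:
  assumes u: "u \<in> vanishing i"
  shows "pi * L2_norm cube_measure u \<le> L2_norm cube_measure (weak_partial cube i u)"
proof -
  obtain d where d: "\<And>k. d k \<in> sin_multiples i" "(\<lambda>k. jet_norm (\<lambda>x. d k x - u x)) \<longlonglongrightarrow> 0"
    using sin_multiples_dense[OF u] by blast
  note dH = sin_multiples_H1[OF d(1)] and uH = vanishing_H1[OF u]
  have l1: "(\<lambda>k. pi * L2_norm cube_measure (d k)) \<longlonglongrightarrow> pi * L2_norm cube_measure u"
    by (intro tendsto_mult_left tendsto_L2_norm[OF H1_L2[OF dH] H1_L2[OF uH] jet_norm_tendsto_L2(1)[OF dH uH d(2)]])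
  have l2: "(\<lambda>k. L2_norm cube_measure (weak_partial cube i (d k))) \<longlonglongrightarrow> L2_norm cube_measure (weak_partial cube i u)"
    by (rule tendsto_L2_norm[OF weak_partial(1)[OF dH] weak_partial(1)[OF uH] jet_norm_tendsto_L2(2)[OF dH uH d(2)]])
  have "pi * L2_norm cube_measure (d k) \<le> L2_norm cube_measure (weak_partial cube i (d k))" for k
    unfolding L2_norm_weak_partial_smooth[OF sin_multiples_smooth[OF d(1)]] by (rule Poincare_sin_multiples[OF d(1)])
  then show ?thesis by (intro LIMSEQ_le[OF l1 l2]) blast
qed

text \<open>With a smooth \<open>d\<close> in place of \<open>v\<close>, both integrals equal minus
  the integral of \<open>u\<close> times a mixed second derivative of \<open>d\<close>. In direction
  \<open>j\<close> the zero trace of \<open>u\<close> permits this; in direction \<open>i\<close> it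
  holds because \<open>partial j d\<close> vanishes on the faces along with \<open>d\<close>.
  Density of \<open>sin_multiples i\<close> passes to \<open>v\<close>.\<close>

lemma integral_swap_partials:
  assumes u: "u \<in> vanishing j" and v: "v \<in> vanishing i" and ij: "i \<noteq> j"
  shows "(LINT x|cube_measure. weak_partial cube j u x * weak_partial cube i v x)
       = (LINT x|cube_measure. weak_partial cube i u x * weak_partial cube j v x)"
proof -
  obtain d where d: "\<And>k. d k \<in> sin_multiples i" "(\<lambda>k. jet_norm (\<lambda>x. d k x - v x)) \<longlonglongrightarrow> 0"
    using sin_multiples_dense[OF v] by blast
  note dH = sin_multiples_H1[OF d(1)] and vH = vanishing_H1[OF v] and uH = vanishing_H1[OF u]
  have eq: "(LINT x|cube_measure. weak_partial cube i (d k) x * weak_partial cube j u x)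
      = (LINT x|cube_measure. weak_partial cube j (d k) x * weak_partial cube i u x)" for k
  proof -
    have sm: "smooth (d k)" by (rule sin_multiples_smooth[OF d(1)])
    obtain q where q: "csmooth q" and dq: "d k = (\<lambda>x. sin (pi * x $ i) * q x)"
      using d(1)[of k] unfolding sin_multiples_def by blast
    have "Green j u (partial i (d k))"
      using u smooth_partial[OF sm] by (simp add: vanishing_def)
    moreover have "\<forall>x. \<forall>c\<in>{0, 1}. partial j (d k) (upd i c x) = 0"
      unfolding dq partial_sin_multiple[OF csmooth_smooth[OF q]] using ij by auto
    then have "Green i u (partial j (d k))"
      using u smooth_partial[OF sm] unfolding vanishing_def by blast
    moreover have "partial i (partial j (d k)) = partial j (partial i (d k))"
      using sin_multiples_csmooth[OF d(1)] unfolding csmooth_def by blast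
    ultimately have "(LINT x|cube_measure. weak_partial cube j u x * partial i (d k) x)
        = (LINT x|cube_measure. weak_partial cube i u x * partial j (d k) x)"
      by (simp add: Green_def)
    then show ?thesis
      using integral_weak_partial_smooth[OF sm weak_partial(1)[OF uH, of j], of i]
        integral_weak_partial_smooth[OF sm weak_partial(1)[OF uH, of i], of j] by (simp add: mult.commute)
  qed
  have "(\<lambda>k. LINT x|cube_measure. weak_partial cube i (d k) x * weak_partial cube j u x)
      \<longlonglongrightarrow> (LINT x|cube_measure. weak_partial cube i v x * weak_partial cube j u x)"
    by (rule tendsto_L2_mult[OF weak_partial(1)[OF dH] weak_partial(1)[OF vH] weak_partial(1)[OF uH] jet_norm_tendsto_L2(2)[OF dH vH d(2)]])
  moreover have "(\<lambda>k. LINT x|cube_measure. weak_partial cube j (d k) x * weak_partial cube i u x)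
      \<longlonglongrightarrow> (LINT x|cube_measure. weak_partial cube j v x * weak_partial cube i u x)"
    by (rule tendsto_L2_mult[OF weak_partial(1)[OF dH] weak_partial(1)[OF vH] weak_partial(1)[OF uH] jet_norm_tendsto_L2(2)[OF dH vH d(2)]])
  ultimately have "(LINT x|cube_measure. weak_partial cube i v x * weak_partial cube j u x)
      = (LINT x|cube_measure. weak_partial cube j v x * weak_partial cube i u x)"
    unfolding eq by (rule LIMSEQ_unique)
  then show ?thesis by (simp add: mult.commute)
qed

section \<open>Vector fields with vanishing tangential trace\<close>

lemma H1_fields_component: "w \<in> H1_fields \<Omega> \<Longrightarrow> (\<lambda>x. w x $ i) \<in> H1 \<Omega>"
  by (simp add: H1_fields_def)

lemma H1_fields_L2:
  assumes "w \<in> H1_fields \<Omega>"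
  shows "w \<in> L2 (lebesgue_on \<Omega>)"
proof -
  have "(\<lambda>x. \<chi> i. w x $ i) \<in> L2 (lebesgue_on \<Omega>)"
    by (intro L2_vec H1_L2 H1_fields_component assms)
  then show ?thesis by simp
qed

lemma weak_jacobian_L2: "w \<in> H1_fields \<Omega> \<Longrightarrow> weak_jacobian \<Omega> w \<in> L2 (lebesgue_on \<Omega>)"
  unfolding weak_jacobian_def[abs_def] by (intro L2_vec weak_partial H1_fields_component)

lemma H1_fields_add: "u \<in> H1_fields cube \<Longrightarrow> v \<in> H1_fields cube \<Longrightarrow> (\<lambda>x. u x + v x) \<in> H1_fields cube"
  by (simp add: H1_fields_def H1_add)

lemma H1_fields_scale:
  assumes "u \<in> H1_fields cube"
  shows "(\<lambda>x. a *\<^sub>R u x) \<in> H1_fields cube"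
  using H1_scale[OF H1_fields_component[OF assms], of a] by (simp add: H1_fields_def)

lemma weak_jacobian_add:
  assumes "u \<in> H1_fields cube" "v \<in> H1_fields cube"
  shows "AE x in cube_measure. weak_jacobian cube (\<lambda>x. u x + v x) x = weak_jacobian cube u x + weak_jacobian cube v x"
proof -
  have "AE x in cube_measure. \<forall>i\<in>UNIV. \<forall>j\<in>UNIV. weak_partial cube j (\<lambda>x. u x $ i + v x $ i) x
      = weak_partial cube j (\<lambda>x. u x $ i) x + weak_partial cube j (\<lambda>x. v x $ i) x"
    by (intro AE_finite_allI finite weak_partial_add H1_fields_component assms)
  then show ?thesis by eventually_elim (simp add: weak_jacobian_def vec_eq_iff)
qed

lemma weak_jacobian_scale:
  assumes "u \<in> H1_fields cube"
  shows "AE x in cube_measure. weak_jacobian cube (\<lambda>x. a *\<^sub>R u x) x = a *\<^sub>R weak_jacobian cube u x"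
proof -
  have "AE x in cube_measure. \<forall>i\<in>UNIV. \<forall>j\<in>UNIV. weak_partial cube j (\<lambda>x. a *\<^sub>R (u x $ i)) x
      = a *\<^sub>R weak_partial cube j (\<lambda>x. u x $ i) x"
    by (intro AE_finite_allI finite weak_partial_scale H1_fields_component assms)
  then show ?thesis by eventually_elim (simp add: weak_jacobian_def vec_eq_iff)
qed

lemma H1t_H1_fields: "w \<in> H1t \<Longrightarrow> w \<in> H1_fields cube"
  by (simp add: H1t_def)

lemma H1t_component: "w \<in> H1t \<Longrightarrow> (\<lambda>x. w x $ i) \<in> H1 cube"
  by (rule H1_fields_component[OF H1t_H1_fields])

lemma H1t_vanishing: "w \<in> H1t \<Longrightarrow> i \<noteq> j \<Longrightarrow> (\<lambda>x. w x $ i) \<in> vanishing j"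
  by (rule zero_trace_vanishing[OF H1t_component]) (auto simp: H1t_def)

lemma H1t_add:
  assumes "u \<in> H1t" "v \<in> H1t"
  shows "(\<lambda>x. u x + v x) \<in> H1t"
  using assms has_trace_add[OF H1t_component[OF assms(1)] _ H1t_component[OF assms(2)]]
  by (simp add: H1t_def H1_fields_add)

lemma H1t_scale:
  assumes "u \<in> H1t"
  shows "(\<lambda>x. a *\<^sub>R u x) \<in> H1t"
  using assms has_trace_scale[OF H1t_component[OF assms], of _ _ _ a] H1_fields_scale[of u a]
  by (simp add: H1t_def)

lemma H1t_zero: "(\<lambda>_. 0) \<in> (H1t :: (real^'n::finite \<Rightarrow> real^'n) set)"
proof -
  have H: "(\<lambda>_. 0) \<in> H1 (cube :: (real^'n) set)" by (rule smooth_H1[OF smooth_const])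
  have "has_trace j c (\<lambda>_. 0) (\<lambda>_. 0)" for j :: 'n and c
    by (rule has_traceI[where \<phi> = "\<lambda>_ _. 0"])
       (use H jet_norm_AE_zero[OF H] in \<open>auto simp: smooth_const L2_norm_def\<close>)
  then show ?thesis using H by (simp add: H1t_def H1_fields_def)
qed

section \<open>The semi-inner product of Jacobians\<close>

definition D_inner :: "(real^'n::finite \<Rightarrow> real^'n) \<Rightarrow> (real^'n \<Rightarrow> real^'n) \<Rightarrow> real" where
  "D_inner u v = L2_inner cube_measure (weak_jacobian cube u) (weak_jacobian cube v)"

definition D_norm :: "(real^'n::finite \<Rightarrow> real^'n) \<Rightarrow> real" where
  "D_norm u = L2_norm cube_measure (weak_jacobian cube u)"

text \<open>Stated for any subspace, since the same form serves on \<open>H1t\<close> and on the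
  discrete space.\<close>

lemma semi_inner_space_D:
  assumes sub: "P \<subseteq> H1t" and zero: "(\<lambda>_. 0) \<in> P"
    and add: "\<And>u v. u \<in> P \<Longrightarrow> v \<in> P \<Longrightarrow> (\<lambda>x. u x + v x) \<in> P"
    and scale: "\<And>u a. u \<in> P \<Longrightarrow> (\<lambda>x. a *\<^sub>R u x) \<in> P"
  shows "semi_inner_space P D_inner"
proof
  note H = H1t_H1_fields[OF subsetD[OF sub]]
  note J = weak_jacobian_L2[OF H]
  fix u v w :: "real^'a \<Rightarrow> real^'a" and a :: real
  assume u: "u \<in> P"
  show "0 \<le> D_inner u u" unfolding D_inner_def by (rule L2.nonneg[OF J[OF u]])
  assume v: "v \<in> P"
  show "D_inner u v = D_inner v u" unfolding D_inner_def by (rule L2.sym[OF J[OF u] J[OF v]])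
  assume w: "w \<in> P"
  show "D_inner (\<lambda>x. u x + v x) w = D_inner u w + D_inner v w"
    unfolding D_inner_def L2.ip_add[OF J[OF u] J[OF v] J[OF w], symmetric]
    by (rule L2_inner_AE_cong[OF J[OF add[OF u v]] L2.add[OF J[OF u] J[OF v]] J[OF w] J[OF w]
          weak_jacobian_add[OF H[OF u] H[OF v]] AE_I2]) (rule refl)
next
  note H = H1t_H1_fields[OF subsetD[OF sub]]
  note J = weak_jacobian_L2[OF H]
  fix u w :: "real^'a \<Rightarrow> real^'a" and a :: real
  assume u: "u \<in> P" and w: "w \<in> P"
  show "D_inner (\<lambda>x. a *\<^sub>R u x) w = a * D_inner u w"
    unfolding D_inner_def L2.ip_scale[OF J[OF u] J[OF w], symmetric]
    by (rule L2_inner_AE_cong[OF J[OF scale[OF u]] L2.scale[OF J[OF u]] J[OF w] J[OF w]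
          weak_jacobian_scale[OF H[OF u]] AE_I2]) (rule refl)
qed (use assms in auto)

lemma sn_D_inner:
  fixes P :: "(real^'n::finite \<Rightarrow> real^'n) set"
  assumes "semi_inner_space P D_inner"
  shows "semi_inner_space.sn (D_inner :: (real^'n \<Rightarrow> real^'n) \<Rightarrow> _) = D_norm"
  by (auto simp: semi_inner_space.sn_def[OF assms] D_norm_def D_inner_def
       L2_norm_def L2_inner_def power2_norm_eq_inner)

lemma semi_inner_space_H1t: "semi_inner_space H1t D_inner"
  by (rule semi_inner_space_D[OF subset_refl H1t_zero H1t_add H1t_scale])

interpretation H1t: semi_inner_space H1t D_inner
  rewrites "semi_inner_space.sn D_inner = D_norm"
  by (rule semi_inner_space_H1t) (rule sn_D_inner[OF semi_inner_space_H1t])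

lemma D_norm_square: "w \<in> H1t \<Longrightarrow> (D_norm w)\<^sup>2 = D_inner w w"
  by (rule H1t.sn_square)

lemma D_norm_nonneg [simp]: "0 \<le> D_norm w"
  by (simp add: D_norm_def)

lemma L2_norm_vec_square:
  fixes f :: "'a \<Rightarrow> 'b::euclidean_space^'n::finite"
  assumes "f \<in> L2 M"
  shows "(L2_norm M f)\<^sup>2 = (\<Sum>i\<in>UNIV. (L2_norm M (\<lambda>x. f x $ i))\<^sup>2)"
  unfolding L2_norm_square norm_vec_square
  by (rule Bochner_Integration.integral_sum) (rule L2_integrable[OF L2_vec_nth[OF assms]])

lemma D_norm_square_sum:
  assumes "w \<in> H1_fields cube"
  shows "(D_norm w)\<^sup>2 = (\<Sum>i\<in>UNIV. \<Sum>j\<in>UNIV. (L2_norm cube_measure (weak_partial cube j (\<lambda>x. w x $ i)))\<^sup>2)"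
proof -
  have "(D_norm w)\<^sup>2 = (\<Sum>i\<in>UNIV. (L2_norm cube_measure (\<lambda>x. weak_jacobian cube w x $ i))\<^sup>2)"
    unfolding D_norm_def by (rule L2_norm_vec_square[OF weak_jacobian_L2[OF assms]])
  also have "\<dots> = (\<Sum>i\<in>UNIV. \<Sum>j\<in>UNIV. (L2_norm cube_measure (\<lambda>x. weak_jacobian cube w x $ i $ j))\<^sup>2)"
    by (rule sum.cong[OF refl], rule L2_norm_vec_square[OF L2_vec_nth[OF weak_jacobian_L2[OF assms]]])
  finally show ?thesis by (simp add: weak_jacobian_def)
qed

lemma jet_norm_square:
  assumes "u \<in> H1 cube"
  shows "(jet_norm u)\<^sup>2 = (L2_norm cube_measure u)\<^sup>2 + (\<Sum>j\<in>UNIV. (L2_norm cube_measure (weak_partial cube j u))\<^sup>2)"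
  unfolding H1_norm_jet[OF assms, symmetric] H1_norm_def by (simp add: add_nonneg_nonneg sum_nonneg)

lemma H1_field_norm_square:
  assumes "w \<in> H1_fields cube"
  shows "(H1_field_norm cube w)\<^sup>2 = (L2_norm cube_measure w)\<^sup>2 + (D_norm w)\<^sup>2"
    and "(H1_field_norm cube w)\<^sup>2 = (\<Sum>i\<in>UNIV. (jet_norm (\<lambda>x. w x $ i))\<^sup>2)"
proof -
  show 1: "(H1_field_norm cube w)\<^sup>2 = (L2_norm cube_measure w)\<^sup>2 + (D_norm w)\<^sup>2"
    by (simp add: H1_field_norm_def D_norm_def)
  show "(H1_field_norm cube w)\<^sup>2 = (\<Sum>i\<in>UNIV. (jet_norm (\<lambda>x. w x $ i))\<^sup>2)"
    unfolding 1 D_norm_square_sum[OF assms] L2_norm_vec_square[OF H1_fields_L2[OF assms]]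
    by (simp add: jet_norm_square[OF H1_fields_component[OF assms]] sum.distrib)
qed

lemma H1_field_norm_nonneg [simp]: "0 \<le> H1_field_norm cube w"
  by (simp add: H1_field_norm_def)

text \<open>In two and more dimensions every component vanishes on some pair of opposite faces.\<close>

lemma H1t_Poincare:
  fixes w :: "real^'n::finite \<Rightarrow> real^'n"
  assumes w: "w \<in> H1t" and n: "2 \<le> CARD('n)"
  shows "pi * L2_norm cube_measure w \<le> D_norm w"
proof (rule power2_le_imp_le)
  have comp: "pi\<^sup>2 * (L2_norm cube_measure (\<lambda>x. w x $ i))\<^sup>2
      \<le> (\<Sum>j\<in>UNIV. (L2_norm cube_measure (weak_partial cube j (\<lambda>x. w x $ i)))\<^sup>2)" for i
  proof -
    have "\<exists>j. i \<noteq> j"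
    proof (rule ccontr)
      assume "\<nexists>j. i \<noteq> j"
      then have "(UNIV :: 'n set) = {i}" by auto
      from arg_cong[OF this, of card] n show False by simp
    qed
    then obtain j where j: "i \<noteq> j" by blast
    have "(pi * L2_norm cube_measure (\<lambda>x. w x $ i))\<^sup>2 \<le> (L2_norm cube_measure (weak_partial cube j (\<lambda>x. w x $ i)))\<^sup>2"
      by (intro power_mono Poincare H1t_vanishing[OF w j]) auto
    also have "\<dots> \<le> (\<Sum>j\<in>UNIV. (L2_norm cube_measure (weak_partial cube j (\<lambda>x. w x $ i)))\<^sup>2)"
      by (rule member_le_sum) auto
    finally show ?thesis by (simp add: power_mult_distrib)
  qed
  show "(pi * L2_norm cube_measure w)\<^sup>2 \<le> (D_norm w)\<^sup>2"
    unfolding power_mult_distrib D_norm_square_sum[OF H1t_H1_fields[OF w]]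
      L2_norm_vec_square[OF H1_fields_L2[OF H1t_H1_fields[OF w]]] sum_distrib_left
    by (rule sum_mono) (rule comp)
qed simp

section \<open>The div-rot identity\<close>

lemma trace_eq_inner: "trace M = M \<bullet> (mat 1 :: real^'n::finite^'n)"
  by (simp add: trace_def inner_vec_def mat_def if_distrib[of "\<lambda>x. _ * x"] cong: if_cong)

lemma inner_matrix: "(M :: real^'n::finite^'m::finite) \<bullet> N = (\<Sum>i\<in>UNIV. \<Sum>j\<in>UNIV. M $ i $ j * N $ i $ j)"
  by (simp add: inner_vec_def)

lemma divergence_eq_trace: "divergence cube w x = trace (weak_jacobian cube w x)"
  by (simp add: divergence_def trace_def weak_jacobian_def)

lemma divergence_L2:
  assumes "w \<in> H1_fields cube"
  shows "divergence cube w \<in> L2 cube_measure"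
proof -
  have "(\<lambda>x. (mat 1 :: real^'a^'a) \<bullet> weak_jacobian cube w x) \<in> L2 cube_measure"
    by (rule L2_inner_bounded[OF weak_jacobian_L2[OF assms], of _ "norm (mat 1 :: real^'a^'a)"]) auto
  then show ?thesis by (simp add: divergence_eq_trace[abs_def] trace_eq_inner inner_commute)
qed

text \<open>Off the diagonal, component \<open>i\<close> of \<open>u\<close> has zero trace in
  direction \<open>j\<close> and component \<open>j\<close> of \<open>w\<close> in direction
  \<open>i\<close>; \<open>integral_swap_partials\<close> then exchanges the mixed derivatives for
  diagonal ones.\<close>

lemma integral_jacobian_transpose:
  assumes u: "u \<in> H1t" and w: "w \<in> H1t"
  shows "(LINT x|cube_measure. weak_jacobian cube u x \<bullet> transpose (weak_jacobian cube w x))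
       = L2_inner cube_measure (divergence cube u) (divergence cube w)"
proof -
  let ?U = "\<lambda>i j x. weak_partial cube j (\<lambda>x. u x $ i) x" and ?W = "\<lambda>i j x. weak_partial cube j (\<lambda>x. w x $ i) x"
  have int: "integrable cube_measure (\<lambda>x. ?U i j x * ?W k l x)" for i j k l
    by (rule integrable_mult_L2[OF weak_partial(1)[OF H1t_component[OF u]] weak_partial(1)[OF H1t_component[OF w]]])
  have "(LINT x|cube_measure. weak_jacobian cube u x \<bullet> transpose (weak_jacobian cube w x))
      = (LINT x|cube_measure. (\<Sum>i\<in>UNIV. \<Sum>j\<in>UNIV. ?U i j x * ?W j i x))"
    by (simp add: inner_matrix weak_jacobian_def transpose_def)
  also have "\<dots> = (\<Sum>i\<in>UNIV. \<Sum>j\<in>UNIV. LINT x|cube_measure. ?U i j x * ?W j i x)"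
    using int by simp
  also have "\<dots> = (\<Sum>i\<in>UNIV. \<Sum>j\<in>UNIV. LINT x|cube_measure. ?U i i x * ?W j j x)"
  proof (intro sum.cong refl)
    fix i j
    show "(LINT x|cube_measure. ?U i j x * ?W j i x) = (LINT x|cube_measure. ?U i i x * ?W j j x)"
    proof (cases "i = j")
      case False
      then show ?thesis
        using integral_swap_partials[OF H1t_vanishing[OF u, of i j] H1t_vanishing[OF w, of j i]] by auto
    qed simp
  qed
  also have "\<dots> = (LINT x|cube_measure. (\<Sum>i\<in>UNIV. \<Sum>j\<in>UNIV. ?U i i x * ?W j j x))"
    using int by simp
  also have "\<dots> = L2_inner cube_measure (divergence cube u) (divergence cube w)"
    by (simp add: L2_inner_def divergence_def sum_product)
  finally show ?thesis .
qed

text \<open>\<open>R\<close> abstracts the rotation read off the Jacobian. Integrating its identity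
  leaves the product with the transposed Jacobian, which \<open>integral_jacobian_transpose\<close>
  identifies with the divergence term.\<close>

lemma D_inner_eq_div_rot:
  fixes R :: "real^'n::finite^'n \<Rightarrow> 'r::euclidean_space"
  assumes R: "\<And>M N. R M \<bullet> R N = M \<bullet> N - M \<bullet> transpose N"
    and u: "u \<in> H1t" and w: "w \<in> H1t"
  shows "D_inner u w = L2_inner cube_measure (divergence cube u) (divergence cube w)
    + L2_inner cube_measure (\<lambda>x. R (weak_jacobian cube u x)) (\<lambda>x. R (weak_jacobian cube w x))"
proof -
  note J = weak_jacobian_L2[OF H1t_H1_fields]
  have "(\<lambda>x. \<chi> i. \<chi> j. weak_jacobian cube w x $ j $ i) \<in> L2 cube_measure"
    by (intro L2_vec L2_vec_nth J w)
  then have T: "(\<lambda>x. transpose (weak_jacobian cube w x)) \<in> L2 cube_measure"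
    by (simp add: transpose_def)
  have "L2_inner cube_measure (\<lambda>x. R (weak_jacobian cube u x)) (\<lambda>x. R (weak_jacobian cube w x))
      = D_inner u w - (LINT x|cube_measure. weak_jacobian cube u x \<bullet> transpose (weak_jacobian cube w x))"
    unfolding L2_inner_def D_inner_def R
    by (rule Bochner_Integration.integral_diff[OF L2_integrable_inner[OF J[OF u] J[OF w]] L2_integrable_inner[OF J[OF u] T]])
  then show ?thesis by (simp add: integral_jacobian_transpose[OF u w])
qed

text \<open>By the Poincare inequality a \<open>D_norm\<close> Cauchy sequence has \<open>H1\<close>
  Cauchy components. Zero traces survive the limit, so it lies in \<open>H1t\<close>, and closedness
  of \<open>P\<close> in the full \<open>H1\<close> norm puts it in \<open>P\<close>.\<close>

lemma complete_semi_inner_space_D: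
  fixes P :: "(real^'n::finite \<Rightarrow> real^'n) set"
  assumes P: "closed_subspace P" and n: "2 \<le> CARD('n)"
  shows "complete_semi_inner_space P D_inner"
proof -
  have sub: "P \<subseteq> H1t" and PD: "semi_inner_space P D_inner"
    using P unfolding closed_subspace_def by (auto intro!: semi_inner_space_D)
  interpret P: semi_inner_space P D_inner by (rule PD)
  have sn: "P.sn = D_norm" by (rule sn_D_inner[OF PD])
  show ?thesis
  proof
    fix s :: "nat \<Rightarrow> real^'n \<Rightarrow> real^'n"
    assume sP: "\<And>k. s k \<in> P" and C: "P.Cauchy_in s"
    have sH: "s k \<in> H1t" for k using sP sub by auto
    \<comment> \<open>As \<open>pi > 1\<close>, the Poincare inequality bounds the \<open>L2\<close>
      norm by \<open>D_norm\<close>, so the square of the left side is at most twice that of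
      \<open>D_norm w\<close>; 2 is a convenient constant above the square root.\<close>
    have jet_le: "jet_norm (\<lambda>x. w x $ i) \<le> 2 * D_norm w" if w: "w \<in> H1t" for w and i :: 'n
    proof (rule power2_le_imp_le)
      have "(jet_norm (\<lambda>x. w x $ i))\<^sup>2 \<le> (\<Sum>i\<in>UNIV. (jet_norm (\<lambda>x. w x $ i))\<^sup>2)"
        by (rule member_le_sum) auto
      also have "\<dots> = (L2_norm cube_measure w)\<^sup>2 + (D_norm w)\<^sup>2"
        using H1_field_norm_square[OF H1t_H1_fields[OF w]] by simp
      also have "\<dots> \<le> (D_norm w)\<^sup>2 + (D_norm w)\<^sup>2"
      proof -
        have "1 * L2_norm cube_measure w \<le> pi * L2_norm cube_measure w"
          using pi_gt3 by (intro mult_right_mono) auto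
        also have "\<dots> \<le> D_norm w" by (rule H1t_Poincare[OF w n])
        finally show ?thesis by (simp add: power_mono)
      qed
      also have "\<dots> \<le> (2 * D_norm w)\<^sup>2" by (simp add: power_mult_distrib)
      finally show "(jet_norm (\<lambda>x. w x $ i))\<^sup>2 \<le> (2 * D_norm w)\<^sup>2" .
    qed simp
    have "\<exists>u. u \<in> H1 cube \<and> (\<lambda>k. jet_norm (\<lambda>x. s k x $ i - u x)) \<longlonglongrightarrow> 0" for i
    proof -
      have "H1.Cauchy_in (\<lambda>k x. s k x $ i)"
        unfolding H1.Cauchy_in_def
      proof (intro allI impI)
        fix e :: real assume "e > 0"
        then obtain N where N: "\<forall>m\<ge>N. \<forall>n\<ge>N. D_norm (\<lambda>x. s m x - s n x) < e / 2"
          using C[unfolded P.Cauchy_in_def sn, rule_format, of "e / 2"] by auto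
        have "jet_norm (\<lambda>x. s m x $ i - s n x $ i) < e" if "m \<ge> N" "n \<ge> N" for m n
          using jet_le[OF H1t.diff[OF sH sH], of m n i] N that by fastforce
        then show "\<exists>N. \<forall>m\<ge>N. \<forall>n\<ge>N. jet_norm (\<lambda>x. s m x $ i - s n x $ i) < e" by blast
      qed
      then obtain u where "u \<in> H1 cube" "(\<lambda>k. jet_norm (\<lambda>x. s k x $ i - u x)) \<longlonglongrightarrow> 0"
        by (rule H1_complete[OF H1t_component[OF sH]])
      then show ?thesis by blast
    qed
    then have "\<exists>U. \<forall>i. U i \<in> H1 cube \<and> (\<lambda>k. jet_norm (\<lambda>x. s k x $ i - U i x)) \<longlonglongrightarrow> 0"
      by (intro choice allI)
    then obtain U where U: "\<And>i. U i \<in> H1 cube" "\<And>i. (\<lambda>k. jet_norm (\<lambda>x. s k x $ i - U i x)) \<longlonglongrightarrow> 0"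
      by blast
    define u :: "real^'n \<Rightarrow> real^'n" where "u x = (\<chi> i. U i x)" for x
    have uF: "u \<in> H1_fields cube" using U(1) by (simp add: H1_fields_def u_def)
    have "has_trace j c (U i) (\<lambda>_. 0)" if "i \<noteq> j" "c \<in> {0, 1}" for i j c
      by (rule has_trace_limit[OF H1t_component[OF sH] _ U]) (use sH that in \<open>auto simp: H1t_def\<close>)
    then have uH: "u \<in> H1t" using uF by (simp add: H1t_def u_def)
    have diffF: "(\<lambda>x. s k x - u x) \<in> H1_fields cube" for k
      by (rule H1t_H1_fields[OF H1t.diff[OF sH uH]])
    have "(\<lambda>k. \<Sum>i\<in>UNIV. (jet_norm (\<lambda>x. s k x $ i - U i x))\<^sup>2) \<longlonglongrightarrow> (\<Sum>i\<in>(UNIV::'n set). 0\<^sup>2)"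
      by (intro tendsto_sum tendsto_power U(2))
    moreover have "(\<Sum>i\<in>UNIV. (jet_norm (\<lambda>x. s k x $ i - U i x))\<^sup>2) = (H1_field_norm cube (\<lambda>x. s k x - u x))\<^sup>2" for k
      using H1_field_norm_square(2)[OF diffF[of k]] by (simp add: u_def)
    ultimately have "(\<lambda>k. (H1_field_norm cube (\<lambda>x. s k x - u x))\<^sup>2) \<longlonglongrightarrow> 0" by simp
    then have "(\<lambda>k. sqrt ((H1_field_norm cube (\<lambda>x. s k x - u x))\<^sup>2)) \<longlonglongrightarrow> sqrt 0"
      by (rule tendsto_real_sqrt)
    then have lim: "(\<lambda>k. H1_field_norm cube (\<lambda>x. s k x - u x)) \<longlonglongrightarrow> 0" by simp
    then have "u \<in> P" using P uH sP unfolding closed_subspace_def by blast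
    moreover have "\<bar>D_norm (\<lambda>x. s k x - u x)\<bar> \<le> H1_field_norm cube (\<lambda>x. s k x - u x)" for k
      by (rule power2_le_imp_le) (use H1_field_norm_square(1)[OF diffF[of k]] in auto)
    then have "(\<lambda>k. D_norm (\<lambda>x. s k x - u x)) \<longlonglongrightarrow> 0" by (rule null_comparison[OF _ lim])
    ultimately show "\<exists>u\<in>P. (\<lambda>k. P.sn (\<lambda>x. s k x - u x)) \<longlonglongrightarrow> 0"
      unfolding sn by blast
  qed
qed

text \<open>Makes the full problem an instance of the discrete one, so that one existence and
  uniqueness proof covers both.\<close>

lemma closed_subspace_H1t: "closed_subspace H1t"
  unfolding closed_subspace_def using H1t_zero H1t_add H1t_scale by auto

section \<open>The Cordes condition\<close>

lemma Linf_norm_eq_0: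
  assumes "b \<in> borel_measurable M" "Linf_norm M b = 0"
  shows "AE x in M. b x = 0"
proof -
  have "AE x in M. ereal (norm (b x)) \<le> Linf_norm M b"
    unfolding Linf_norm_def by (rule esssup_AE)
  then show ?thesis unfolding assms(2) by eventually_elim simp
qed

text \<open>Testing with unit vectors bounds every diagonal entry below by \<open>l\<close>.\<close>

lemma form_le_trace_pos:
  fixes M :: "real^'n::finite^'n"
  assumes "form_le (l *\<^sub>R mat 1) M" "l > 0"
  shows "trace M > 0"
proof -
  have "l \<le> M $ i $ i" for i
    using assms(1)[unfolded form_le_def, rule_format, of "axis i 1"]
    by (simp add: inner_axis' matrix_vector_mult_basis column_def mat_def)
  then have "0 < M $ i $ i" for i using assms(2) less_le_trans by blast
  then show ?thesis unfolding trace_def by (intro sum_pos) auto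
qed

text \<open>The left-hand side equals \<open>n - (tr A)\<^sup>2 / (|A|\<^sup>2 + |b|\<^sup>2)\<close>.\<close>

lemma Cordes_distance:
  fixes M :: "real^'n::finite^'n" and v :: "real^'n"
  assumes tr: "trace M > 0" and c: "real CARD('n) - 1 + \<delta> > 0"
    and Cordes: "((norm M)\<^sup>2 + (norm v)\<^sup>2) / (trace M)\<^sup>2 \<le> 1 / (real CARD('n) - 1 + \<delta>)"
  defines "\<gamma> \<equiv> trace M / ((norm M)\<^sup>2 + (norm v)\<^sup>2)"
  shows "(norm (\<gamma> *\<^sub>R M - mat 1))\<^sup>2 + (norm (\<gamma> *\<^sub>R v))\<^sup>2 \<le> 1 - \<delta>"
proof -
  define S where "S = (norm M)\<^sup>2 + (norm v)\<^sup>2"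
  define T where "T = trace M"
  have "M \<noteq> 0" using tr by (auto simp: trace_def)
  then have S: "S > 0" unfolding S_def by (intro add_pos_nonneg) auto
  have "S * (real CARD('n) - 1 + \<delta>) \<le> T\<^sup>2"
    using Cordes c tr unfolding S_def[symmetric] T_def[symmetric] by (simp add: field_simps)
  then have le: "real CARD('n) - 1 + \<delta> \<le> T\<^sup>2 / S" using S by (simp add: field_simps)
  have n: "(norm (mat 1 :: real^'n^'n))\<^sup>2 = real CARD('n)"
    by (simp add: power2_norm_eq_inner inner_matrix mat_def if_distrib[of "\<lambda>x. _ * x"] cong: if_cong)
  have "(norm (\<gamma> *\<^sub>R M - mat 1))\<^sup>2 + (norm (\<gamma> *\<^sub>R v))\<^sup>2 = \<gamma>\<^sup>2 * S - 2 * \<gamma> * T + real CARD('n)"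
    unfolding S_def T_def n[symmetric] trace_eq_inner power2_norm_eq_inner
    by (simp add: inner_diff_left inner_diff_right inner_commute algebra_simps power2_eq_square)
  also have "\<dots> = real CARD('n) - T\<^sup>2 / S"
    using S unfolding \<gamma>_def S_def[symmetric] T_def[symmetric] by (simp add: field_simps power2_eq_square)
  finally show ?thesis using le by simp
qed

text \<open>\<open>R\<close> and \<open>rot\<close> are parameters so that both dimensions share one
  proof: the rotation is a scalar in the plane and a vector in space, and it enters through the
  identity assumed of \<open>R\<close>.\<close>

locale Cordes_problem =
  fixes A :: "real^'n::finite \<Rightarrow> real^'n^'n" and b :: "real^'n \<Rightarrow> real^'n" and \<delta> :: real
    and R :: "real^'n^'n \<Rightarrow> 'r::euclidean_space" and rot :: "(real^'n \<Rightarrow> real^'n) \<Rightarrow> real^'n \<Rightarrow> 'r"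
  assumes n2: "2 \<le> CARD('n)"
    and A: "A \<in> Linf cube_measure" and ell: "uniformly_elliptic A" and b: "b \<in> Linf cube_measure"
    and \<delta>: "delta0 b < \<delta>" "\<delta> \<le> 1"
    and Cordes: "AE x in cube_measure.
         ((norm (A x))\<^sup>2 + (norm (b x))\<^sup>2) / (trace (A x))\<^sup>2 \<le> 1 / (real CARD('n) - 1 + \<delta>)"
    and R: "\<And>M N. R M \<bullet> R N = M \<bullet> N - M \<bullet> transpose N"
    and rot: "\<And>w x. rot w x = R (weak_jacobian cube w x)"
begin

text \<open>Wherever \<open>A x\<close> is nonzero, \<open>gam A b x\<close> is the factor s that
  minimizes |s A - I|^2 + |s b|^2; \<open>G\<close> and \<open>g\<close> are the residuals at the
  minimum.\<close>

definition G :: "real^'n \<Rightarrow> real^'n^'n" where "G x = gam A b x *\<^sub>R A x - mat 1"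

definition g :: "real^'n \<Rightarrow> real^'n" where "g x = gam A b x *\<^sub>R b x"

text \<open>The Poincare constant enters the contraction factor only when there is a lower-order term.\<close>

definition t :: real where "t = (if Linf_norm cube_measure b \<noteq> 0 then 1 else 0)"

text \<open>\<open>1 - \<delta>\<close> bounds the residual coefficients, and
  \<open>1 + t / pi\<^sup>2\<close> is the price of estimating \<open>w\<close> by its Jacobian. For
  \<open>\<delta> \<le> 1\<close> the result is below one exactly when
  \<open>\<delta> > delta0 b\<close>.\<close>

definition \<kappa> :: real where "\<kappa> = sqrt ((1 - \<delta>) * (1 + t / pi\<^sup>2))"

text \<open>The deviation of the scaled operator from the divergence: \<open>gam A b x * Ltilde A b
  w x = - divergence cube w x - pert w x\<close>.\<close>

definition pert :: "(real^'n \<Rightarrow> real^'n) \<Rightarrow> real^'n \<Rightarrow> real" where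
  "pert w x = G x \<bullet> weak_jacobian cube w x + g x \<bullet> w x"

text \<open>The bilinear form of the problem is \<open>D_inner + E\<close>.\<close>

definition E :: "(real^'n \<Rightarrow> real^'n) \<Rightarrow> (real^'n \<Rightarrow> real^'n) \<Rightarrow> real" where
  "E u w = L2_inner cube_measure (divergence cube u) (pert w)"

lemma measurable_coefficients [measurable]:
  "A \<in> borel_measurable cube_measure" "b \<in> borel_measurable cube_measure"
  using A b by (auto simp: Linf_def)

lemma measurable_gam [measurable]: "gam A b \<in> borel_measurable cube_measure"
  unfolding gam_def[abs_def] trace_eq_inner by measurable

lemma measurable_G_g: "G \<in> borel_measurable cube_measure" "g \<in> borel_measurable cube_measure"
  unfolding G_def[abs_def] g_def[abs_def] by measurable

lemma t_cases: "t = 0 \<or> t = 1"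
  by (simp add: t_def)

lemma \<delta>_pos: "0 < \<delta>"
  using \<delta>(1) unfolding delta0_def by (auto split: if_splits simp: add_pos_nonneg intro: less_trans[rotated])

lemma \<kappa>: "0 \<le> \<kappa>" "\<kappa> < 1" "\<kappa>\<^sup>2 = (1 - \<delta>) * (1 + t / pi\<^sup>2)"
proof -
  have nn: "0 \<le> (1 - \<delta>) * (1 + t / pi\<^sup>2)"
    using \<delta>(2) t_cases by (intro mult_nonneg_nonneg) auto
  then show "0 \<le> \<kappa>" "\<kappa>\<^sup>2 = (1 - \<delta>) * (1 + t / pi\<^sup>2)" by (auto simp: \<kappa>_def)
  have "(1 - \<delta>) * (1 + t / pi\<^sup>2) < 1"
  proof (cases "t = 0")
    case True
    then show ?thesis using \<delta>_pos by simp
  next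
    case False
    then have t: "t = 1" and "inverse (1 + pi\<^sup>2) < \<delta>"
      using \<delta>(1) by (auto simp: t_def delta0_def split: if_splits)
    have p: "0 < 1 + pi\<^sup>2" by (simp add: add_pos_nonneg)
    have "1 < \<delta> * (1 + pi\<^sup>2)"
      using \<open>inverse (1 + pi\<^sup>2) < \<delta>\<close> p by (simp add: field_simps)
    then have "(1 - \<delta>) * (pi\<^sup>2 + 1) < pi\<^sup>2" by (simp add: algebra_simps)
    then show ?thesis unfolding t by (simp add: field_simps)
  qed
  then show "\<kappa> < 1" unfolding \<kappa>_def by simp
qed

lemma coefficient_bound: "AE x in cube_measure. (norm (G x))\<^sup>2 + (norm (g x))\<^sup>2 \<le> 1 - \<delta>"
proof -
  obtain l where l: "l > 0" "AE x in cube_measure. form_le (l *\<^sub>R mat 1) (A x)"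
    using ell unfolding uniformly_elliptic_def by (auto elim: AE_mp intro: AE_I2)
  have c: "real CARD('n) - 1 + \<delta> > 0" using n2 \<delta>_pos by simp
  show ?thesis
    using l(2) Cordes
  proof eventually_elim
    case (elim x)
    from Cordes_distance[OF form_le_trace_pos[OF elim(1) l(1)] c elim(2)]
    show ?case unfolding G_def g_def gam_def .
  qed
qed

lemma g_zero: "t = 0 \<Longrightarrow> AE x in cube_measure. g x = 0"
proof -
  assume "t = 0"
  then have "AE x in cube_measure. b x = 0"
    by (intro Linf_norm_eq_0) (auto simp: t_def split: if_splits)
  then show ?thesis by eventually_elim (simp add: g_def)
qed

text \<open>Cauchy-Schwarz for the pairs \<open>(G, g)\<close> and \<open>(Dw, t w)\<close>.
  Inserting \<open>t\<close> is harmless, since \<open>g\<close> vanishes almost everywhere if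
  \<open>t = 0\<close>, and in that case it removes the zero-order term from the bound.\<close>

lemma pert_pointwise:
  "AE x in cube_measure. (pert w x)\<^sup>2 \<le> (1 - \<delta>) * ((norm (weak_jacobian cube w x))\<^sup>2 + t * (norm (w x))\<^sup>2)"
proof -
  have "AE x in cube_measure. t = 0 \<longrightarrow> g x = 0"
    using g_zero by (cases "t = 0") auto
  with coefficient_bound show ?thesis
  proof eventually_elim
    case (elim x)
    let ?J = "weak_jacobian cube w x"
    have "pert w x = (G x, g x) \<bullet> (?J, t *\<^sub>R w x)"
      using elim(2) t_cases by (auto simp: pert_def)
    then have "\<bar>pert w x\<bar> \<le> norm (G x, g x) * norm (?J, t *\<^sub>R w x)"
      using Cauchy_Schwarz_ineq2 by metis
    then have "\<bar>pert w x\<bar>\<^sup>2 \<le> (norm (G x, g x) * norm (?J, t *\<^sub>R w x))\<^sup>2"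
      by (intro power_mono) auto
    also have "\<dots> = ((norm (G x))\<^sup>2 + (norm (g x))\<^sup>2) * ((norm ?J)\<^sup>2 + t * (norm (w x))\<^sup>2)"
      using t_cases by (auto simp: norm_Pair power_mult_distrib add_nonneg_nonneg)
    also have "\<dots> \<le> (1 - \<delta>) * ((norm ?J)\<^sup>2 + t * (norm (w x))\<^sup>2)"
      using elim(1) t_cases by (intro mult_right_mono) auto
    finally show ?case by simp
  qed
qed

lemma pert_L2:
  assumes "w \<in> H1_fields cube"
  shows "pert w \<in> L2 cube_measure"
proof -
  have "AE x in cube_measure. norm (G x) \<le> 1 \<and> norm (g x) \<le> 1"
    using coefficient_bound
  proof eventually_elim
    case (elim x)
    then have "(norm (G x))\<^sup>2 \<le> 1\<^sup>2" "(norm (g x))\<^sup>2 \<le> 1\<^sup>2"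
      using \<delta>_pos zero_le_power2[of "norm (G x)"] zero_le_power2[of "norm (g x)"] by (simp_all, linarith+)
    then show ?case using power2_le_imp_le[of "norm (G x)" 1] power2_le_imp_le[of "norm (g x)" 1] by simp
  qed
  then have "AE x in cube_measure. norm (G x) \<le> 1" "AE x in cube_measure. norm (g x) \<le> 1" by auto
  then show ?thesis
    unfolding pert_def[abs_def]
    by (intro L2.add L2_inner_bounded[OF weak_jacobian_L2[OF assms] measurable_G_g(1)]
        L2_inner_bounded[OF H1_fields_L2[OF assms] measurable_G_g(2)])
qed

lemma pert_norm:
  assumes w: "w \<in> H1t"
  shows "L2_norm cube_measure (pert w) \<le> \<kappa> * D_norm w"
proof (rule power2_le_imp_le)
  note F = H1t_H1_fields[OF w]
  have i: "integrable cube_measure (\<lambda>x. (norm (weak_jacobian cube w x))\<^sup>2)" "integrable cube_measure (\<lambda>x. (norm (w x))\<^sup>2)"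
    by (rule L2_integrable[OF weak_jacobian_L2[OF F]], rule L2_integrable[OF H1_fields_L2[OF F]])
  have "(L2_norm cube_measure (pert w))\<^sup>2 = (LINT x|cube_measure. (pert w x)\<^sup>2)"
    by (simp add: L2_norm_square)
  also have "\<dots> \<le> (LINT x|cube_measure. (1 - \<delta>) * ((norm (weak_jacobian cube w x))\<^sup>2 + t * (norm (w x))\<^sup>2))"
    by (rule integral_mono_AE) (use L2_integrable[OF pert_L2[OF F]] i pert_pointwise in auto)
  also have "\<dots> = (1 - \<delta>) * ((D_norm w)\<^sup>2 + t * (L2_norm cube_measure w)\<^sup>2)"
    using i by (simp add: D_norm_def L2_norm_square)
  also have "\<dots> \<le> (1 - \<delta>) * ((D_norm w)\<^sup>2 + t * ((D_norm w)\<^sup>2 / pi\<^sup>2))"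
  proof -
    have "(pi * L2_norm cube_measure w)\<^sup>2 \<le> (D_norm w)\<^sup>2"
      by (intro power_mono H1t_Poincare w n2) auto
    then have "(L2_norm cube_measure w)\<^sup>2 \<le> (D_norm w)\<^sup>2 / pi\<^sup>2"
      by (simp add: power_mult_distrib field_simps)
    then show ?thesis using \<delta>(2) t_cases by (intro mult_left_mono add_left_mono) auto
  qed
  also have "\<dots> = (\<kappa> * D_norm w)\<^sup>2"
    unfolding power_mult_distrib \<kappa>(3) by (simp add: algebra_simps)
  finally show "(L2_norm cube_measure (pert w))\<^sup>2 \<le> (\<kappa> * D_norm w)\<^sup>2" .
qed (use \<kappa> in simp)

text \<open>Drops the rotation term of the div-rot identity. The constant one matters: the pointwise
  estimate of a trace would bring in the square root of the dimension, and
  \<open>\<kappa> < 1\<close> would no longer ensure a contraction.\<close>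

lemma divergence_norm:
  fixes u :: "real^'n \<Rightarrow> real^'n"
  assumes u: "u \<in> H1t"
  shows "L2_norm cube_measure (divergence cube u) \<le> D_norm u"
proof (rule power2_le_imp_le)
  have "0 \<le> L2_inner cube_measure (\<lambda>x. R (weak_jacobian cube u x)) (\<lambda>x. R (weak_jacobian cube u x))"
    unfolding L2_inner_def by simp
  then show "(L2_norm cube_measure (divergence cube u))\<^sup>2 \<le> (D_norm u)\<^sup>2"
    unfolding D_norm_square[OF u] D_inner_eq_div_rot[OF R u u] L2.sn_square[OF divergence_L2[OF H1t_H1_fields[OF u]]]
    by simp
qed simp

lemma E_bound:
  assumes "u \<in> H1t" "w \<in> H1t"
  shows "\<bar>E u w\<bar> \<le> \<kappa> * D_norm u * D_norm w"
proof -
  have "\<bar>E u w\<bar> \<le> L2_norm cube_measure (divergence cube u) * L2_norm cube_measure (pert w)"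
    unfolding E_def by (rule L2.Cauchy_Schwarz[OF divergence_L2 pert_L2]) (use assms H1t_H1_fields in auto)
  also have "\<dots> \<le> D_norm u * (\<kappa> * D_norm w)"
    using assms by (intro mult_mono divergence_norm pert_norm) auto
  finally show ?thesis by (simp add: mult_ac)
qed

lemma E_add_right:
  assumes "u \<in> H1t" "v \<in> H1t" "w \<in> H1t"
  shows "E u (\<lambda>x. v x + w x) = E u v + E u w"
proof -
  note F = assms[THEN H1t_H1_fields]
  show ?thesis
    unfolding E_def L2.ip_add_right[OF pert_L2[OF F(2)] pert_L2[OF F(3)] divergence_L2[OF F(1)], symmetric]
    by (rule L2_inner_AE_cong[OF divergence_L2[OF F(1)] divergence_L2[OF F(1)] pert_L2[OF H1_fields_add[OF F(2,3)]]
          L2.add[OF pert_L2[OF F(2)] pert_L2[OF F(3)]]])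
       (use weak_jacobian_add[OF F(2,3)] in \<open>auto simp: pert_def inner_add_right elim: eventually_mono\<close>)
qed

lemma E_scale_right:
  assumes "u \<in> H1t" "w \<in> H1t"
  shows "E u (\<lambda>x. a *\<^sub>R w x) = a * E u w"
proof -
  note F = assms[THEN H1t_H1_fields]
  show ?thesis
    unfolding E_def L2.ip_scale_right[OF pert_L2[OF F(2)] divergence_L2[OF F(1)], symmetric]
    by (rule L2_inner_AE_cong[OF divergence_L2[OF F(1)] divergence_L2[OF F(1)] pert_L2[OF H1_fields_scale[OF F(2)]]
          L2.scale[OF pert_L2[OF F(2)]]])
       (use weak_jacobian_scale[OF F(2), of a] in \<open>auto simp: pert_def distrib_left elim: eventually_mono\<close>)
qed

lemma E_diff_right:
  assumes "u \<in> H1t" "v \<in> H1t" "w \<in> H1t"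
  shows "E u (\<lambda>x. v x - w x) = E u v - E u w"
  using E_add_right[OF assms(1,2) H1t_scale[OF assms(3)], of "-1"] E_scale_right[OF assms(1,3), of "-1"] by simp

lemma E_diff_left:
  assumes "u \<in> H1t" "v \<in> H1t" "w \<in> H1t"
  shows "E (\<lambda>x. u x - v x) w = E u w - E v w"
proof -
  note F = assms[THEN H1t_H1_fields]
  note F' = H1t_H1_fields[OF H1t.diff[OF assms(1,2)]]
  have s: "(\<lambda>x. -1 *\<^sub>R v x) \<in> H1_fields cube" by (rule H1_fields_scale[OF F(2)])
  have "AE x in cube_measure. weak_jacobian cube (\<lambda>x. u x + -1 *\<^sub>R v x) x
      = weak_jacobian cube u x + weak_jacobian cube (\<lambda>x. -1 *\<^sub>R v x) x"
    by (rule weak_jacobian_add[OF F(1) s])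
  with weak_jacobian_scale[OF F(2), of "-1"]
  have "AE x in cube_measure. divergence cube (\<lambda>x. u x - v x) x = divergence cube u x - divergence cube v x"
    by eventually_elim (simp add: divergence_eq_trace trace_eq_inner inner_diff_left)
  then show ?thesis
    unfolding E_def L2.ip_diff[OF divergence_L2[OF F(1)] divergence_L2[OF F(2)] pert_L2[OF F(3)], symmetric]
    by (intro L2_inner_AE_cong[OF divergence_L2[OF F'] L2.diff[OF divergence_L2[OF F(1)] divergence_L2[OF F(2)]]
          pert_L2[OF F(3)] pert_L2[OF F(3)]]) auto
qed

text \<open>The minus sign of the divergence cancels those of the scaled operator, which is minus
  divergence minus \<open>pert\<close>; the divergence and rotation products then add up to
  \<open>D_inner\<close>.\<close>

lemma form_eq:
  assumes u: "u \<in> H1t" and w: "w \<in> H1t"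
  shows "L2_inner cube_measure (\<lambda>x. - divergence cube u x) (\<lambda>x. gam A b x * Ltilde A b w x)
      + L2_inner cube_measure (rot u) (rot w) = D_inner u w + E u w"
proof -
  note F = u[THEN H1t_H1_fields] w[THEN H1t_H1_fields]
  have "- divergence cube u x * (gam A b x * Ltilde A b w x)
      = divergence cube u x * divergence cube w x + divergence cube u x * pert w x" for x
    by (simp add: Ltilde_def pert_def G_def g_def divergence_eq_trace[of w] trace_eq_inner inner_diff_left
        inner_commute[of "mat 1"] algebra_simps)
  then have "L2_inner cube_measure (\<lambda>x. - divergence cube u x) (\<lambda>x. gam A b x * Ltilde A b w x)
      = (LINT x|cube_measure. divergence cube u x * divergence cube w x + divergence cube u x * pert w x)"
    by (simp add: L2_inner_def)
  also have "\<dots> = L2_inner cube_measure (divergence cube u) (divergence cube w) + E u w"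
    using integrable_mult_L2[OF divergence_L2[OF F(1)] divergence_L2[OF F(2)]]
      integrable_mult_L2[OF divergence_L2[OF F(1)] pert_L2[OF F(2)]]
    by (simp add: L2_inner_def E_def)
  finally show ?thesis
    unfolding D_inner_eq_div_rot[OF R u w] rot[abs_def] by simp
qed

lemma solves_iff:
  assumes "V \<subseteq> H1t"
  shows "solves rot A b F V r \<longleftrightarrow> r \<in> V \<and> (\<forall>w\<in>V. D_inner r w + E r w = L2_inner cube_measure F w)"
proof (cases "r \<in> V")
  case True
  then have "L2_inner cube_measure (\<lambda>x. - divergence cube r x) (\<lambda>x. gam A b x * Ltilde A b w x)
      + L2_inner cube_measure (rot r) (rot w) = D_inner r w + E r w" if "w \<in> V" for w
    using that assms by (intro form_eq) auto
  then show ?thesis unfolding solves_def using True by simp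
qed (simp add: solves_def)

lemma coercive:
  assumes "d \<in> H1t"
  shows "(1 - \<kappa>) * (D_norm d)\<^sup>2 \<le> D_inner d d + E d d"
  using E_bound[OF assms assms] by (simp add: D_norm_square[OF assms, symmetric] power2_eq_square algebra_simps)

text \<open>Existence is \<open>perturbed_Riesz\<close> on \<open>P\<close>. For uniqueness the
  difference of two solutions is tested with itself: coercivity gives distance zero, and the
  Poincare inequality turns this into equality almost everywhere.\<close>

lemma unique_solution_exists:
  assumes P: "closed_subspace P" and F: "F \<in> L2 cube_measure"
  shows "\<exists>r. unique_solution rot A b F P r"
proof -
  have sub: "P \<subseteq> H1t" using P by (simp add: closed_subspace_def)
  note H = subsetD[OF sub]
  interpret P: complete_semi_inner_space P D_inner
    by (rule complete_semi_inner_space_D[OF P n2])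
  have sn: "P.sn = D_norm" by (rule sn_D_inner[OF P.semi_inner_space_axioms])
  have l: "P.bounded_functional (L2_inner cube_measure F)"
  proof (rule P.bounded_functionalI[where K = "L2_norm cube_measure F"])
    fix u v and a :: real assume u: "u \<in> P"
    note Lu = H1_fields_L2[OF H1t_H1_fields[OF H[OF u]]]
    show "L2_inner cube_measure F (\<lambda>x. a *\<^sub>R u x) = a * L2_inner cube_measure F u"
      by (rule L2.ip_scale_right[OF Lu F])
    \<comment> \<open>The load is bounded by the \<open>L2\<close> norm of \<open>u\<close>; since
      \<open>pi > 1\<close>, the Poincare inequality passes to \<open>D_norm\<close>.\<close>
    have "1 * L2_norm cube_measure u \<le> pi * L2_norm cube_measure u"
      using pi_gt3 by (intro mult_right_mono) auto
    then have "L2_norm cube_measure u \<le> D_norm u" using H1t_Poincare[OF H[OF u] n2] by simp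
    then have "L2_norm cube_measure F * L2_norm cube_measure u \<le> L2_norm cube_measure F * D_norm u"
      by (intro mult_left_mono) auto
    then show "\<bar>L2_inner cube_measure F u\<bar> \<le> L2_norm cube_measure F * P.sn u"
      unfolding sn using L2.Cauchy_Schwarz[OF F Lu] by linarith
    assume v: "v \<in> P"
    show "L2_inner cube_measure F (\<lambda>x. u x + v x) = L2_inner cube_measure F u + L2_inner cube_measure F v"
      by (rule L2.ip_add_right[OF Lu H1_fields_L2[OF H1t_H1_fields[OF H[OF v]]] F])
  qed simp
  have E: "P.bounded_functional (E u)" if u: "u \<in> P" for u
    by (rule P.bounded_functionalI[where K = "\<kappa> * D_norm u"])
       (use \<kappa> u H E_add_right E_scale_right E_bound in \<open>auto simp: sn\<close>)
  obtain r where r: "r \<in> P" "\<And>w. w \<in> P \<Longrightarrow> D_inner r w + E r w = L2_inner cube_measure F w"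
    by (rule P.perturbed_Riesz[OF l E E_diff_left _ \<kappa>(1,2)]) (use H E_bound in \<open>auto simp: sn\<close>)
  have "AE x in cube_measure. s x = r x" if s: "solves rot A b F P s" for s
  proof -
    have s: "s \<in> P" "\<And>w. w \<in> P \<Longrightarrow> D_inner s w + E s w = L2_inner cube_measure F w"
      using s unfolding solves_iff[OF sub] by auto
    let ?d = "\<lambda>x. s x - r x"
    have dP: "?d \<in> P" by (rule P.diff[OF s(1) r(1)])
    have "D_inner ?d ?d + E ?d ?d = 0"
      using s(2)[OF dP] r(2)[OF dP] by (simp add: P.ip_diff[OF s(1) r(1) dP] E_diff_left[OF H[OF s(1)] H[OF r(1)] H[OF dP]])
    then have "(1 - \<kappa>) * (D_norm ?d)\<^sup>2 \<le> 0" using coercive[OF H[OF dP]] by simp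
    then have "D_norm ?d = 0" using \<kappa>(2) by (simp add: mult_le_0_iff)
    then have "L2_norm cube_measure ?d \<le> 0"
      using H1t_Poincare[OF H[OF dP] n2] pi_gt_zero by (simp add: mult_le_0_iff)
    then have "L2_norm cube_measure ?d = 0" by (simp add: order_antisym)
    then have "AE x in cube_measure. s x - r x = 0"
      by (rule L2_norm_eq_0[OF H1_fields_L2[OF H1t_H1_fields[OF H[OF dP]]]])
    then show ?thesis by eventually_elim simp
  qed
  then show ?thesis unfolding unique_solution_def using r solves_iff[OF sub] by blast
qed

text \<open>The constant is the continuity bound \<open>1 + \<kappa>\<close> over the coercivity
  bound \<open>1 - \<kappa>\<close>. What is estimated is \<open>D_norm\<close> of the error, which
  dominates its divergence with constant one.\<close>

lemma quasi_optimal: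
  assumes P: "closed_subspace P" and \<rho>: "solves rot A b F H1t \<rho>" and \<rho>h: "solves rot A b F P \<rho>h" and w: "w \<in> P"
  shows "L2_norm cube_measure (divergence cube (\<lambda>x. \<rho> x - \<rho>h x)) \<le> (1 + \<kappa>) / (1 - \<kappa>) * D_norm (\<lambda>x. \<rho> x - w x)"
proof -
  have sub: "P \<subseteq> H1t" using P by (simp add: closed_subspace_def)
  interpret P: semi_inner_space P D_inner
    using complete_semi_inner_space_D[OF P n2] by (rule complete_semi_inner_space.axioms(1))
  have \<rho>': "\<rho> \<in> H1t" "\<And>v. v \<in> H1t \<Longrightarrow> D_inner \<rho> v + E \<rho> v = L2_inner cube_measure F v"
    using \<rho> unfolding solves_iff[OF subset_refl] by auto
  have \<rho>h': "\<rho>h \<in> P" "\<And>v. v \<in> P \<Longrightarrow> D_inner \<rho>h v + E \<rho>h v = L2_inner cube_measure F v"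
    using \<rho>h unfolding solves_iff[OF sub] by auto
  have H: "\<rho>h \<in> H1t" "w \<in> H1t" using \<rho>h'(1) w sub by auto
  let ?e = "\<lambda>x. \<rho> x - \<rho>h x" and ?q = "\<lambda>x. \<rho> x - w x" and ?v = "\<lambda>x. w x - \<rho>h x"
  have e: "?e \<in> H1t" and q: "?q \<in> H1t" and v: "?v \<in> H1t"
    using \<rho>'(1) H by (auto intro: H1t.diff)
  have vP: "?v \<in> P" by (rule P.diff[OF w \<rho>h'(1)])
  \<comment> \<open>Galerkin orthogonality: \<open>w - \<rho>h\<close> is an admissible test field
    in both problems.\<close>
  have orth: "D_inner ?e ?v + E ?e ?v = 0"
    using \<rho>'(2)[OF v] \<rho>h'(2)[OF vP]
    by (simp add: H1t.ip_diff[OF \<rho>'(1) H(1) v] E_diff_left[OF \<rho>'(1) H(1) v])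
  have ve: "?v = (\<lambda>x. ?e x - ?q x)" by auto
  have "D_inner ?e ?e + E ?e ?e = D_inner ?e ?q + E ?e ?q"
    using orth unfolding ve H1t.ip_diff_right[OF e q e] E_diff_right[OF e e q] by simp
  then have "(1 - \<kappa>) * (D_norm ?e)\<^sup>2 \<le> D_inner ?e ?q + E ?e ?q" using coercive[OF e] by simp
  also have "\<dots> \<le> D_norm ?e * D_norm ?q + \<kappa> * D_norm ?e * D_norm ?q"
    using H1t.Cauchy_Schwarz[OF e q] E_bound[OF e q] by linarith
  finally have "((1 - \<kappa>) * D_norm ?e) * D_norm ?e \<le> ((1 + \<kappa>) * D_norm ?q) * D_norm ?e"
    by (simp add: power2_eq_square algebra_simps)
  then have "(1 - \<kappa>) * D_norm ?e \<le> (1 + \<kappa>) * D_norm ?q"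
    using \<kappa> mult_right_le_imp_le[of "(1 - \<kappa>) * D_norm ?e" "D_norm ?e" "(1 + \<kappa>) * D_norm ?q"]
    by (cases "D_norm ?e = 0") (auto simp: less_le)
  then have "D_norm ?e \<le> (1 + \<kappa>) / (1 - \<kappa>) * D_norm ?q" using \<kappa>(2) by (simp add: field_simps)
  with divergence_norm[OF e] show ?thesis by linarith
qed

text \<open>The constant can precede \<open>f\<close>, \<open>F\<close> and \<open>P\<close> because
  \<open>\<kappa>\<close> depends only on \<open>\<delta>\<close> and on whether the norm of
  \<open>b\<close> is zero.\<close>

lemma error_estimate:
  "\<exists>C>0. \<forall>(f :: real^'n \<Rightarrow> real) F (P :: (real^'n \<Rightarrow> real^'n) set).
     f \<in> L2 cube_measure \<and> F \<in> H1_fields cube \<and>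
     (AE x in cube_measure. f x = - divergence cube F x) \<and> closed_subspace P \<longrightarrow>
     (\<exists>\<rho>. unique_solution rot A b F H1t \<rho>) \<and>
     (\<forall>\<rho>. unique_solution rot A b F H1t \<rho> \<longrightarrow>
        (\<exists>\<rho>h. unique_solution rot A b F P \<rho>h \<and>
           L2_norm cube_measure (divergence cube (\<lambda>x. \<rho> x - \<rho>h x))
             \<le> C * (INF w\<in>P. L2_norm cube_measure (weak_jacobian cube (\<lambda>x. \<rho> x - w x)))))"
proof (intro exI[of _ "(1 + \<kappa>) / (1 - \<kappa>)"] conjI allI impI)
  show C: "(1 + \<kappa>) / (1 - \<kappa>) > 0" using \<kappa> by simp
  fix f :: "real^'n \<Rightarrow> real" and F :: "real^'n \<Rightarrow> real^'n" and P :: "(real^'n \<Rightarrow> real^'n) set"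
  assume as: "f \<in> L2 cube_measure \<and> F \<in> H1_fields cube \<and>
     (AE x in cube_measure. f x = - divergence cube F x) \<and> closed_subspace P"
  then have P: "closed_subspace P" and F: "F \<in> L2 cube_measure" by (auto intro: H1_fields_L2)
  show "\<exists>\<rho>. unique_solution rot A b F H1t \<rho>"
    by (rule unique_solution_exists[OF closed_subspace_H1t F])
  fix \<rho> assume \<rho>: "unique_solution rot A b F H1t \<rho>"
  obtain \<rho>h where \<rho>h: "unique_solution rot A b F P \<rho>h" using unique_solution_exists[OF P F] by blast
  let ?L = "L2_norm cube_measure (divergence cube (\<lambda>x. \<rho> x - \<rho>h x))"
  \<comment> \<open>Dividing by the positive constant makes the left side a lower bound of all
    approximation errors, hence at most their infimum.\<close>
  have "?L / ((1 + \<kappa>) / (1 - \<kappa>)) \<le> (INF w\<in>P. L2_norm cube_measure (weak_jacobian cube (\<lambda>x. \<rho> x - w x)))"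
  proof (rule cINF_greatest)
    show "P \<noteq> {}" using P by (auto simp: closed_subspace_def)
    fix w assume w: "w \<in> P"
    have "?L \<le> (1 + \<kappa>) / (1 - \<kappa>) * D_norm (\<lambda>x. \<rho> x - w x)"
      by (rule quasi_optimal[OF P _ _ w]) (use \<rho> \<rho>h in \<open>auto simp: unique_solution_def\<close>)
    then show "?L / ((1 + \<kappa>) / (1 - \<kappa>)) \<le> L2_norm cube_measure (weak_jacobian cube (\<lambda>x. \<rho> x - w x))"
      unfolding D_norm_def pos_divide_le_eq[OF C] by (simp only: mult.commute)
  qed
  then have "?L \<le> (1 + \<kappa>) / (1 - \<kappa>) * (INF w\<in>P. L2_norm cube_measure (weak_jacobian cube (\<lambda>x. \<rho> x - w x)))"
    unfolding pos_divide_le_eq[OF C] by (simp only: mult.commute)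
  with \<rho>h show "\<exists>\<rho>h. unique_solution rot A b F P \<rho>h \<and>
           L2_norm cube_measure (divergence cube (\<lambda>x. \<rho> x - \<rho>h x))
             \<le> (1 + \<kappa>) / (1 - \<kappa>) * (INF w\<in>P. L2_norm cube_measure (weak_jacobian cube (\<lambda>x. \<rho> x - w x)))"
    by blast
qed

end

text \<open>For any size, \<open>M \<bullet> N - M \<bullet> transpose N\<close> is the sum over
  index pairs i < j of (M_ij - M_ji)(N_ij - N_ji). The plane has one such pair and space has three,
  which are the components of the rotation up to sign.\<close>

lemma inner_antisym_2:
  fixes M N :: "real^2^2"
  shows "(M $ 1 $ 2 - M $ 2 $ 1) \<bullet> (N $ 1 $ 2 - N $ 2 $ 1) = M \<bullet> N - M \<bullet> transpose N"
  by (simp add: inner_matrix sum_2 transpose_def algebra_simps)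

lemma inner_antisym_3:
  fixes M N :: "real^3^3"
  shows "(vector [M $ 3 $ 2 - M $ 2 $ 3, M $ 1 $ 3 - M $ 3 $ 1, M $ 2 $ 1 - M $ 1 $ 2] :: real^3)
      \<bullet> vector [N $ 3 $ 2 - N $ 2 $ 3, N $ 1 $ 3 - N $ 3 $ 1, N $ 2 $ 1 - N $ 1 $ 2]
    = M \<bullet> N - M \<bullet> transpose N"
  by (simp add: inner_matrix inner_vec_def sum_3 vector_3 transpose_def algebra_simps)

theorem theorem6p2:
  shows "(\<forall>(A :: real^2 \<Rightarrow> real^2^2) (b :: real^2 \<Rightarrow> real^2) (\<delta> :: real).
      A \<in> Linf cube_measure \<and> (AE x in cube_measure. transpose (A x) = A x) \<and>
      uniformly_elliptic A \<and> b \<in> Linf cube_measure \<and>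
      delta0 b < \<delta> \<and> \<delta> \<le> 1 \<and>
      (AE x in cube_measure.
         ((norm (A x))\<^sup>2 + (norm (b x))\<^sup>2) / (trace (A x))\<^sup>2
           \<le> 1 / (real CARD(2) - 1 + \<delta>)) \<longrightarrow>
      (\<exists>C>0. \<forall>(f :: real^2 \<Rightarrow> real) F P.
         f \<in> L2 cube_measure \<and> F \<in> H1_fields cube \<and>
         (AE x in cube_measure. f x = - divergence cube F x) \<and> closed_subspace P \<longrightarrow>
         (\<exists>\<rho>. unique_solution (rot2 cube) A b F H1t \<rho>) \<and>
         (\<forall>\<rho>. unique_solution (rot2 cube) A b F H1t \<rho> \<longrightarrow>
            (\<exists>\<rho>h. unique_solution (rot2 cube) A b F P \<rho>h \<and>
               L2_norm cube_measure (divergence cube (\<lambda>x. \<rho> x - \<rho>h x))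
                 \<le> C * (INF w\<in>P. L2_norm cube_measure (weak_jacobian cube (\<lambda>x. \<rho> x - w x)))))))
    \<and>
    (\<forall>(A :: real^3 \<Rightarrow> real^3^3) (b :: real^3 \<Rightarrow> real^3) (\<delta> :: real).
      A \<in> Linf cube_measure \<and> (AE x in cube_measure. transpose (A x) = A x) \<and>
      uniformly_elliptic A \<and> b \<in> Linf cube_measure \<and>
      delta0 b < \<delta> \<and> \<delta> \<le> 1 \<and>
      (AE x in cube_measure.
         ((norm (A x))\<^sup>2 + (norm (b x))\<^sup>2) / (trace (A x))\<^sup>2
           \<le> 1 / (real CARD(3) - 1 + \<delta>)) \<longrightarrow>
      (\<exists>C>0. \<forall>(f :: real^3 \<Rightarrow> real) F P.
         f \<in> L2 cube_measure \<and> F \<in> H1_fields cube \<and>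
         (AE x in cube_measure. f x = - divergence cube F x) \<and> closed_subspace P \<longrightarrow>
         (\<exists>\<rho>. unique_solution (rot3 cube) A b F H1t \<rho>) \<and>
         (\<forall>\<rho>. unique_solution (rot3 cube) A b F H1t \<rho> \<longrightarrow>
            (\<exists>\<rho>h. unique_solution (rot3 cube) A b F P \<rho>h \<and>
               L2_norm cube_measure (divergence cube (\<lambda>x. \<rho> x - \<rho>h x))
                 \<le> C * (INF w\<in>P. L2_norm cube_measure (weak_jacobian cube (\<lambda>x. \<rho> x - w x)))))))"
proof (intro conjI allI impI, goal_cases)
  case (1 A b \<delta>)
  then have h: "A \<in> Linf cube_measure" "uniformly_elliptic A" "b \<in> Linf cube_measure" "delta0 b < \<delta>" "\<delta> \<le> 1"
    "AE x in cube_measure. ((norm (A x))\<^sup>2 + (norm (b x))\<^sup>2) / (trace (A x))\<^sup>2 \<le> 1 / (real CARD(2) - 1 + \<delta>)"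
    by blast+
  interpret Cordes_problem A b \<delta>
    "\<lambda>M. M $ 1 $ 2 - M $ 2 $ 1" "rot2 cube"
  proof (rule Cordes_problem.intro[OF _ h inner_antisym_2])
    show "rot2 cube w x = weak_jacobian cube w x $ 1 $ 2 - weak_jacobian cube w x $ 2 $ 1" for w x
      by (simp add: rot2_def weak_jacobian_def)
  qed simp
  show ?case by (rule error_estimate)
next
  case (2 A b \<delta>)
  then have h: "A \<in> Linf cube_measure" "uniformly_elliptic A" "b \<in> Linf cube_measure" "delta0 b < \<delta>" "\<delta> \<le> 1"
    "AE x in cube_measure. ((norm (A x))\<^sup>2 + (norm (b x))\<^sup>2) / (trace (A x))\<^sup>2 \<le> 1 / (real CARD(3) - 1 + \<delta>)"
    by blast+
  interpret Cordes_problem A b \<delta>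
    "\<lambda>M. vector [M $ 3 $ 2 - M $ 2 $ 3, M $ 1 $ 3 - M $ 3 $ 1, M $ 2 $ 1 - M $ 1 $ 2]" "rot3 cube"
  proof (rule Cordes_problem.intro[OF _ h inner_antisym_3])
    show "rot3 cube w x = vector [weak_jacobian cube w x $ 3 $ 2 - weak_jacobian cube w x $ 2 $ 3,
        weak_jacobian cube w x $ 1 $ 3 - weak_jacobian cube w x $ 3 $ 1, weak_jacobian cube w x $ 2 $ 1 - weak_jacobian cube w x $ 1 $ 2]" for w x
      by (simp add: rot3_def weak_jacobian_def)
  qed simp
  show ?case by (rule error_estimate)
qed

end
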